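(* Let $d\ge 2$ and $k\geq d+2$ with $\frac1{d+1}+\frac1{k-d-1}>\frac12$ and $(k,d)\neq(8,4)$. The $(k,d)$-Mukai edge graph is a subgraph of the vertex-edge graph of any $(k,d)$-KD polytope (where a vertex $D$ of the Mukai edge graph is identified with the lattice point $P_D$ of the polytope given by the generator of multidegree $D$). Therefore, a $(k,d)$-KD polytope with minimal number of edges has the $(k,d)$-Mukai edge graph as vertex-edge graph.
   Context: $X_{k,d}$ is the blow-up of $\mathbb{P}^d$ over $\mathbb{C}$ at $k$ generic points, with $\operatorname{Pic}(X_{k,d})\cong\mathbb{Z}^{k+1}$ free on the hyperplane class $H$ and the exceptional classes $E_1,\dots,E_k$. The Mukai bilinear form is given by $(H,H)=d-1$, $(H,E_i)=0$, $(E_i,E_j)=-\delta_{i,j}$. The canonical class is $K_{k,d}=-(d+1)H+(d-1)\sum_iE_i$, and the anticanonical degree of $D$ is $\frac1{d-1}(-K_{k,d},D)$. *Mukai edge graph.* Consider the graph whose vertices are the effective divisor classes of anticanonical degree one, two being joined by an edge iff their Mukai product is zero. The $(k,d)$-Mukai edge graph is the connected component containing $E_1$. *Weyl group.* Identify $m_0H-\sum_i m_iE_i$ with $[n_0,n_1,\dots,n_k]=[m_0,m_0-m_1,\dots,m_0-m_k]\in\mathbb{Z}^{k+1}$. The Weyl group is generated by the permutations of the last $k$ entries and the Cremona element $[n_0,\dots,n_k]\mapsto[n_0',n_1,\dots,n_{d+1},n_0'-n_0+n_{d+2},\dots,n_0'-n_0+n_k]$ with $n_0'=\sum_{i=1}^{d+1}n_i-n_0$.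 For a class $D$ in the Weyl orbit of $E_1$ one has $\dim H^0(X_{k,d},D)=1$. For the given $(k,d)$, the effective classes of anticanonical degree one are exactly the Weyl orbit of $E_1$, together with $-K_{8,2}$ if $(k,d)=(8,2)$ and $-\frac12K_{7,3}$ if $(k,d)=(7,3)$. *The map $\phi_{k,d}(t)$.* Let $P=(p_1,\dots,p_k)$ be the $(d+1)\times k$ matrix over $\mathbb{C}(t)$ whose columns represent points of $\mathbb{P}(\mathbb{C}(t)^{d+1})$. For each effective class $D=m_0H-\sum m_iE_i$ of anticanonical degree one with $m_0>0$, put $h^0(D)=\dim_{\mathbb{C}}H^0(X_{k,d},D)$ (value for generic points) and choose a basis $f_1^D,\dots,f^D_{h^0(D)}$ of the linear system of degree-$m_0$ forms over $\mathbb{C}(t)$ vanishing at $p_i$ with multiplicity at least $m_i$ for all $i$. The points are in *general position* if all $f_i^D$ are nonzero, meaning that each of these linear systems has dimension exactly $h^0(D)$. Let $G_{k,d}$ index the variables $x_{E_i}$ ($1\le i\le k$) and $x_{D,i}$ ($1\le i\le h^0(D)$, $D=m_0H-\sum m_iE_i$ ranging over the effective classes of anticanonical degree one with $m_0>0$), and define the $\mathbb{C}(t)$-algebra map $$\phi_{k,d}(t):\mathbb{C}(t)[G_{k,d}]\to\mathbb{C}(t)[x_1,\dots,x_k,y_1,\dots,y_k],\quad x_{E_i}\mapsto x_i,\quad x_{D,i}\mapsto f_i^D\big(P\cdot\tfrac yx\big)x_1^{m_0-m_1}\cdots x_k^{m_0-m_k},$$ where $\frac yx=(\frac{y_1}{x_1},\dots,\frac{y_k}{x_k})^T$.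 Each variable has as multidegree the corresponding class ($E_i$ or $D$). *Khovanskii bases.* For nonzero $f\in\mathbb{C}(t)[z_1,\dots,z_m]$, $\operatorname{ord}(f)$ is the integer such that $t^{-\operatorname{ord}(f)}f$ has neither a pole nor a zero at $t=0$, and $\operatorname{in}_{\mathbf 0}(f)=(t^{-\operatorname{ord}(f)}f)|_{t=0}\in\mathbb{C}[z_1,\dots,z_m]$. A Khovanskii basis of a $\mathbb{C}(t)$-subalgebra $R$ is a set $\mathcal F$ of generators of $R$ such that $\operatorname{in}_{\mathbf 0}(f)$ is a monomial (up to a nonzero scalar) for all $f\in\mathcal F$ and the $\mathbb{C}$-algebra $\operatorname{in}_{\mathbf 0}(R)$ of initial forms of elements of $R$ is generated by $\operatorname{in}_{\mathbf 0}(\mathcal F)$. Such a basis gives a flat degeneration of $R$ to the toric variety defined by the kernel of the map sending the variable of $f\in\mathcal F$ to $\operatorname{in}_{\mathbf 0}(f)$. *KD polytopes.* A $(k,d)$-Khovanskii degeneration (KD) polytope is the $(k+d)$-dimensional polytope associated to a normal toric degeneration of $\operatorname{im}(\phi_{k,d}(t))$ for points in general position. Precisely, it is the convex hull of the exponent vectors of the initial monomials of the elements $\phi_{k,d}(t)(G_{k,d})$ (images of the variables), whenever these elements form a Khovanskii basis of $\operatorname{im}(\phi_{k,d}(t))$ and the corresponding toric variety is normal. For $D$ in the Weyl orbit of $E_1$, $P_D$ is the exponent vector of the initial monomial of the unique generator of multidegree $D$. The vertex-edge graph of a polytope is the graph of its vertices and edges ($1$-dimensional faces).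
   Formalization: "Minimal number of edges" is read as having exactly as many edges as the Mukai edge graph (a proved lower bound); minimal among all KD polytopes fails for (k,d)=(4,2), where they are 6-dimensional with 10 vertices, so not simple, and have more than the Mukai graph's 30 edges. *)

theory Defs
  imports
    "HOL-Analysis.Analysis"
    "HOL-Library.Poly_Mapping"
    "HOL-Computational_Algebra.Polynomial"
    "HOL-Computational_Algebra.Fraction_Field"
begin

section \<open>Polynomials and Laurent polynomials\<close>

text \<open>
  An element of \<^typ>\<open>('v \<Rightarrow>\<^sub>0 nat) \<Rightarrow>\<^sub>0 'c\<close> is a polynomial over \<^typ>\<open>'c\<close> in the variables \<^typ>\<open>'v\<close>;
  with integer exponents it is a Laurent polynomial.
\<close>

type_synonym ('v, 'c) pol = "('v \<Rightarrow>\<^sub>0 nat) \<Rightarrow>\<^sub>0 'c"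
type_synonym ('v, 'c) laurent = "('v \<Rightarrow>\<^sub>0 int) \<Rightarrow>\<^sub>0 'c"

definition const :: "'c \<Rightarrow> ('e::comm_monoid_add \<Rightarrow>\<^sub>0 'c::comm_ring_1)" where
  "const c = Poly_Mapping.single 0 c"

definition monom_of :: "'e \<Rightarrow> ('e::comm_monoid_add \<Rightarrow>\<^sub>0 'c::comm_ring_1)" where
  "monom_of \<alpha> = Poly_Mapping.single \<alpha> 1"

definition pvar :: "'v \<Rightarrow> ('v, 'c::comm_ring_1) pol" where
  "pvar v = monom_of (Poly_Mapping.single v 1)"

definition pvars :: "('v, 'c::zero) pol \<Rightarrow> 'v set" where
  "pvars f = (\<Union>\<alpha>\<in>Poly_Mapping.keys f. Poly_Mapping.keys \<alpha>)"

definition tdeg :: "('v \<Rightarrow>\<^sub>0 nat) \<Rightarrow> nat" where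
  "tdeg \<alpha> = (\<Sum>v\<in>Poly_Mapping.keys \<alpha>. Poly_Mapping.lookup \<alpha> v)"

text \<open>Substitute \<open>g v\<close> for each variable \<open>v\<close>; coefficients are mapped by \<open>h\<close>.\<close>

definition subst_pol :: "('c \<Rightarrow> 'a) \<Rightarrow> ('v \<Rightarrow> 'a) \<Rightarrow> ('v, 'c::zero) pol \<Rightarrow> 'a::comm_ring_1" where
  "subst_pol h g f = (\<Sum>\<alpha>\<in>Poly_Mapping.keys f. h (Poly_Mapping.lookup f \<alpha>) *
      (\<Prod>v\<in>Poly_Mapping.keys \<alpha>. g v ^ Poly_Mapping.lookup \<alpha> v))"

definition mp_scale :: "'c \<Rightarrow> ('e::comm_monoid_add \<Rightarrow>\<^sub>0 'c::comm_ring_1) \<Rightarrow> ('e \<Rightarrow>\<^sub>0 'c)" where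
  "mp_scale c f = const c * f"

interpretation mp: vector_space "mp_scale :: 'c::field \<Rightarrow> ('e::comm_monoid_add \<Rightarrow>\<^sub>0 'c) \<Rightarrow> ('e \<Rightarrow>\<^sub>0 'c)"
  by unfold_locales
    (simp_all add: mp_scale_def const_def algebra_simps single_add mult_single
      flip: mult.assoc)

text \<open>The subalgebra (over the coefficient ring) generated by a set.\<close>

inductive_set alg_gen :: "('e::comm_monoid_add \<Rightarrow>\<^sub>0 'c::comm_ring_1) set \<Rightarrow> ('e \<Rightarrow>\<^sub>0 'c) set"
  for S where
  const: "const c \<in> alg_gen S"
| gen: "f \<in> S \<Longrightarrow> f \<in> alg_gen S"
| add: "f \<in> alg_gen S \<Longrightarrow> g \<in> alg_gen S \<Longrightarrow> f + g \<in> alg_gen S"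
| mult: "f \<in> alg_gen S \<Longrightarrow> g \<in> alg_gen S \<Longrightarrow> f * g \<in> alg_gen S"

section \<open>Divisor classes on the blow-up\<close>

text \<open>
  The number of points is \<^term>\<open>CARD('n)\<close>, and the points and exceptional classes are indexed
  by \<^typ>\<open>'n\<close>.  The pair \<open>(m0, m)\<close> stands for \<open>m0 H - (\<Sum>i. m i E i)\<close>; note the sign.
\<close>

type_synonym 'n divcls = "int \<times> (int ^ 'n)"

definition exc :: "'n::finite \<Rightarrow> 'n divcls" where
  "exc i = (0, - axis i 1)"

definition mukai_form :: "nat \<Rightarrow> 'n::finite divcls \<Rightarrow> 'n divcls \<Rightarrow> int" where
  "mukai_form d D D' = (int d - 1) * fst D * fst D' - (\<Sum>i\<in>UNIV. snd D $ i * snd D' $ i)"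

definition canon :: "nat \<Rightarrow> 'n::finite divcls" where
  "canon d = (- (int d + 1), \<chi> i. - (int d - 1))"

definition antican_deg :: "nat \<Rightarrow> 'n::finite divcls \<Rightarrow> real" where
  "antican_deg d D = 1 / (real d - 1) * of_int (mukai_form d (- canon d) D)"

text \<open>
  A form vanishes at a point of projective space with multiplicity at least \<open>m\<close> iff its Taylor
  expansion around any representative of the point has no terms of degree less than \<open>m\<close>;
  for \<open>m \<le> 0\<close> there is no condition.  The coordinates are indexed by \<open>{..d}\<close>.
\<close>

definition vanishes_at :: "(nat, 'c::comm_ring_1) pol \<Rightarrow> (nat \<Rightarrow> 'c) \<Rightarrow> int \<Rightarrow> bool" where
  "vanishes_at f p m \<longleftrightarrow>
     (\<forall>\<alpha>\<in>Poly_Mapping.keys (subst_pol const (\<lambda>l. const (p l) + pvar l) f :: (nat, 'c) pol).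
        m \<le> int (tdeg \<alpha>))"

definition linsys :: "nat \<Rightarrow> ('n::finite \<Rightarrow> nat \<Rightarrow> 'c::comm_ring_1) \<Rightarrow> 'n divcls \<Rightarrow> (nat, 'c) pol set" where
  "linsys d P D = {f. pvars f \<subseteq> {..d} \<and>
     (\<forall>\<alpha>\<in>Poly_Mapping.keys f. int (tdeg \<alpha>) = fst D) \<and>
     (\<forall>i. vanishes_at f (P i) (snd D $ i))}"

text \<open>
  A property holds for generic complex points if it holds on some nonempty basic Zariski open
  set of coordinate matrices.
\<close>

definition generically :: "nat \<Rightarrow> (('n::finite \<Rightarrow> nat \<Rightarrow> complex) \<Rightarrow> bool) \<Rightarrow> bool" where
  "generically d R \<longleftrightarrow> (\<exists>g :: ('n \<times> nat, complex) pol. g \<noteq> 0 \<and> pvars g \<subseteq> UNIV \<times> {..d} \<and>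
     (\<forall>P. subst_pol (\<lambda>c. c) (\<lambda>(i, l). P i l) g \<noteq> 0 \<longrightarrow> R P))"

text \<open>
  Sections of the line bundle of \<open>(m0, m)\<close> on the blow-up are the forms of degree \<open>m0\<close> with
  multiplicity at least \<open>m i\<close> at the points.
\<close>

definition h0 :: "nat \<Rightarrow> 'n::finite divcls \<Rightarrow> nat" where
  "h0 d D = (THE n. generically d (\<lambda>P. mp.dim (linsys d P D) = n))"

definition eff_deg_one :: "nat \<Rightarrow> 'n::finite divcls set" where
  "eff_deg_one d = {D. h0 d D > 0 \<and> antican_deg d D = 1}"

section \<open>Graphs\<close>

type_synonym 'a graph = "'a set \<times> 'a set set"

definition relabel :: "('a \<Rightarrow> 'b) \<Rightarrow> 'a graph \<Rightarrow> 'b graph" where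
  "relabel f \<Gamma> = (f ` fst \<Gamma>, (\<lambda>e. f ` e) ` snd \<Gamma>)"

definition subgraph :: "'a graph \<Rightarrow> 'a graph \<Rightarrow> bool" where
  "subgraph \<Gamma> \<Delta> \<longleftrightarrow> fst \<Gamma> \<subseteq> fst \<Delta> \<and> snd \<Gamma> \<subseteq> snd \<Delta>"

definition mukai_adj :: "nat \<Rightarrow> 'n::finite divcls \<Rightarrow> 'n divcls \<Rightarrow> bool" where
  "mukai_adj d D D' \<longleftrightarrow> D \<in> eff_deg_one d \<and> D' \<in> eff_deg_one d \<and> D \<noteq> D' \<and> mukai_form d D D' = 0"

text \<open>The connected component of \<open>exc a\<close>; the index \<open>a\<close> plays the role of the first point.\<close>

definition mukai_edge_graph :: "nat \<Rightarrow> 'n::finite \<Rightarrow> 'n divcls graph" where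
  "mukai_edge_graph d a = (let V = {D. (mukai_adj d)\<^sup>*\<^sup>* (exc a) D}
     in (V, {{D, D'} | D D'. D \<in> V \<and> D' \<in> V \<and> mukai_adj d D D'}))"

definition vertex_edge_graph :: "'a::euclidean_space set \<Rightarrow> 'a graph" where
  "vertex_edge_graph Q =
     ({v. v extreme_point_of Q}, {{u, v} | u v. closed_segment u v edge_of Q})"

section \<open>Initial forms and Khovanskii bases\<close>

type_synonym ratfun = "complex poly fract"

definition tt :: ratfun where
  "tt = Fract [:0, 1:] 1"

text \<open>\<open>value0 c v\<close>: the rational function \<open>c\<close> has no pole at \<open>t = 0\<close> and takes the value \<open>v\<close> there.\<close>

definition value0 :: "ratfun \<Rightarrow> complex \<Rightarrow> bool" where
  "value0 c v \<longleftrightarrow> (\<exists>p q. poly q 0 \<noteq> 0 \<and> c = Fract p q \<and> v = poly p 0 / poly q 0)"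

definition specializes :: "('e \<Rightarrow>\<^sub>0 ratfun) \<Rightarrow> ('e \<Rightarrow>\<^sub>0 complex) \<Rightarrow> bool" where
  "specializes f g \<longleftrightarrow> (\<forall>\<alpha>. value0 (Poly_Mapping.lookup f \<alpha>) (Poly_Mapping.lookup g \<alpha>))"

definition ord0 :: "('e::comm_monoid_add \<Rightarrow>\<^sub>0 ratfun) \<Rightarrow> int" where
  "ord0 f = (THE n. \<exists>g. g \<noteq> 0 \<and> specializes (mp_scale (tt powi (- n)) f) g)"

definition init0 :: "('e::comm_monoid_add \<Rightarrow>\<^sub>0 ratfun) \<Rightarrow> ('e \<Rightarrow>\<^sub>0 complex)" where
  "init0 f = (THE g. specializes (mp_scale (tt powi (- ord0 f)) f) g)"

definition is_monomial :: "('e \<Rightarrow>\<^sub>0 complex) \<Rightarrow> bool" where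
  "is_monomial g \<longleftrightarrow> (\<exists>\<alpha> c. c \<noteq> 0 \<and> g = Poly_Mapping.single \<alpha> c)"

definition exponent :: "('e \<Rightarrow>\<^sub>0 complex) \<Rightarrow> 'e" where
  "exponent g = (THE \<alpha>. \<exists>c. c \<noteq> 0 \<and> g = Poly_Mapping.single \<alpha> c)"

definition khovanskii_basis ::
    "('e::comm_monoid_add \<Rightarrow>\<^sub>0 ratfun) set \<Rightarrow> ('e \<Rightarrow>\<^sub>0 ratfun) set \<Rightarrow> bool" where
  "khovanskii_basis R F \<longleftrightarrow> alg_gen F = R \<and>
     (\<forall>f\<in>F. f \<noteq> 0 \<and> is_monomial (init0 f)) \<and>
     alg_gen (init0 ` (R - {0})) = alg_gen (init0 ` F)"

text \<open>
  A domain \<open>A\<close> is normal if every fraction \<open>a / b\<close> that is integral over \<open>A\<close> lies in \<open>A\<close>; the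
  monic equation for \<open>a / b\<close> is written with the denominators cleared.
\<close>

definition integrally_closed :: "'r::comm_ring_1 set \<Rightarrow> bool" where
  "integrally_closed A \<longleftrightarrow> (\<forall>a\<in>A. \<forall>b\<in>A. b \<noteq> 0 \<longrightarrow>
     (\<exists>n>0. \<exists>c. (\<forall>i<n. c i \<in> A) \<and> a ^ n + (\<Sum>i<n. c i * a ^ i * b ^ (n - i)) = 0) \<longrightarrow>
     (\<exists>q\<in>A. a = q * b))"

section \<open>The parametrization and Khovanskii degeneration polytopes\<close>

datatype 'n xy = XV 'n | YV 'n

datatype 'n::finite gvar = VE 'n | VD "'n divcls" nat

fun multideg :: "'n::finite gvar \<Rightarrow> 'n divcls" where
  "multideg (VE i) = exc i"
| "multideg (VD D j) = D"

definition gvars :: "nat \<Rightarrow> 'n::finite gvar set" where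
  "gvars d = range VE \<union> {VD D j | D j. D \<in> eff_deg_one d \<and> fst D > 0 \<and> j \<in> {1..h0 d D}}"

definition general_position :: "nat \<Rightarrow> ('n::finite \<Rightarrow> nat \<Rightarrow> ratfun) \<Rightarrow> bool" where
  "general_position d P \<longleftrightarrow>
     (\<forall>D\<in>eff_deg_one d. fst D > 0 \<longrightarrow> mp.dim (linsys d P D) = h0 d D)"

definition linsys_bases ::
    "nat \<Rightarrow> ('n::finite \<Rightarrow> nat \<Rightarrow> ratfun) \<Rightarrow> ('n divcls \<Rightarrow> nat \<Rightarrow> (nat, ratfun) pol) \<Rightarrow> bool" where
  "linsys_bases d P F \<longleftrightarrow> (\<forall>D\<in>eff_deg_one d. fst D > 0 \<longrightarrow>
     inj_on (F D) {1..h0 d D} \<and> \<not> mp.dependent (F D ` {1..h0 d D}) \<and>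
     mp.span (F D ` {1..h0 d D}) = linsys d P D)"

text \<open>
  The map is written with values in Laurent polynomials, where \<open>y / x\<close> makes sense; the images of
  the variables lie in the subring of polynomials, so image, initial forms and exponents are the
  same as with values in the polynomial ring.
\<close>

fun phi_var :: "('n::finite \<Rightarrow> nat \<Rightarrow> ratfun) \<Rightarrow> ('n divcls \<Rightarrow> nat \<Rightarrow> (nat, ratfun) pol) \<Rightarrow>
    'n gvar \<Rightarrow> ('n xy, ratfun) laurent" where
  "phi_var P F (VE i) = monom_of (Poly_Mapping.single (XV i) 1)"
| "phi_var P F (VD D j) =
     subst_pol const (\<lambda>l. \<Sum>i\<in>UNIV. const (P i l) *
         monom_of (Poly_Mapping.single (YV i) 1 - Poly_Mapping.single (XV i) 1)) (F D j) *
     monom_of (\<Sum>i\<in>UNIV. Poly_Mapping.single (XV i) (fst D - snd D $ i))"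

definition phi :: "('n::finite \<Rightarrow> nat \<Rightarrow> ratfun) \<Rightarrow> ('n divcls \<Rightarrow> nat \<Rightarrow> (nat, ratfun) pol) \<Rightarrow>
    ('n gvar, ratfun) pol \<Rightarrow> ('n xy, ratfun) laurent" where
  "phi P F = subst_pol const (phi_var P F)"

definition phi_image :: "nat \<Rightarrow> ('n::finite \<Rightarrow> nat \<Rightarrow> ratfun) \<Rightarrow>
    ('n divcls \<Rightarrow> nat \<Rightarrow> (nat, ratfun) pol) \<Rightarrow> ('n xy, ratfun) laurent set" where
  "phi_image d P F = phi P F ` {f. pvars f \<subseteq> gvars d}"

definition init_point :: "('n::finite \<Rightarrow> nat \<Rightarrow> ratfun) \<Rightarrow>
    ('n divcls \<Rightarrow> nat \<Rightarrow> (nat, ratfun) pol) \<Rightarrow> 'n gvar \<Rightarrow> (real ^ 'n) \<times> (real ^ 'n)" where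
  "init_point P F v = (let \<alpha> = exponent (init0 (phi_var P F v)) in
     (\<chi> i. of_int (Poly_Mapping.lookup \<alpha> (XV i)), \<chi> i. of_int (Poly_Mapping.lookup \<alpha> (YV i))))"

definition class_point :: "nat \<Rightarrow> ('n::finite \<Rightarrow> nat \<Rightarrow> ratfun) \<Rightarrow>
    ('n divcls \<Rightarrow> nat \<Rightarrow> (nat, ratfun) pol) \<Rightarrow> 'n divcls \<Rightarrow> (real ^ 'n) \<times> (real ^ 'n)" where
  "class_point d P F D = init_point P F (THE v. v \<in> gvars d \<and> multideg v = D)"

text \<open>
  The coordinate ring of the toric variety, i.e. the polynomial ring modulo the kernel of the
  monomial map, is isomorphic to the image \<open>alg_gen (init0 ` phi_var P F ` gvars d)\<close> of that map.
\<close>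

definition KD_data :: "nat \<Rightarrow> ('n::finite \<Rightarrow> nat \<Rightarrow> ratfun) \<Rightarrow>
    ('n divcls \<Rightarrow> nat \<Rightarrow> (nat, ratfun) pol) \<Rightarrow> bool" where
  "KD_data d P F \<longleftrightarrow>
     (\<forall>i. \<exists>l\<le>d. P i l \<noteq> 0) \<and> general_position d P \<and> linsys_bases d P F \<and>
     khovanskii_basis (phi_image d P F) (phi_var P F ` gvars d) \<and>
     integrally_closed (alg_gen (init0 ` phi_var P F ` gvars d))"

definition KD_polytope :: "nat \<Rightarrow> ('n::finite \<Rightarrow> nat \<Rightarrow> ratfun) \<Rightarrow>
    ('n divcls \<Rightarrow> nat \<Rightarrow> (nat, ratfun) pol) \<Rightarrow> ((real ^ 'n) \<times> (real ^ 'n)) set" where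
  "KD_polytope d P F = convex hull (init_point P F ` gvars d)"

end

theory Submission
  imports Defs
begin

text \<open>
  The total degrees of an initial monomial in \<open>y\<close> and in each pair \<open>x\<^sub>i, y\<^sub>i\<close> determine the class of
  its generator, so the Mukai product with a class \<open>D\<close> is a linear functional on the space of the
  polytope. If \<open>D\<close> is in the Weyl orbit of \<open>E\<^sub>1\<close>, it takes the value \<open>-1\<close> at \<open>P\<^sub>D\<close> and nonnegative
  values at all other generators, because \<open>(D - G, D - G) < 0\<close> on the orthogonal complement of the
  canonical class. Hence it exposes \<open>P\<^sub>D\<close> as a vertex, and for \<open>(D, D') = 0\<close> the functional of
  \<open>D + D'\<close> exposes the segment from \<open>P\<^sub>D\<close> to \<open>P\<^sub>D\<^sub>'\<close> as an edge.

  The effective classes of degree one are controlled by descent: a Cremona transformation based at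
  any \<open>d + 1\<close> of the points preserves \<open>h\<^sup>0\<close>, so an effective class keeps a nonnegative degree under
  all of them, and arithmetic shows that a class of minimal degree is some \<open>E\<^sub>i\<close>, \<open>-K\<^sub>8\<^sub>,\<^sub>2\<close> or
  \<open>-K\<^sub>7\<^sub>,\<^sub>3/2\<close>. The last two have Mukai product one with every class of degree one, so they are
  isolated in the graph.
\<close>

subsection \<open>Substitution\<close>

text \<open>A Cremona transformation changes the class and also moves the remaining points, so
  invariance of \<open>h0\<close> compares linear systems for two configurations, and genericity
  must be carried from one to the other. For this the transformation is realised on coordinate
  matrices as an exact involution of the open set \<open>denom P \<noteq> 0\<close>. Inversion of
  coordinates bends lines, so multiplicities are tested by substituting power series, that is, along
  formal arcs. The Weyl orbit is represented by two invariants, self-product -1 and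
  \<open>h0 = 1\<close>; permutations are absorbed into the free choice of the \<open>d + 1\<close>
  base points. The finite-type condition is used in two shapes: as (K, K) > 0, which makes the Mukai
  form negative definite orthogonally to K, and as a bound on k - d - 1, which leaves few numerical
  cases for classes of minimal degree. The exposing functionals depend on the class alone and not on
  the points, which gives the same edges in every KD polytope.\<close>

definition mono_eval :: "('v \<Rightarrow> 'a) \<Rightarrow> ('v \<Rightarrow>\<^sub>0 nat) \<Rightarrow> 'a::comm_ring_1" where
  "mono_eval g \<alpha> = (\<Prod>v\<in>Poly_Mapping.keys \<alpha>. g v ^ Poly_Mapping.lookup \<alpha> v)"

lemma mono_eval_superset:
  assumes "finite S" "Poly_Mapping.keys \<alpha> \<subseteq> S"
  shows "mono_eval g \<alpha> = (\<Prod>v\<in>S. g v ^ Poly_Mapping.lookup \<alpha> v)"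
  unfolding mono_eval_def
  by (rule prod.mono_neutral_left) (use assms in \<open>auto simp: in_keys_iff\<close>)

lemma mono_eval_0 [simp]: "mono_eval g 0 = 1"
  by (simp add: mono_eval_def)

lemma mono_eval_add: "mono_eval g (\<alpha> + \<beta>) = mono_eval g \<alpha> * mono_eval g \<beta>"
proof -
  let ?S = "Poly_Mapping.keys \<alpha> \<union> Poly_Mapping.keys \<beta>"
  have "mono_eval g (\<alpha> + \<beta>) = (\<Prod>v\<in>?S. g v ^ Poly_Mapping.lookup (\<alpha> + \<beta>) v)"
    by (rule mono_eval_superset) (auto dest: set_mp[OF Poly_Mapping.keys_add])
  also have "\<dots> = (\<Prod>v\<in>?S. g v ^ Poly_Mapping.lookup \<alpha> v) * (\<Prod>v\<in>?S. g v ^ Poly_Mapping.lookup \<beta> v)"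
    by (simp add: lookup_add power_add prod.distrib)
  also have "\<dots> = mono_eval g \<alpha> * mono_eval g \<beta>"
    by (simp add: mono_eval_superset[of ?S])
  finally show ?thesis .
qed

lemma mono_eval_single [simp]: "mono_eval g (Poly_Mapping.single v n) = g v ^ n"
  by (cases "n = 0") (simp_all add: mono_eval_def)

lemma mono_eval_cong:
  "(\<And>v. v \<in> Poly_Mapping.keys \<alpha> \<Longrightarrow> g v = g' v) \<Longrightarrow> mono_eval g \<alpha> = mono_eval g' \<alpha>"
  by (simp add: mono_eval_def)

lemma subst_pol_mono_eval:
  "subst_pol h g f = (\<Sum>\<alpha>\<in>Poly_Mapping.keys f. h (Poly_Mapping.lookup f \<alpha>) * mono_eval g \<alpha>)"
  by (simp add: subst_pol_def mono_eval_def)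

lemma poly_mapping_sum_single:
  "(\<Sum>\<alpha>\<in>Poly_Mapping.keys f. Poly_Mapping.single \<alpha> (Poly_Mapping.lookup f \<alpha>)) = f"
proof (rule poly_mapping_eqI)
  fix \<beta>
  show "Poly_Mapping.lookup (\<Sum>\<alpha>\<in>Poly_Mapping.keys f. Poly_Mapping.single \<alpha> (Poly_Mapping.lookup f \<alpha>)) \<beta>
    = Poly_Mapping.lookup f \<beta>"
    by (cases "\<beta> \<in> Poly_Mapping.keys f") (auto simp: lookup_sum lookup_single when_def in_keys_iff)
qed

text \<open>Three instances occur: \<open>const\<close> for composing polynomials, the identity for
  values at complex points, and \<open>fps_const\<close> for restriction to formal arcs.\<close>

locale coeff_hom =
  fixes h :: "'c::comm_ring_1 \<Rightarrow> 'a::comm_ring_1"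
  assumes hom_0: "h 0 = 0" and hom_1: "h 1 = 1"
    and hom_add: "h (x + y) = h x + h y" and hom_mult: "h (x * y) = h x * h y"
begin

lemma hom_sum: "h (sum f A) = (\<Sum>x\<in>A. h (f x))"
  by (induction A rule: infinite_finite_induct) (auto simp: hom_add hom_0)

lemma subst_pol_superset:
  assumes "finite S" "Poly_Mapping.keys f \<subseteq> S"
  shows "subst_pol h g f = (\<Sum>\<alpha>\<in>S. h (Poly_Mapping.lookup f \<alpha>) * mono_eval g \<alpha>)"
  unfolding subst_pol_mono_eval
  by (rule sum.mono_neutral_left) (use assms in \<open>auto simp: in_keys_iff hom_0\<close>)

lemma subst_pol_0 [simp]: "subst_pol h g 0 = 0"
  by (simp add: subst_pol_def hom_0)

lemma subst_pol_add: "subst_pol h g (f + f') = subst_pol h g f + subst_pol h g f'"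
proof -
  let ?S = "Poly_Mapping.keys f \<union> Poly_Mapping.keys f'"
  have "subst_pol h g (f + f') = (\<Sum>\<alpha>\<in>?S. h (Poly_Mapping.lookup (f + f') \<alpha>) * mono_eval g \<alpha>)"
    by (rule subst_pol_superset) (auto dest: set_mp[OF Poly_Mapping.keys_add])
  then show ?thesis
    by (simp add: lookup_add hom_add distrib_right sum.distrib subst_pol_superset[of ?S])
qed

lemma subst_pol_sum: "subst_pol h g (sum f A) = (\<Sum>x\<in>A. subst_pol h g (f x))"
  by (induction A rule: infinite_finite_induct) (auto simp: subst_pol_add)

lemma subst_pol_single: "subst_pol h g (Poly_Mapping.single \<alpha> c) = h c * mono_eval g \<alpha>"
  by (subst subst_pol_superset[of "{\<alpha>}"]) (auto simp: hom_0)

lemma subst_pol_mult: "subst_pol h g (f * f') = subst_pol h g f * subst_pol h g f'"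
proof -
  have "f * f' = (\<Sum>\<alpha>\<in>Poly_Mapping.keys f. \<Sum>\<beta>\<in>Poly_Mapping.keys f'.
      Poly_Mapping.single (\<alpha> + \<beta>) (Poly_Mapping.lookup f \<alpha> * Poly_Mapping.lookup f' \<beta>))"
    by (subst (1 2) poly_mapping_sum_single[symmetric]) (simp add: sum_product mult_single)
  then have "subst_pol h g (f * f') = (\<Sum>\<alpha>\<in>Poly_Mapping.keys f. \<Sum>\<beta>\<in>Poly_Mapping.keys f'.
      (h (Poly_Mapping.lookup f \<alpha>) * mono_eval g \<alpha>) * (h (Poly_Mapping.lookup f' \<beta>) * mono_eval g \<beta>))"
    by (simp only: subst_pol_sum subst_pol_single hom_mult mono_eval_add mult_ac)
  then show ?thesis
    by (simp only: subst_pol_mono_eval sum_product)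
qed

lemma subst_pol_const [simp]: "subst_pol h g (const c) = h c"
  by (simp add: const_def subst_pol_single)

lemma subst_pol_1 [simp]: "subst_pol h g 1 = 1"
  using subst_pol_single[of g 0 1] by (simp add: hom_1)

lemma subst_pol_pvar [simp]: "subst_pol h g (pvar v) = g v"
  by (simp add: pvar_def monom_of_def subst_pol_single hom_1)

lemma subst_pol_power: "subst_pol h g (f ^ n) = subst_pol h g f ^ n"
  by (induction n) (auto simp: subst_pol_mult)

lemma subst_pol_prod: "subst_pol h g (prod f A) = (\<Prod>x\<in>A. subst_pol h g (f x))"
  by (induction A rule: infinite_finite_induct) (auto simp: subst_pol_mult)

text \<open>Merges a Taylor shift or a coordinate change with the restriction to an arc into a
  single substitution.\<close>

lemma subst_pol_subst_pol:
  "subst_pol h g (subst_pol const k f) = subst_pol h (\<lambda>v. subst_pol h g (k v)) f"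
  unfolding subst_pol_def[of const] subst_pol_sum subst_pol_mult subst_pol_prod subst_pol_power
    subst_pol_const
  unfolding subst_pol_def ..

end

lemma subst_pol_cong:
  assumes "\<And>v. v \<in> pvars f \<Longrightarrow> g v = g' v"
  shows "subst_pol h g f = subst_pol h g' f"
proof -
  have "mono_eval g \<alpha> = mono_eval g' \<alpha>" if "\<alpha> \<in> Poly_Mapping.keys f" for \<alpha>
    by (rule mono_eval_cong, rule assms) (use that in \<open>auto simp: pvars_def\<close>)
  then show ?thesis by (simp add: subst_pol_mono_eval)
qed

interpretation const_hom: coeff_hom const
  by unfold_locales (simp_all add: const_def single_add mult_single)

interpretation id_hom: coeff_hom "\<lambda>c. c"
  by unfold_locales simp_all

interpretation fps_const_hom: coeff_hom fps_const
  by unfold_locales simp_all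

lemma subst_pol_pvar_id:
  fixes f :: "('v, 'c::comm_ring_1) pol"
  shows "subst_pol const pvar f = f"
proof -
  have "mono_eval pvar \<alpha> = (Poly_Mapping.single \<alpha> 1 :: ('v,'c::comm_ring_1) pol)" for \<alpha> :: "'v \<Rightarrow>\<^sub>0 nat"
  proof -
    have "(\<Prod>v\<in>A. Poly_Mapping.single (Poly_Mapping.single v (n v)) (1::'c)) =
       Poly_Mapping.single (\<Sum>v\<in>A. Poly_Mapping.single v (n v)) 1" for A and n :: "'v \<Rightarrow> nat"
      by (induction A rule: infinite_finite_induct) (simp_all add: mult_single)
    moreover have "pvar v ^ n = (Poly_Mapping.single (Poly_Mapping.single v n) 1 :: ('v,'c) pol)" for v n
      by (induction n) (simp_all add: pvar_def monom_of_def mult_single add.commute flip: single_add)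
    ultimately show ?thesis
      by (simp only: mono_eval_def poly_mapping_sum_single)
  qed
  then show ?thesis
    by (simp add: subst_pol_mono_eval const_def mult_single poly_mapping_sum_single)
qed

text \<open>The monomial functions are distinct characters, hence independent.\<close>

lemma mono_eval_independent:
  fixes c :: "('v \<Rightarrow>\<^sub>0 nat) \<Rightarrow> complex"
  assumes "finite K" "\<And>x. (\<Sum>\<alpha>\<in>K. c \<alpha> * mono_eval x \<alpha>) = 0" "\<alpha> \<in> K"
  shows "c \<alpha> = 0"
  using assms
proof (induction K arbitrary: c \<alpha> rule: finite_induct)
  case empty
  then show ?case by simp
next
  case (insert \<beta> K)
  have K0: "c \<alpha> = 0" if \<alpha>: "\<alpha> \<in> K" for \<alpha>
  proof -
    from \<alpha> insert have "\<alpha> \<noteq> \<beta>" by auto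
    then obtain v where v: "Poly_Mapping.lookup \<alpha> v \<noteq> Poly_Mapping.lookup \<beta> v"
      by (meson poly_mapping_eqI)
    \<comment> \<open>Dedekind's argument: doubling the coordinate \<open>v\<close> multiplies the
      monomial \<gamma> by 2 to the power \<gamma>(v). Subtracting the multiple for \<beta> cancels
      that term and keeps the one for \<alpha>.\<close>
    define y :: "'v \<Rightarrow> complex" where "y = (\<lambda>w. if w = v then 2 else 1)"
    have y: "mono_eval y \<gamma> = 2 ^ Poly_Mapping.lookup \<gamma> v" for \<gamma>
    proof (cases "v \<in> Poly_Mapping.keys \<gamma>")
      case True
      then show ?thesis unfolding mono_eval_def y_def
        by (subst prod.remove[of _ v]) auto
    next
      case False
      then show ?thesis unfolding mono_eval_def y_def
        by (subst prod.neutral) (auto simp: in_keys_iff)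
    qed
    have yx: "mono_eval (\<lambda>w. y w * x w) \<gamma> = mono_eval y \<gamma> * mono_eval x \<gamma>" for x \<gamma>
      by (simp add: mono_eval_def power_mult_distrib prod.distrib)
    have "(\<Sum>\<gamma>\<in>K. c \<gamma> * (mono_eval y \<gamma> - mono_eval y \<beta>) * mono_eval x \<gamma>) = 0" for x
    proof -
      have "(\<Sum>\<gamma>\<in>insert \<beta> K. c \<gamma> * (mono_eval y \<gamma> - mono_eval y \<beta>) * mono_eval x \<gamma>)
        = (\<Sum>\<gamma>\<in>insert \<beta> K. c \<gamma> * mono_eval (\<lambda>w. y w * x w) \<gamma>) -
          mono_eval y \<beta> * (\<Sum>\<gamma>\<in>insert \<beta> K. c \<gamma> * mono_eval x \<gamma>)"
        unfolding yx sum_distrib_left sum_subtractf[symmetric]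
        by (rule sum.cong) (auto simp: algebra_simps)
      also have "\<dots> = 0"
        by (simp only: insert.prems(1) mult_zero_right diff_zero)
      finally show ?thesis using insert.hyps by simp
    qed
    from insert.IH[of "\<lambda>\<gamma>. c \<gamma> * (mono_eval y \<gamma> - mono_eval y \<beta>)", OF this \<alpha>]
    have "c \<alpha> = 0 \<or> (2::complex) ^ Poly_Mapping.lookup \<alpha> v = 2 ^ Poly_Mapping.lookup \<beta> v"
      by (simp add: y)
    moreover have "(2::complex) ^ m = 2 ^ n \<longleftrightarrow> m = n" for m n :: nat
    proof -
      have "(2::complex) ^ m = 2 ^ n \<longleftrightarrow> complex_of_real (2 ^ m) = complex_of_real (2 ^ n)" by simp
      also have "\<dots> \<longleftrightarrow> (2::real) ^ m = 2 ^ n" by (subst of_real_eq_iff) simp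
      finally show ?thesis by simp
    qed
    ultimately show ?thesis using v by simp
  qed
  have "c \<beta> = 0"
    using insert.prems(1)[of "\<lambda>_. 1"] insert.hyps K0
    by (simp add: mono_eval_def)
  then show ?case using K0 insert.prems by auto
qed

lemma exists_nonzero_value:
  fixes g :: "('v, complex) pol"
  assumes "g \<noteq> 0"
  shows "\<exists>x. subst_pol (\<lambda>c. c) x g \<noteq> 0"
proof (rule ccontr)
  assume "\<not> ?thesis"
  then have "Poly_Mapping.lookup g \<alpha> = 0" if "\<alpha> \<in> Poly_Mapping.keys g" for \<alpha>
    using mono_eval_independent[OF finite_keys[of g], of "Poly_Mapping.lookup g"] that
    by (simp add: subst_pol_mono_eval)
  then have "Poly_Mapping.lookup g \<alpha> = 0" for \<alpha>
    by (metis in_keys_iff)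
  then have "g = 0" by (intro poly_mapping_eqI) simp
  with assms show False by simp
qed

subsection \<open>Vanishing order along lines\<close>

text \<open>The bound is an integer because multiplicities in a class may be negative; it then
  imposes no condition.\<close>

definition fps_ge :: "int \<Rightarrow> 'a::comm_ring_1 fps \<Rightarrow> bool" where
  "fps_ge m F \<longleftrightarrow> (\<forall>j. int j < m \<longrightarrow> fps_nth F j = 0)"

lemma fps_ge_0 [simp]: "fps_ge m 0"
  by (simp add: fps_ge_def)

lemma fps_ge_add: "fps_ge m F \<Longrightarrow> fps_ge m G \<Longrightarrow> fps_ge m (F + G)"
  by (simp add: fps_ge_def)

lemma fps_ge_sum: "(\<And>x. x \<in> A \<Longrightarrow> fps_ge m (F x)) \<Longrightarrow> fps_ge m (sum F A)"
  by (induction A rule: infinite_finite_induct) (auto intro: fps_ge_add)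

lemma fps_ge_mult: "fps_ge m F \<Longrightarrow> fps_ge m (G * F)"
  by (auto simp: fps_ge_def fps_mult_nth intro!: sum.neutral)

lemma fps_ge_X_power: "m \<le> int k \<Longrightarrow> fps_ge m (fps_X ^ k)"
  by (auto simp: fps_ge_def fps_X_power_nth)

lemma tdeg_superset:
  assumes "finite S" "Poly_Mapping.keys \<alpha> \<subseteq> S"
  shows "tdeg \<alpha> = (\<Sum>v\<in>S. Poly_Mapping.lookup \<alpha> v)"
  unfolding tdeg_def
  by (rule sum.mono_neutral_left) (use assms in \<open>auto simp: in_keys_iff\<close>)

lemma tdeg_0 [simp]: "tdeg 0 = 0"
  by (simp add: tdeg_def)

lemma tdeg_add: "tdeg (\<alpha> + \<beta>) = tdeg \<alpha> + tdeg \<beta>"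
proof -
  let ?S = "Poly_Mapping.keys \<alpha> \<union> Poly_Mapping.keys \<beta>"
  have "tdeg (\<alpha> + \<beta>) = (\<Sum>v\<in>?S. Poly_Mapping.lookup (\<alpha> + \<beta>) v)"
    by (rule tdeg_superset) (auto dest: set_mp[OF Poly_Mapping.keys_add])
  then show ?thesis
    by (simp add: lookup_add sum.distrib tdeg_superset[of ?S])
qed

lemma tdeg_single [simp]: "tdeg (Poly_Mapping.single v n) = n"
  by (simp add: tdeg_def)

lemma mono_eval_scale: "mono_eval (\<lambda>v. x * g v) \<alpha> = x ^ tdeg \<alpha> * mono_eval g \<alpha>"
  by (simp add: mono_eval_def tdeg_def power_mult_distrib prod.distrib power_sum)

lemma (in coeff_hom) hom_power: "h (x ^ n) = h x ^ n"
  by (induction n) (auto simp: hom_1 hom_mult)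

lemma (in coeff_hom) hom_prod: "h (prod f A) = (\<Prod>x\<in>A. h (f x))"
  by (induction A rule: infinite_finite_induct) (auto simp: hom_1 hom_mult)

lemma (in coeff_hom) mono_eval_hom: "mono_eval (\<lambda>v. h (g v)) \<alpha> = h (mono_eval g \<alpha>)"
  by (simp add: mono_eval_def hom_power hom_prod)

text \<open>The direction \<open>w\<close> may itself be a power series, so the bound holds along
  every formal arc through \<open>p\<close>. Curved arcs arise as images of lines under inversion of
  coordinates.\<close>

lemma fps_ge_shift:
  fixes w :: "nat \<Rightarrow> 'c::comm_ring_1 fps"
  assumes "vanishes_at f p m"
  shows "fps_ge m (subst_pol fps_const (\<lambda>l. fps_const (p l) + fps_X * w l) f)"
proof -
  let ?f = "subst_pol const (\<lambda>l. const (p l) + pvar l) f :: (nat, 'c) pol"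
  have "subst_pol fps_const (\<lambda>l. fps_const (p l) + fps_X * w l) f =
      subst_pol fps_const (\<lambda>l. fps_X * w l) ?f"
    by (simp add: fps_const_hom.subst_pol_subst_pol fps_const_hom.subst_pol_add)
  also have "\<dots> = (\<Sum>\<alpha>\<in>Poly_Mapping.keys ?f. fps_const (Poly_Mapping.lookup ?f \<alpha>) * mono_eval w \<alpha> *
      fps_X ^ tdeg \<alpha>)"
    by (simp add: subst_pol_mono_eval mono_eval_scale mult_ac)
  also have "fps_ge m \<dots>"
    by (intro fps_ge_sum fps_ge_mult fps_ge_X_power) (use assms in \<open>auto simp: vanishes_at_def\<close>)
  finally show ?thesis .
qed

text \<open>On a line through \<open>p\<close> the coefficient of \<open>fps_X ^ j\<close> is the
  degree-j part of the Taylor expansion, evaluated at the direction \<open>v\<close>. If it vanishes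
  for all \<open>v\<close>, that part is zero by independence of the monomial functions. The
  criterion is visibly linear in \<open>f\<close>.\<close>

lemma vanishes_at_iff:
  fixes f :: "(nat, complex) pol"
  shows "vanishes_at f p m \<longleftrightarrow>
    (\<forall>v. fps_ge m (subst_pol fps_const (\<lambda>l. fps_const (p l) + fps_X * fps_const (v l)) f))"
    (is "_ \<longleftrightarrow> ?R")
proof
  assume ?R
  let ?f = "subst_pol const (\<lambda>l. const (p l) + pvar l) f :: (nat, complex) pol"
  have shift: "subst_pol fps_const (\<lambda>l. fps_const (p l) + fps_X * fps_const (v l)) f =
      (\<Sum>\<alpha>\<in>Poly_Mapping.keys ?f. fps_const (Poly_Mapping.lookup ?f \<alpha> * mono_eval v \<alpha>) * fps_X ^ tdeg \<alpha>)" for v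
  proof -
    have "subst_pol fps_const (\<lambda>l. fps_const (p l) + fps_X * fps_const (v l)) f =
      subst_pol fps_const (\<lambda>l. fps_X * fps_const (v l)) ?f"
    by (simp add: fps_const_hom.subst_pol_subst_pol fps_const_hom.subst_pol_add)
    then show ?thesis
      by (simp add: subst_pol_mono_eval mono_eval_scale fps_const_hom.mono_eval_hom mult_ac
          flip: fps_const_mult)
  qed
  show "vanishes_at f p m"
    unfolding vanishes_at_def
  proof
    fix \<alpha> assume \<alpha>: "\<alpha> \<in> Poly_Mapping.keys ?f"
    show "m \<le> int (tdeg \<alpha>)"
    proof (rule ccontr)
      assume "\<not> ?thesis"
      then have less: "int (tdeg \<alpha>) < m" by simp
      let ?K = "{\<beta>\<in>Poly_Mapping.keys ?f. tdeg \<beta> = tdeg \<alpha>}"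
      have "(\<Sum>\<beta>\<in>?K. Poly_Mapping.lookup ?f \<beta> * mono_eval v \<beta>) = 0" for v
      proof -
        have "0 = fps_nth (subst_pol fps_const (\<lambda>l. fps_const (p l) + fps_X * fps_const (v l)) f) (tdeg \<alpha>)"
          using \<open>?R\<close> less by (simp add: fps_ge_def)
        also have "\<dots> = (\<Sum>\<beta>\<in>Poly_Mapping.keys ?f.
            if tdeg \<beta> = tdeg \<alpha> then Poly_Mapping.lookup ?f \<beta> * mono_eval v \<beta> else 0)"
          unfolding shift fps_sum_nth
          by (intro sum.cong refl) (auto simp: fps_X_power_nth)
        also have "\<dots> = (\<Sum>\<beta>\<in>?K. Poly_Mapping.lookup ?f \<beta> * mono_eval v \<beta>)"
          by (subst sum.inter_filter) auto
        finally show ?thesis by simp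
      qed
      from mono_eval_independent[OF _ this, of \<alpha>] \<alpha> show False
        by (auto simp: in_keys_iff)
    qed
  qed
qed (simp add: fps_ge_shift)

subsection \<open>Linear systems\<close>

definition form :: "nat \<Rightarrow> int \<Rightarrow> (nat, 'c::zero) pol \<Rightarrow> bool" where
  "form d n f \<longleftrightarrow> (\<forall>\<alpha>\<in>Poly_Mapping.keys f. Poly_Mapping.keys \<alpha> \<subseteq> {..d} \<and> int (tdeg \<alpha>) = n)"

lemma linsys_iff: "f \<in> linsys d P D \<longleftrightarrow> form d (fst D) f \<and> (\<forall>i. vanishes_at f (P i) (snd D $ i))"
  by (auto simp: linsys_def form_def pvars_def)

lemma form_add: "form d n f \<Longrightarrow> form d n g \<Longrightarrow> form d n (f + g)"
  using Poly_Mapping.keys_add[of f g] by (auto simp: form_def)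

lemma form_0 [simp]: "form d n 0"
  by (simp add: form_def)

lemma form_sum: "(\<And>x. x \<in> A \<Longrightarrow> form d n (f x)) \<Longrightarrow> form d n (sum f A)"
  by (induction A rule: infinite_finite_induct) (auto intro: form_add)

lemma form_mult:
  fixes f g :: "(nat, 'c::comm_ring_1) pol"
  assumes "form d m f" "form d n g"
  shows "form d (m + n) (f * g)"
  unfolding form_def
proof
  fix \<alpha> assume "\<alpha> \<in> Poly_Mapping.keys (f * g)"
  then obtain \<beta> \<gamma> where \<alpha>: "\<alpha> = \<beta> + \<gamma>"
    and *: "\<beta> \<in> Poly_Mapping.keys f" "\<gamma> \<in> Poly_Mapping.keys g"
    using keys_mult[of f g] by auto
  have "Poly_Mapping.keys \<alpha> \<subseteq> Poly_Mapping.keys \<beta> \<union> Poly_Mapping.keys \<gamma>"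
    unfolding \<alpha> by (rule Poly_Mapping.keys_add)
  moreover have "Poly_Mapping.keys \<beta> \<subseteq> {..d}" "int (tdeg \<beta>) = m"
    "Poly_Mapping.keys \<gamma> \<subseteq> {..d}" "int (tdeg \<gamma>) = n"
    using assms * by (simp_all add: form_def)
  ultimately show "Poly_Mapping.keys \<alpha> \<subseteq> {..d} \<and> int (tdeg \<alpha>) = m + n"
    by (auto simp: \<alpha> tdeg_add)
qed

lemma form_const: "form d 0 (const c)"
  by (auto simp: form_def const_def split: if_splits)

lemma form_1: "form d 0 (1 :: (nat, 'c::comm_ring_1) pol)"
  using form_const[of d "1::'c"] by (simp add: const_hom.hom_1)

lemma form_pvar: "l \<le> d \<Longrightarrow> form d 1 (pvar l)"
  by (auto simp: form_def pvar_def monom_of_def split: if_splits)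

lemma form_power: "form d n f \<Longrightarrow> form d (int k * n) (f ^ k)" for f :: "(nat, 'c::comm_ring_1) pol"
  by (induction k) (auto simp: form_1 algebra_simps intro!: form_mult[of d n])

lemma form_prod:
  fixes f :: "'b \<Rightarrow> (nat, 'c::comm_ring_1) pol"
  shows "(\<And>x. x \<in> A \<Longrightarrow> form d (n x) (f x)) \<Longrightarrow> form d (sum n A) (prod f A)"
  by (induction A rule: infinite_finite_induct) (auto simp: form_1 intro!: form_mult)

lemma form_scale: "form d n f \<Longrightarrow> form d n (const c * f)"
  using form_mult[OF form_const, of d n f] by simp

lemma form_subst_pol:
  fixes k :: "nat \<Rightarrow> (nat, 'c::comm_ring_1) pol"
  assumes f: "form d n f" and k: "\<And>l. l \<le> d \<Longrightarrow> form d 1 (k l)"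
  shows "form d n (subst_pol const k f)"
  unfolding subst_pol_def
proof (intro form_sum form_scale)
  fix \<alpha> assume \<alpha>: "\<alpha> \<in> Poly_Mapping.keys f"
  have "form d (\<Sum>v\<in>Poly_Mapping.keys \<alpha>. int (Poly_Mapping.lookup \<alpha> v) * 1)
      (\<Prod>v\<in>Poly_Mapping.keys \<alpha>. k v ^ Poly_Mapping.lookup \<alpha> v)"
    by (intro form_prod form_power k) (use f \<alpha> in \<open>auto simp: form_def\<close>)
  moreover have "(\<Sum>v\<in>Poly_Mapping.keys \<alpha>. int (Poly_Mapping.lookup \<alpha> v) * 1) = n"
    using f \<alpha> by (auto simp: form_def tdeg_def)
  ultimately show "form d n (\<Prod>v\<in>Poly_Mapping.keys \<alpha>. k v ^ Poly_Mapping.lookup \<alpha> v)"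
    by simp
qed

lemma subspace_linsys:
  fixes P :: "'n::finite \<Rightarrow> nat \<Rightarrow> complex"
  shows "mp.subspace (linsys d P D)"
proof (rule mp.subspaceI)
  show "0 \<in> linsys d P D"
    by (simp add: linsys_iff vanishes_at_iff)
  show "x + y \<in> linsys d P D" if "x \<in> linsys d P D" "y \<in> linsys d P D" for x y
    using that by (auto simp: linsys_iff vanishes_at_iff form_add fps_const_hom.subst_pol_add fps_ge_add)
  show "mp_scale c x \<in> linsys d P D" if "x \<in> linsys d P D" for c x
    using that by (auto simp: linsys_iff vanishes_at_iff mp_scale_def form_scale
        fps_const_hom.subst_pol_mult fps_ge_mult)
qed

lemma dim_eq_of_linear_bij:
  fixes h :: "('e::comm_monoid_add \<Rightarrow>\<^sub>0 'c::field) \<Rightarrow> ('e \<Rightarrow>\<^sub>0 'c)"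
  assumes V: "mp.subspace V" and add: "\<And>x y. h (x + y) = h x + h y"
    and scale: "\<And>c x. h (mp_scale c x) = mp_scale c (h x)"
    and bij: "bij_betw h V W"
  shows "mp.dim V = mp.dim W"
proof -
  interpret Vector_Spaces.linear mp_scale mp_scale h
    by unfold_locales (simp_all add: add scale)
  obtain B where B: "B \<subseteq> V" "mp.independent B" "V \<subseteq> mp.span B" "card B = mp.dim V"
    using mp.basis_exists .
  have span: "mp.span B = V"
    using B V by (meson mp.span_minimal subset_antisym)
  have "mp.independent (h ` B)"
    by (rule independent_injective_image) (use B bij span in \<open>auto simp: bij_betw_def\<close>)
  moreover have "mp.span (h ` B) = W"
    using span_image[of B] span bij by (simp add: bij_betw_def)
  moreover have "card (h ` B) = card B"
    by (rule card_image) (use B bij in \<open>auto simp: bij_betw_def intro: inj_on_subset\<close>)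
  ultimately show ?thesis
    using B(4) mp.dim_span_eq_card_independent by metis
qed

subsection \<open>Linear coordinate changes\<close>

definition lin_change :: "nat \<Rightarrow> (nat \<Rightarrow> nat \<Rightarrow> 'c) \<Rightarrow> (nat, 'c::comm_ring_1) pol \<Rightarrow> (nat, 'c) pol" where
  "lin_change d B = subst_pol const (\<lambda>l. \<Sum>j\<le>d. const (B l j) * pvar j)"

text \<open>The linear substitution maps lines through \<open>P' i\<close> to lines through
  \<open>P i\<close>, so the line criterion transfers multiplicities directly.\<close>

lemma lin_change_mem_linsys:
  fixes P P' :: "'n::finite \<Rightarrow> nat \<Rightarrow> complex"
  assumes f: "f \<in> linsys d P D" and P: "\<And>i l. l \<le> d \<Longrightarrow> P i l = (\<Sum>j\<le>d. B l j * P' i j)"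
  shows "lin_change d B f \<in> linsys d P' D"
proof -
  have "form d (fst D) (lin_change d B f)"
    unfolding lin_change_def
    by (intro form_subst_pol form_sum form_scale form_pvar) (use f in \<open>auto simp: linsys_iff\<close>)
  moreover have "vanishes_at (lin_change d B f) (P' i) (snd D $ i)" for i
    unfolding vanishes_at_iff
  proof
    fix v
    have "subst_pol fps_const (\<lambda>l. fps_const (P' i l) + fps_X * fps_const (v l)) (lin_change d B f) =
      subst_pol fps_const (\<lambda>l. fps_const (P i l) + fps_X * fps_const (\<Sum>j\<le>d. B l j * v j)) f"
      unfolding lin_change_def fps_const_hom.subst_pol_subst_pol
    proof (rule subst_pol_cong)
      fix l assume "l \<in> pvars f"
      then have "l \<le> d" using f by (auto simp: linsys_def)
      then show "subst_pol fps_const (\<lambda>l. fps_const (P' i l) + fps_X * fps_const (v l))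
          (\<Sum>j\<le>d. const (B l j) * pvar j) =
         fps_const (P i l) + fps_X * fps_const (\<Sum>j\<le>d. B l j * v j)"
        by (simp add: P fps_const_hom.subst_pol_sum fps_const_hom.subst_pol_mult fps_const_hom.hom_sum
            sum_distrib_left distrib_left sum.distrib mult_ac flip: fps_const_mult)
    qed
    then show "fps_ge (snd D $ i) (subst_pol fps_const
        (\<lambda>l. fps_const (P' i l) + fps_X * fps_const (v l)) (lin_change d B f))"
      using f by (simp add: linsys_iff fps_ge_shift)
  qed
  ultimately show ?thesis by (simp add: linsys_iff)
qed

lemma lin_change_lin_change:
  assumes "pvars f \<subseteq> {..d}"
    and "\<And>l k. l \<le> d \<Longrightarrow> k \<le> d \<Longrightarrow> (\<Sum>j\<le>d. B l j * B' j k) = (if l = k then 1 else 0)"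
  shows "lin_change d B' (lin_change d B f) = f"
proof -
  have "lin_change d B' (lin_change d B f) = subst_pol const pvar f"
    unfolding lin_change_def const_hom.subst_pol_subst_pol
  proof (rule subst_pol_cong)
    fix l assume "l \<in> pvars f"
    then have l: "l \<le> d" using assms by auto
    have "subst_pol const (\<lambda>l. \<Sum>j\<le>d. const (B' l j) * pvar j) (\<Sum>j\<le>d. const (B l j) * pvar j) =
        (\<Sum>j\<le>d. \<Sum>k\<le>d. const (B l j * B' j k) * pvar k)"
      by (simp add: const_hom.subst_pol_sum const_hom.subst_pol_mult sum_distrib_left
          const_hom.hom_mult mult_ac)
    also have "\<dots> = (\<Sum>k\<le>d. const (\<Sum>j\<le>d. B l j * B' j k) * pvar k)"
      by (subst sum.swap) (simp add: const_hom.hom_sum sum_distrib_right)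
    also have "\<dots> = (\<Sum>k\<le>d. if l = k then pvar k else 0)"
      using l assms(2) by (intro sum.cong) (auto simp: const_hom.hom_0 const_hom.hom_1)
    also have "\<dots> = pvar l" using l by simp
    finally show "subst_pol const (\<lambda>l. \<Sum>j\<le>d. const (B' l j) * pvar j) (\<Sum>j\<le>d. const (B l j) * pvar j) =
        pvar l" .
  qed
  then show ?thesis by (simp add: subst_pol_pvar_id)
qed

lemma dim_linsys_lin_change:
  fixes P P' :: "'n::finite \<Rightarrow> nat \<Rightarrow> complex"
  assumes P: "\<And>i l. l \<le> d \<Longrightarrow> P i l = (\<Sum>j\<le>d. B l j * P' i j)"
    and BB': "\<And>l k. l \<le> d \<Longrightarrow> k \<le> d \<Longrightarrow> (\<Sum>j\<le>d. B l j * B' j k) = (if l = k then 1 else 0)"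
    and B'B: "\<And>l k. l \<le> d \<Longrightarrow> k \<le> d \<Longrightarrow> (\<Sum>j\<le>d. B' l j * B j k) = (if l = k then 1 else 0)"
  shows "mp.dim (linsys d P D) = mp.dim (linsys d P' D)"
proof (rule dim_eq_of_linear_bij[OF subspace_linsys])
  have P': "P' i l = (\<Sum>j\<le>d. B' l j * P i j)" if "l \<le> d" for i l
  proof -
    have "(\<Sum>j\<le>d. B' l j * P i j) = (\<Sum>j\<le>d. \<Sum>k\<le>d. B' l j * B j k * P' i k)"
      by (intro sum.cong refl) (simp add: P sum_distrib_left mult_ac)
    also have "\<dots> = (\<Sum>k\<le>d. (\<Sum>j\<le>d. B' l j * B j k) * P' i k)"
      by (subst sum.swap) (simp add: sum_distrib_right)
    also have "\<dots> = (\<Sum>k\<le>d. if l = k then P' i k else 0)"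
      using that by (intro sum.cong refl) (simp add: B'B)
    finally show ?thesis using that by simp
  qed
  show "bij_betw (lin_change d B) (linsys d P D) (linsys d P' D)"
  proof (rule bij_betw_byWitness[where f' = "lin_change d B'"])
    show "\<forall>f\<in>linsys d P D. lin_change d B' (lin_change d B f) = f"
      by (intro ballI lin_change_lin_change BB') (auto simp: linsys_def)
    show "\<forall>f\<in>linsys d P' D. lin_change d B (lin_change d B' f) = f"
      by (intro ballI lin_change_lin_change B'B) (auto simp: linsys_def)
    show "lin_change d B ` linsys d P D \<subseteq> linsys d P' D"
      by (auto intro: lin_change_mem_linsys P)
    show "lin_change d B' ` linsys d P' D \<subseteq> linsys d P D"
      by (auto intro: lin_change_mem_linsys P')
  qed
qed (simp_all add: lin_change_def mp_scale_def const_hom.subst_pol_add const_hom.subst_pol_mult)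

subsection \<open>The standard Cremona transformation on forms\<close>

text \<open>Near the l-th coordinate point the variable \<open>l\<close> is a unit and every other
  variable has order one, so the monomial \<alpha> has order N - \<alpha>(l). Distinct monomials
  cannot cancel, which turns multiplicity into a condition on exponents.\<close>

lemma vanishes_at_axis:
  fixes f :: "(nat, complex) pol"
  assumes f: "form d N f" and l: "l \<le> d"
    and p: "\<And>k. k \<le> d \<Longrightarrow> p k = (if k = l then 1 else 0)"
  shows "vanishes_at f p m \<longleftrightarrow> (\<forall>\<alpha>\<in>Poly_Mapping.keys f. m \<le> N - int (Poly_Mapping.lookup \<alpha> l))"
proof -
  let ?e = "\<lambda>\<alpha>. \<Sum>k\<in>{..d} - {l}. Poly_Mapping.lookup \<alpha> k"
  have e: "int (?e \<alpha>) = N - int (Poly_Mapping.lookup \<alpha> l)" if "\<alpha> \<in> Poly_Mapping.keys f" for \<alpha>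
  proof -
    have "tdeg \<alpha> = (\<Sum>k\<le>d. Poly_Mapping.lookup \<alpha> k)"
      by (rule tdeg_superset) (use f that in \<open>auto simp: form_def\<close>)
    also have "\<dots> = Poly_Mapping.lookup \<alpha> l + ?e \<alpha>"
      using l by (simp add: sum.remove)
    finally show ?thesis using f that by (auto simp: form_def)
  qed
  have mono: "mono_eval (\<lambda>k. fps_const (p k) + fps_X * fps_const (v k)) \<alpha> =
      (1 + fps_X * fps_const (v l)) ^ Poly_Mapping.lookup \<alpha> l *
      (fps_const (\<Prod>k\<in>{..d} - {l}. v k ^ Poly_Mapping.lookup \<alpha> k) * fps_X ^ ?e \<alpha>)"
    if "\<alpha> \<in> Poly_Mapping.keys f" for v \<alpha>
  proof -
    have "mono_eval (\<lambda>k. fps_const (p k) + fps_X * fps_const (v k)) \<alpha> =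
        (\<Prod>k\<le>d. (fps_const (p k) + fps_X * fps_const (v k)) ^ Poly_Mapping.lookup \<alpha> k)"
      by (rule mono_eval_superset) (use f that in \<open>auto simp: form_def\<close>)
    also have "\<dots> = (1 + fps_X * fps_const (v l)) ^ Poly_Mapping.lookup \<alpha> l *
        (\<Prod>k\<in>{..d} - {l}. (fps_const (p k) + fps_X * fps_const (v k)) ^ Poly_Mapping.lookup \<alpha> k)"
      using l by (subst prod.remove[of _ l]) (auto simp: p)
    also have "(\<Prod>k\<in>{..d} - {l}. (fps_const (p k) + fps_X * fps_const (v k)) ^ Poly_Mapping.lookup \<alpha> k) =
        (\<Prod>k\<in>{..d} - {l}. fps_X ^ Poly_Mapping.lookup \<alpha> k * fps_const (v k ^ Poly_Mapping.lookup \<alpha> k))"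
      by (intro prod.cong refl) (auto simp: p power_mult_distrib fps_const_power)
    also have "\<dots> = fps_const (\<Prod>k\<in>{..d} - {l}. v k ^ Poly_Mapping.lookup \<alpha> k) * fps_X ^ ?e \<alpha>"
      by (simp add: prod.distrib power_sum fps_const_hom.hom_prod mult.commute)
    finally show ?thesis .
  qed
  show ?thesis
  proof
    assume R: "\<forall>\<alpha>\<in>Poly_Mapping.keys f. m \<le> N - int (Poly_Mapping.lookup \<alpha> l)"
    show "vanishes_at f p m"
      unfolding vanishes_at_iff subst_pol_mono_eval
    proof (intro allI fps_ge_sum fps_ge_mult)
      fix v \<alpha> assume \<alpha>: "\<alpha> \<in> Poly_Mapping.keys f"
      show "fps_ge m (mono_eval (\<lambda>k. fps_const (p k) + fps_X * fps_const (v k)) \<alpha>)"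
        unfolding mono[OF \<alpha>]
        by (intro fps_ge_mult fps_ge_X_power) (use e[OF \<alpha>] R \<alpha> in auto)
    qed
  next
    assume L: "vanishes_at f p m"
    show "\<forall>\<alpha>\<in>Poly_Mapping.keys f. m \<le> N - int (Poly_Mapping.lookup \<alpha> l)"
    proof (rule ballI, rule ccontr)
      fix \<alpha> assume \<alpha>: "\<alpha> \<in> Poly_Mapping.keys f" and "\<not> m \<le> N - int (Poly_Mapping.lookup \<alpha> l)"
      then have less: "int (?e \<alpha>) < m" using e[OF \<alpha>] by simp
      let ?K = "{\<beta>\<in>Poly_Mapping.keys f. ?e \<beta> = ?e \<alpha>}"
      have K: "Poly_Mapping.lookup \<beta> l = Poly_Mapping.lookup \<alpha> l" if "\<beta> \<in> ?K" for \<beta>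
      proof -
        have "\<beta> \<in> Poly_Mapping.keys f" "int (?e \<beta>) = int (?e \<alpha>)" using that by simp_all
        then show ?thesis using e[OF \<alpha>] e[of \<beta>] by linarith
      qed
      have "(\<Sum>\<beta>\<in>?K. Poly_Mapping.lookup f \<beta> * mono_eval x \<beta>) = 0" for x
      proof -
        \<comment> \<open>A direction without l-component makes the unit factor equal to 1, so each
          monomial contributes to a single power of \<open>fps_X\<close>.\<close>
        define v where "v = x(l := 0)"
        let ?F = "subst_pol fps_const (\<lambda>k. fps_const (p k) + fps_X * fps_const (v k)) f"
        have "?F = (\<Sum>\<beta>\<in>Poly_Mapping.keys f. fps_const (Poly_Mapping.lookup f \<beta> *
            (\<Prod>k\<in>{..d} - {l}. x k ^ Poly_Mapping.lookup \<beta> k)) * fps_X ^ ?e \<beta>)"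
          unfolding subst_pol_mono_eval
          by (intro sum.cong refl) (simp add: mono v_def mult_ac flip: fps_const_mult)
        then have "fps_nth ?F (?e \<alpha>) = (\<Sum>\<beta>\<in>Poly_Mapping.keys f. if ?e \<beta> = ?e \<alpha> then
            Poly_Mapping.lookup f \<beta> * (\<Prod>k\<in>{..d} - {l}. x k ^ Poly_Mapping.lookup \<beta> k) else 0)"
          unfolding fps_sum_nth by (auto simp: fps_sum_nth fps_X_power_nth intro!: sum.cong)
        also have "\<dots> = (\<Sum>\<beta>\<in>?K. Poly_Mapping.lookup f \<beta> * (\<Prod>k\<in>{..d} - {l}. x k ^ Poly_Mapping.lookup \<beta> k))"
          by (subst sum.inter_filter) auto
        finally have *: "(\<Sum>\<beta>\<in>?K. Poly_Mapping.lookup f \<beta> * (\<Prod>k\<in>{..d} - {l}. x k ^ Poly_Mapping.lookup \<beta> k)) = 0"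
          using L less by (simp add: vanishes_at_iff fps_ge_def)
        have "(\<Sum>\<beta>\<in>?K. Poly_Mapping.lookup f \<beta> * mono_eval x \<beta>) = x l ^ Poly_Mapping.lookup \<alpha> l *
          (\<Sum>\<beta>\<in>?K. Poly_Mapping.lookup f \<beta> * (\<Prod>k\<in>{..d} - {l}. x k ^ Poly_Mapping.lookup \<beta> k))"
          unfolding sum_distrib_left
        proof (intro sum.cong refl)
          fix \<beta> assume \<beta>: "\<beta> \<in> ?K"
          have "mono_eval x \<beta> = (\<Prod>k\<le>d. x k ^ Poly_Mapping.lookup \<beta> k)"
            by (rule mono_eval_superset) (use f \<beta> in \<open>auto simp: form_def\<close>)
          also have "\<dots> = x l ^ Poly_Mapping.lookup \<alpha> l * (\<Prod>k\<in>{..d} - {l}. x k ^ Poly_Mapping.lookup \<beta> k)"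
            using l K[OF \<beta>] by (subst prod.remove[of _ l]) auto
          finally show "Poly_Mapping.lookup f \<beta> * mono_eval x \<beta> = x l ^ Poly_Mapping.lookup \<alpha> l *
            (Poly_Mapping.lookup f \<beta> * (\<Prod>k\<in>{..d} - {l}. x k ^ Poly_Mapping.lookup \<beta> k))"
            by simp
        qed
        then show ?thesis by (simp only: * mult_zero_right)
      qed
      from mono_eval_independent[OF _ this, of \<alpha>] \<alpha> show False
        by (auto simp: in_keys_iff)
    qed
  qed
qed

text \<open>Exponents are subtracted with truncation: linearity in \<open>f\<close> is
  unconditional, while involutivity and the behaviour under evaluation rest on
  \<open>dominated\<close>.\<close>

definition cremona_pol :: "('v \<Rightarrow>\<^sub>0 nat) \<Rightarrow> ('v, 'c::comm_ring_1) pol \<Rightarrow> ('v, 'c) pol" where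
  "cremona_pol n f = (\<Sum>\<alpha>\<in>Poly_Mapping.keys f. Poly_Mapping.single (n - \<alpha>) (Poly_Mapping.lookup f \<alpha>))"

lemma cremona_pol_superset:
  assumes "finite S" "Poly_Mapping.keys f \<subseteq> S"
  shows "cremona_pol n f = (\<Sum>\<alpha>\<in>S. Poly_Mapping.single (n - \<alpha>) (Poly_Mapping.lookup f \<alpha>))"
  unfolding cremona_pol_def
  by (rule sum.mono_neutral_left) (use assms in \<open>auto simp: in_keys_iff\<close>)

lemma cremona_pol_add: "cremona_pol n (f + g) = cremona_pol n f + cremona_pol n g"
proof -
  let ?S = "Poly_Mapping.keys f \<union> Poly_Mapping.keys g"
  have "cremona_pol n (f + g) = (\<Sum>\<alpha>\<in>?S. Poly_Mapping.single (n - \<alpha>) (Poly_Mapping.lookup (f + g) \<alpha>))"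
    by (rule cremona_pol_superset) (auto dest: set_mp[OF Poly_Mapping.keys_add])
  then show ?thesis
    by (simp add: lookup_add single_add sum.distrib cremona_pol_superset[of ?S])
qed

lemma cremona_pol_0 [simp]: "cremona_pol n 0 = 0"
  by (simp add: cremona_pol_def)

lemma cremona_pol_sum: "cremona_pol n (sum f A) = (\<Sum>x\<in>A. cremona_pol n (f x))"
  by (induction A rule: infinite_finite_induct) (auto simp: cremona_pol_add)

lemma cremona_pol_single: "cremona_pol n (Poly_Mapping.single \<alpha> c) = Poly_Mapping.single (n - \<alpha>) c"
  by (subst cremona_pol_superset[of "{\<alpha>}"]) auto

lemma mp_scale_single: "mp_scale c (Poly_Mapping.single \<alpha> b) = Poly_Mapping.single \<alpha> (c * b)"
  by (simp add: mp_scale_def const_def mult_single)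

lemma mp_scale_sum: "mp_scale c (sum f A) = (\<Sum>x\<in>A. mp_scale c (f x))"
  by (simp add: mp_scale_def sum_distrib_left)

lemma cremona_pol_scale: "cremona_pol n (mp_scale c f) = mp_scale c (cremona_pol n f)"
proof -
  have "mp_scale c f = (\<Sum>\<alpha>\<in>Poly_Mapping.keys f. Poly_Mapping.single \<alpha> (c * Poly_Mapping.lookup f \<alpha>))"
    using arg_cong[OF poly_mapping_sum_single[of f, symmetric], of "mp_scale c"]
    by (simp only: mp_scale_sum mp_scale_single)
  then show ?thesis
    by (simp add: cremona_pol_sum cremona_pol_single cremona_pol_def[of n f] mp_scale_sum mp_scale_single)
qed

lemma keys_cremona_pol:
  assumes "\<beta> \<in> Poly_Mapping.keys (cremona_pol n f)"
  obtains \<alpha> where "\<alpha> \<in> Poly_Mapping.keys f" "\<beta> = n - \<alpha>"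
proof -
  have "(\<Sum>\<alpha>\<in>Poly_Mapping.keys f. Poly_Mapping.lookup (Poly_Mapping.single (n - \<alpha>) (Poly_Mapping.lookup f \<alpha>)) \<beta>) \<noteq> 0"
    using assms by (simp add: cremona_pol_def lookup_sum in_keys_iff)
  then obtain \<alpha> where "\<alpha> \<in> Poly_Mapping.keys f"
    "Poly_Mapping.lookup (Poly_Mapping.single (n - \<alpha>) (Poly_Mapping.lookup f \<alpha>)) \<beta> \<noteq> 0"
    by (meson sum.not_neutral_contains_not_neutral)
  then show ?thesis by (intro that) (auto simp: lookup_single when_def split: if_splits)
qed

definition dominated :: "('v \<Rightarrow>\<^sub>0 nat) \<Rightarrow> ('v, 'c::zero) pol \<Rightarrow> bool" where
  "dominated n f \<longleftrightarrow> (\<forall>\<alpha>\<in>Poly_Mapping.keys f. \<forall>v. Poly_Mapping.lookup \<alpha> v \<le> Poly_Mapping.lookup n v)"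

lemma cremona_pol_involution: "dominated n f \<Longrightarrow> cremona_pol n (cremona_pol n f) = f"
proof -
  assume f: "dominated n f"
  have "n - (n - \<alpha>) = \<alpha>" if "\<alpha> \<in> Poly_Mapping.keys f" for \<alpha>
    using f that by (intro poly_mapping_eqI) (simp add: lookup_minus dominated_def)
  then show ?thesis
    unfolding cremona_pol_def[of n f]
    by (simp add: cremona_pol_sum cremona_pol_single poly_mapping_sum_single)
qed

lemma dominated_cremona_pol: "dominated n (cremona_pol n f)"
  by (auto simp: dominated_def lookup_minus elim!: keys_cremona_pol)

text \<open>Only the relation \<open>y v * z v = 1\<close> enters, and no division, so the identity
  is available in the ring of power series.\<close>

lemma (in coeff_hom) subst_pol_cremona_pol:
  assumes f: "dominated n f" and yz: "\<And>v. v \<in> Poly_Mapping.keys n \<Longrightarrow> y v * z v = 1"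
  shows "subst_pol h y (cremona_pol n f) = mono_eval y n * subst_pol h z f"
proof -
  have "mono_eval y (n - \<alpha>) = mono_eval y n * mono_eval z \<alpha>" if "\<alpha> \<in> Poly_Mapping.keys f" for \<alpha>
  proof -
    have le: "Poly_Mapping.lookup \<alpha> v \<le> Poly_Mapping.lookup n v" for v
      using f that by (auto simp: dominated_def)
    then have sub: "Poly_Mapping.keys \<alpha> \<subseteq> Poly_Mapping.keys n"
      by (metis in_keys_iff le_zero_eq subsetI)
    have n: "n = (n - \<alpha>) + \<alpha>"
      using le by (intro poly_mapping_eqI) (simp add: lookup_minus lookup_add)
    have "mono_eval y \<alpha> * mono_eval z \<alpha> = (\<Prod>v\<in>Poly_Mapping.keys \<alpha>. (y v * z v) ^ Poly_Mapping.lookup \<alpha> v)"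
      by (simp add: mono_eval_def power_mult_distrib prod.distrib)
    also have "\<dots> = 1"
      using sub yz by (intro prod.neutral) auto
    finally have "mono_eval y \<alpha> * mono_eval z \<alpha> = 1" .
    moreover have "mono_eval y n = mono_eval y (n - \<alpha>) * mono_eval y \<alpha>"
      by (subst n) (rule mono_eval_add)
    ultimately show ?thesis by (simp add: mult.assoc)
  qed
  then show ?thesis
    by (simp add: cremona_pol_def subst_pol_sum subst_pol_single)
       (simp add: subst_pol_mono_eval sum_distrib_left mult_ac)
qed

text \<open>On \<open>I\<close> the entries n_i = m_0 - m_i are kept, outside \<open>I\<close> the
  multiplicities m_i. The arbitrary set \<open>I\<close> of base points covers the conjugates of the
  Cremona element by permutations.\<close>

definition cremona :: "nat \<Rightarrow> 'n::finite set \<Rightarrow> 'n divcls \<Rightarrow> 'n divcls" where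
  "cremona d I D = (let m = int d * fst D - (\<Sum>i\<in>I. snd D $ i) in
     (m, \<chi> i. if i \<in> I then m - (fst D - snd D $ i) else snd D $ i))"

lemma fst_cremona: "fst (cremona d I D) = int d * fst D - (\<Sum>i\<in>I. snd D $ i)"
  by (simp add: cremona_def Let_def)

lemma snd_cremona: "snd (cremona d I D) $ i =
   (if i \<in> I then fst (cremona d I D) - (fst D - snd D $ i) else snd D $ i)"
  by (simp add: cremona_def Let_def)

lemma cremona_involution:
  assumes "card I = d + 1"
  shows "cremona d I (cremona d I D) = D"
proof -
  have *: "fst (cremona d I (cremona d I D)) = fst D"
  proof -
    let ?s = "\<Sum>i\<in>I. snd D $ i"
    have "fst (cremona d I (cremona d I D)) =
        int d * fst (cremona d I D) - (\<Sum>i\<in>I. (fst (cremona d I D) - fst D) + snd D $ i)"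
      by (subst fst_cremona) (simp add: snd_cremona algebra_simps)
    also have "\<dots> = int d * fst (cremona d I D) - (int d + 1) * (fst (cremona d I D) - fst D) - ?s"
      by (simp only: sum.distrib sum_constant assms) simp
    also have "\<dots> = fst D"
      by (simp add: fst_cremona algebra_simps)
    finally show ?thesis .
  qed
  moreover have "snd (cremona d I (cremona d I D)) = snd D"
    by (simp add: vec_eq_iff snd_cremona[of d I "cremona d I D"] *) (simp add: snd_cremona)
  ultimately show ?thesis by (simp add: prod_eq_iff)
qed

lemma exponent_le_of_linsys:
  fixes P :: "'n::finite \<Rightarrow> nat \<Rightarrow> complex"
  assumes f: "f \<in> linsys d P D"
    and ax: "\<And>k l. k \<le> d \<Longrightarrow> l \<le> d \<Longrightarrow> P (e l) k = (if k = l then 1 else 0)"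
    and \<alpha>: "\<alpha> \<in> Poly_Mapping.keys f" and l: "l \<le> d"
  shows "int (Poly_Mapping.lookup \<alpha> l) \<le> fst D - snd D $ e l"
proof -
  have "form d (fst D) f" "vanishes_at f (P (e l)) (snd D $ e l)"
    using f by (auto simp: linsys_iff)
  from this(2) have "snd D $ e l \<le> fst D - int (Poly_Mapping.lookup \<alpha> l)"
    using \<alpha> by (subst (asm) vanishes_at_axis[OF \<open>form d (fst D) f\<close> l ax[OF _ l]]) auto
  then show ?thesis by linarith
qed

text \<open>
  The form \<open>f\<close> is sent to \<open>x\<^sup>n f(1/x)\<close>, where \<open>n\<^sub>l = m\<^sub>0 - m\<^sub>l\<close> bounds the degree of \<open>f\<close> in \<open>x\<^sub>l\<close>
  because of its multiplicity at the \<open>l\<close>-th coordinate point.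
\<close>

lemma cremona_pol_mem_linsys:
  fixes P Q :: "'n::finite \<Rightarrow> nat \<Rightarrow> complex"
  assumes f: "f \<in> linsys d P D" and n: "\<And>l. l \<le> d \<Longrightarrow> int (n l) = fst D - snd D $ e l"
    and e: "inj_on e {..d}" and I: "I = e ` {..d}"
    and P: "\<And>k l. k \<le> d \<Longrightarrow> l \<le> d \<Longrightarrow> P (e l) k = (if k = l then 1 else 0)"
    and Q: "\<And>k l. k \<le> d \<Longrightarrow> l \<le> d \<Longrightarrow> Q (e l) k = (if k = l then 1 else 0)"
    and PQ: "\<And>i l. i \<notin> I \<Longrightarrow> l \<le> d \<Longrightarrow> Q i l * P i l = 1"
    and N: "N = (\<Sum>l\<le>d. Poly_Mapping.single l (n l))"
  shows "cremona_pol N f \<in> linsys d Q (cremona d I D) \<and> dominated N f"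
proof -
  have lookup_N: "Poly_Mapping.lookup N l = (if l \<le> d then n l else 0)" for l
    by (simp add: N lookup_sum lookup_single when_def)
  have keys_N: "Poly_Mapping.keys N \<subseteq> {..d}"
    by (auto simp: in_keys_iff lookup_N split: if_splits)
  have f_form: "form d (fst D) f" using f by (simp add: linsys_iff)
  have dom: "dominated N f"
    unfolding dominated_def
  proof (intro ballI allI)
    fix \<alpha> l assume \<alpha>: "\<alpha> \<in> Poly_Mapping.keys f"
    show "Poly_Mapping.lookup \<alpha> l \<le> Poly_Mapping.lookup N l"
    proof (cases "l \<le> d")
      case True
      then show ?thesis
        using exponent_le_of_linsys[OF f P \<alpha> True] n[OF True] by (simp add: lookup_N)
    next
      case False
      then have "l \<notin> Poly_Mapping.keys \<alpha>" using f_form \<alpha> by (auto simp: form_def)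
      then show ?thesis by (simp add: in_keys_iff)
    qed
  qed
  have sumI: "(\<Sum>i\<in>I. g i) = (\<Sum>l\<le>d. g (e l))" for g :: "'n \<Rightarrow> int"
    using e by (simp add: I sum.reindex)
  have deg: "(\<Sum>l\<le>d. int (n l)) - fst D = fst (cremona d I D)"
    by (simp add: n fst_cremona sumI sum_subtractf algebra_simps)
  have form: "form d (fst (cremona d I D)) (cremona_pol N f)"
    unfolding form_def
  proof
    fix \<beta> assume "\<beta> \<in> Poly_Mapping.keys (cremona_pol N f)"
    then obtain \<alpha> where \<alpha>: "\<alpha> \<in> Poly_Mapping.keys f" "\<beta> = N - \<alpha>" by (rule keys_cremona_pol)
    have sub: "Poly_Mapping.keys \<beta> \<subseteq> {..d}"
      using keys_N by (auto simp: \<alpha> in_keys_iff lookup_minus lookup_N split: if_splits)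
    have "N = \<beta> + \<alpha>"
      using dom \<alpha>(1) by (intro poly_mapping_eqI) (simp add: \<alpha>(2) lookup_minus lookup_add dominated_def)
    then have "tdeg N = tdeg \<beta> + tdeg \<alpha>" by (simp add: tdeg_add)
    moreover have "tdeg N = (\<Sum>l\<le>d. n l)"
      using keys_N by (simp add: tdeg_superset[of "{..d}"] lookup_N)
    moreover have "int (tdeg \<alpha>) = fst D" using f_form \<alpha> by (simp add: form_def)
    ultimately have "int (tdeg \<beta>) = fst (cremona d I D)"
      using deg by (metis add_diff_cancel_right' of_nat_add of_nat_sum)
    with sub show "Poly_Mapping.keys \<beta> \<subseteq> {..d} \<and> int (tdeg \<beta>) = fst (cremona d I D)" by simp
  qed
  have "vanishes_at (cremona_pol N f) (Q i) (snd (cremona d I D) $ i)" for i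
  proof (cases "i \<in> I")
    case True
    then obtain l where l: "l \<le> d" "i = e l" by (auto simp: I)
    show ?thesis
      unfolding l(2)
    proof (subst vanishes_at_axis[OF form l(1) Q[OF _ l(1)]]; (intro ballI)?)
      fix \<beta> assume "\<beta> \<in> Poly_Mapping.keys (cremona_pol N f)"
      \<comment> \<open>At a coordinate point the required multiplicity says exactly that the
        exponent of the l-th variable is at most \<open>n l\<close>, which truncated subtraction
        from \<open>N\<close> guarantees.\<close>
      then have "Poly_Mapping.lookup \<beta> l \<le> n l"
        using dominated_cremona_pol[of N f] l lookup_N[of l] unfolding dominated_def by metis
      then show "snd (cremona d I D) $ e l \<le> fst (cremona d I D) - int (Poly_Mapping.lookup \<beta> l)"
        using True l n[of l] by (simp add: snd_cremona)
    qed
  next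
    case False
    show ?thesis
      unfolding vanishes_at_iff
    proof
      fix v :: "nat \<Rightarrow> complex"
      \<comment> \<open>\<open>Y\<close> is a line through \<open>Q i\<close>. For
        \<open>l \<le> d\<close>, \<open>Z\<close> is its inverse, an arc with constant term
        \<open>P i l\<close> because \<open>Q i l * P i l = 1\<close>; shifting the inverse series
        by one extracts the direction \<open>w\<close>.\<close>
      define Y where "Y l = fps_const (Q i l) + fps_X * fps_const (v l)" for l
      define w where "w l = fps_shift 1 (inverse (Y l))" for l
      define Z where "Z l = fps_const (P i l) + fps_X * w l" for l
      have Z: "Z l = inverse (Y l)" if "l \<le> d" for l
      proof (rule fps_ext)
        fix k
        have "inverse (Q i l) = P i l"
          using PQ[OF False that] by (metis inverse_unique)
        then show "fps_nth (Z l) k = fps_nth (inverse (Y l)) k"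
          by (cases k) (simp_all add: Z_def w_def Y_def)
      qed
      have YZ: "Y l * Z l = 1" if "l \<in> Poly_Mapping.keys N" for l
      proof -
        have l: "l \<le> d" using that keys_N by auto
        then have "fps_nth (Y l) 0 \<noteq> 0" using PQ[OF False l] by (auto simp: Y_def)
        then show ?thesis by (simp add: Z[OF l] inverse_mult_eq_1')
      qed
      have "subst_pol fps_const Y (cremona_pol N f) = mono_eval Y N * subst_pol fps_const Z f"
        by (rule fps_const_hom.subst_pol_cremona_pol[OF dom YZ])
      moreover have "fps_ge (snd D $ i) (subst_pol fps_const Z f)"
        unfolding Z_def using f by (intro fps_ge_shift) (simp add: linsys_iff)
      ultimately show "fps_ge (snd (cremona d I D) $ i) (subst_pol fps_const
          (\<lambda>l. fps_const (Q i l) + fps_X * fps_const (v l)) (cremona_pol N f))"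
        using False by (simp add: Y_def[symmetric] fps_ge_mult snd_cremona)
    qed
  qed
  with form dom show ?thesis by (simp add: linsys_iff)
qed

lemma dim_linsys_cremona_standard:
  fixes P Q :: "'n::finite \<Rightarrow> nat \<Rightarrow> complex"
  assumes e: "inj_on e {..d}" and I: "I = e ` {..d}"
    and P: "\<And>k l. k \<le> d \<Longrightarrow> l \<le> d \<Longrightarrow> P (e l) k = (if k = l then 1 else 0)"
    and Q: "\<And>k l. k \<le> d \<Longrightarrow> l \<le> d \<Longrightarrow> Q (e l) k = (if k = l then 1 else 0)"
    and PQ: "\<And>i l. i \<notin> I \<Longrightarrow> l \<le> d \<Longrightarrow> Q i l * P i l = 1"
  shows "mp.dim (linsys d P D) = mp.dim (linsys d Q (cremona d I D))"
proof -
  let ?D = "cremona d I D"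
  have card: "card I = d + 1" using e by (simp add: I card_image)
  have diff: "fst ?D - snd ?D $ e l = fst D - snd D $ e l" if "l \<le> d" for l
    using that by (simp add: snd_cremona I)
  show ?thesis
  proof (cases "\<forall>l\<le>d. fst D - snd D $ e l \<ge> 0")
    case True
    define n where "n l = nat (fst D - snd D $ e l)" for l
    define N where "N = (\<Sum>l\<le>d. Poly_Mapping.single l (n l))"
    have n: "int (n l) = fst D - snd D $ e l" if "l \<le> d" for l
      using True that by (simp add: n_def)
    have n': "int (n l) = fst ?D - snd ?D $ e l" if "l \<le> d" for l
      using n diff that by simp
    have QP: "P i l * Q i l = 1" if "i \<notin> I" "l \<le> d" for i l
      using PQ[OF that] by (simp add: mult.commute)
    note * = cremona_pol_mem_linsys[OF _ n e I P Q PQ N_def]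
    note ** = cremona_pol_mem_linsys[OF _ n' e I Q P QP N_def, unfolded cremona_involution[OF card]]
    show ?thesis
    proof (rule dim_eq_of_linear_bij[OF subspace_linsys])
      show "bij_betw (cremona_pol N) (linsys d P D) (linsys d Q ?D)"
        by (rule bij_betw_byWitness[where f' = "cremona_pol N"])
          (use * ** in \<open>auto intro: cremona_pol_involution\<close>)
    qed (simp_all add: cremona_pol_add cremona_pol_scale)
  next
    case False
    \<comment> \<open>A negative m_0 - m_l would bound an exponent by a negative number, so the
      system is zero. The difference is the same for \<open>D\<close> and its image, hence both
      systems are zero.\<close>
    then obtain l where l: "l \<le> d" "fst D - snd D $ e l < 0" by auto
    have zero: "linsys d R D' = {0}"
      if ax: "\<And>k l. k \<le> d \<Longrightarrow> l \<le> d \<Longrightarrow> R (e l) k = (if k = l then 1 else 0)"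
        and neg: "fst D' - snd D' $ e l < 0" for R :: "'n \<Rightarrow> nat \<Rightarrow> complex" and D' :: "'n divcls"
    proof -
      have "f = 0" if f: "f \<in> linsys d R D'" for f
      proof -
        have "Poly_Mapping.keys f = {}"
          using exponent_le_of_linsys[OF f ax _ l(1)] neg
          by (metis all_not_in_conv not_less of_nat_0_le_iff order.trans)
        then show ?thesis by (metis empty_iff in_keys_iff lookup_zero poly_mapping_eqI)
      qed
      then show ?thesis
        using mp.subspace_0[OF subspace_linsys, of d R D'] by auto
    qed
    show ?thesis
      using zero[OF P, of D] zero[OF Q, of ?D] l diff[OF l(1)] by simp
  qed
qed

subsection \<open>Generic dimension and the Cremona action\<close>

inductive polyfun :: "nat \<Rightarrow> (('n \<Rightarrow> nat \<Rightarrow> complex) \<Rightarrow> complex) \<Rightarrow> bool" for d where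
  const: "polyfun d (\<lambda>P. c)"
| coord: "l \<le> d \<Longrightarrow> polyfun d (\<lambda>P. P i l)"
| add: "polyfun d \<phi> \<Longrightarrow> polyfun d \<psi> \<Longrightarrow> polyfun d (\<lambda>P. \<phi> P + \<psi> P)"
| mult: "polyfun d \<phi> \<Longrightarrow> polyfun d \<psi> \<Longrightarrow> polyfun d (\<lambda>P. \<phi> P * \<psi> P)"

lemma polyfun_sum: "(\<And>x. x \<in> A \<Longrightarrow> polyfun d (\<phi> x)) \<Longrightarrow> polyfun d (\<lambda>P. \<Sum>x\<in>A. \<phi> x P)"
  by (induction A rule: infinite_finite_induct) (auto intro: polyfun.intros)

lemma polyfun_prod: "(\<And>x. x \<in> A \<Longrightarrow> polyfun d (\<phi> x)) \<Longrightarrow> polyfun d (\<lambda>P. \<Prod>x\<in>A. \<phi> x P)"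
  by (induction A rule: infinite_finite_induct) (auto intro: polyfun.intros)

lemma polyfun_power: "polyfun d \<phi> \<Longrightarrow> polyfun d (\<lambda>P. \<phi> P ^ n)"
  by (induction n) (auto intro: polyfun.intros)

lemma polyfun_det:
  fixes A :: "('n \<Rightarrow> nat \<Rightarrow> complex) \<Rightarrow> complex ^ 'm ^ 'm"
  assumes "\<And>i j. polyfun d (\<lambda>P. A P $ i $ j)"
  shows "polyfun d (\<lambda>P. det (A P))"
  unfolding det_def by (intro polyfun_sum polyfun.mult polyfun.const polyfun_prod assms)

lemma pvars_add: "pvars (f + g) \<subseteq> pvars f \<union> pvars g"
  using Poly_Mapping.keys_add[of f g] by (auto simp: pvars_def)

lemma pvars_mult: "pvars (f * g) \<subseteq> pvars f \<union> pvars g" for f g :: "('v, 'c::comm_ring_1) pol"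
proof
  fix v assume "v \<in> pvars (f * g)"
  then obtain \<alpha> where "\<alpha> \<in> Poly_Mapping.keys (f * g)" and v: "v \<in> Poly_Mapping.keys \<alpha>"
    by (auto simp: pvars_def)
  then obtain \<beta> \<gamma> where \<alpha>: "\<alpha> = \<beta> + \<gamma>" and *: "\<beta> \<in> Poly_Mapping.keys f" "\<gamma> \<in> Poly_Mapping.keys g"
    using keys_mult[of f g] by auto
  have "v \<in> Poly_Mapping.keys \<beta> \<union> Poly_Mapping.keys \<gamma>"
    using v Poly_Mapping.keys_add[of \<beta> \<gamma>] unfolding \<alpha> by auto
  with * show "v \<in> pvars f \<union> pvars g" by (auto simp: pvars_def)
qed

lemma polyfun_imp_pol:
  fixes \<phi> :: "('n \<Rightarrow> nat \<Rightarrow> complex) \<Rightarrow> complex"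
  assumes "polyfun d \<phi>"
  shows "\<exists>g. pvars g \<subseteq> UNIV \<times> {..d} \<and> (\<forall>P. subst_pol (\<lambda>c. c) (\<lambda>(i, l). P i l) g = \<phi> P)"
  using assms
proof induction
  case (const c)
  have "pvars (Defs.const c :: ('n \<times> nat, complex) pol) = {}"
    by (auto simp: pvars_def const_def split: if_splits)
  then show ?case by (intro exI[of _ "Defs.const c"]) (auto simp: id_hom.subst_pol_const)
next
  case (coord l i)
  have "pvars (pvar (i, l) :: ('n \<times> nat, complex) pol) \<subseteq> UNIV \<times> {..d}"
    using coord by (auto simp: pvars_def pvar_def monom_of_def split: if_splits)
  then show ?case by (intro exI[of _ "pvar (i, l)"]) (auto simp: id_hom.subst_pol_pvar)
next
  case (add \<phi> \<psi>)
  then obtain g g' where "pvars g \<subseteq> UNIV \<times> {..d}" "\<forall>P. subst_pol (\<lambda>c. c) (\<lambda>(i, l). P i l) g = \<phi> P"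
    "pvars g' \<subseteq> UNIV \<times> {..d}" "\<forall>P. subst_pol (\<lambda>c. c) (\<lambda>(i, l). P i l) g' = \<psi> P" by auto
  then show ?case using pvars_add[of g g']
    by (intro exI[of _ "g + g'"]) (auto simp: id_hom.subst_pol_add)
next
  case (mult \<phi> \<psi>)
  then obtain g g' where "pvars g \<subseteq> UNIV \<times> {..d}" "\<forall>P. subst_pol (\<lambda>c. c) (\<lambda>(i, l). P i l) g = \<phi> P"
    "pvars g' \<subseteq> UNIV \<times> {..d}" "\<forall>P. subst_pol (\<lambda>c. c) (\<lambda>(i, l). P i l) g' = \<psi> P" by auto
  then show ?case using pvars_mult[of g g']
    by (intro exI[of _ "g * g'"]) (auto simp: id_hom.subst_pol_mult)
qed

lemma pol_imp_polyfun:
  fixes g :: "('n \<times> nat, complex) pol"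
  assumes "pvars g \<subseteq> UNIV \<times> {..d}"
  shows "polyfun d (\<lambda>P. subst_pol (\<lambda>c. c) (\<lambda>(i, l). P i l) g)"
  unfolding subst_pol_def
proof (intro polyfun_sum polyfun.mult polyfun.const polyfun_prod polyfun_power)
  fix \<alpha> v assume "\<alpha> \<in> Poly_Mapping.keys g" "v \<in> Poly_Mapping.keys \<alpha>"
  then have "v \<in> UNIV \<times> {..d}" using assms by (auto simp: pvars_def)
  then show "polyfun d (\<lambda>P. case v of (i, l) \<Rightarrow> P i l)"
    by (cases v) (auto intro: polyfun.coord)
qed

text \<open>A nonzero complex polynomial takes a nonzero value, so the open set can be given by a
  function that is not identically zero. Functions are easier to pull back than formal
  polynomials.\<close>

lemma generically_iff:
  fixes R :: "('n::finite \<Rightarrow> nat \<Rightarrow> complex) \<Rightarrow> bool"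
  shows "generically d R \<longleftrightarrow>
    (\<exists>\<phi>. polyfun d \<phi> \<and> (\<exists>P. \<phi> P \<noteq> 0) \<and> (\<forall>P. \<phi> P \<noteq> 0 \<longrightarrow> R P))"
proof
  assume "generically d R"
  then obtain g :: "('n \<times> nat, complex) pol" where g: "g \<noteq> 0" "pvars g \<subseteq> UNIV \<times> {..d}"
    "\<forall>P. subst_pol (\<lambda>c. c) (\<lambda>(i, l). P i l) g \<noteq> 0 \<longrightarrow> R P"
    by (auto simp: generically_def)
  obtain x where "subst_pol (\<lambda>c. c) x g \<noteq> 0" using exists_nonzero_value[OF g(1)] by blast
  moreover have "x = (\<lambda>(i, l). (\<lambda>i l. x (i, l)) i l)" by auto
  ultimately have "\<exists>P. subst_pol (\<lambda>c. c) (\<lambda>(i, l). P i l) g \<noteq> 0" by metis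
  with pol_imp_polyfun[OF g(2)] g(3)
  show "\<exists>\<phi>. polyfun d \<phi> \<and> (\<exists>P. \<phi> P \<noteq> 0) \<and> (\<forall>P. \<phi> P \<noteq> 0 \<longrightarrow> R P)" by blast
next
  assume "\<exists>\<phi>. polyfun d \<phi> \<and> (\<exists>P. \<phi> P \<noteq> 0) \<and> (\<forall>P. \<phi> P \<noteq> 0 \<longrightarrow> R P)"
  then obtain \<phi> where \<phi>: "polyfun d \<phi>" "\<exists>P. \<phi> P \<noteq> 0" "\<forall>P. \<phi> P \<noteq> 0 \<longrightarrow> R P" by blast
  obtain g where g: "pvars g \<subseteq> UNIV \<times> {..d}" "\<forall>P. subst_pol (\<lambda>c. c) (\<lambda>(i, l). P i l) g = \<phi> P"
    using polyfun_imp_pol[OF \<phi>(1)] by blast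
  have "g \<noteq> 0" using g(2) \<phi>(2) by auto
  then show "generically d R" unfolding generically_def using g \<phi>(3) by metis
qed

lemma polyfun_on_line:
  assumes "polyfun d \<phi>"
  shows "\<exists>p. \<forall>s. \<phi> (\<lambda>i l. P i l + s * V i l) = poly p s"
  using assms
proof induction
  case (const c)
  show ?case by (rule exI[of _ "[:c:]"]) simp
next
  case (coord l i)
  show ?case by (rule exI[of _ "[:P i l, V i l:]"]) simp
next
  case (add \<phi> \<psi>)
  then show ?case by (metis poly_add)
next
  case (mult \<phi> \<psi>)
  then show ?case by (metis poly_mult)
qed

text \<open>Irreducibility of affine space: on the line joining \<open>P\<close> and
  \<open>Q\<close> both functions are nonzero polynomials in one variable, and so is their
  product.\<close>

lemma polyfun_nonzero_common:
  assumes "polyfun d \<phi>" "polyfun d \<psi>" "\<phi> P \<noteq> 0" "\<psi> Q \<noteq> 0"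
  shows "\<exists>R. \<phi> R \<noteq> 0 \<and> \<psi> R \<noteq> 0"
proof -
  let ?R = "\<lambda>s i l. P i l + s * (Q i l - P i l)"
  obtain p where p: "\<And>s. \<phi> (?R s) = poly p s" using polyfun_on_line[OF assms(1), of P "\<lambda>i l. Q i l - P i l"] by blast
  obtain q where q: "\<And>s. \<psi> (?R s) = poly q s" using polyfun_on_line[OF assms(2), of P "\<lambda>i l. Q i l - P i l"] by blast
  have "p \<noteq> 0" using p[of 0] assms by auto
  moreover have "q \<noteq> 0" using q[of 1] assms by auto
  ultimately have "p * q \<noteq> 0" by simp
  then obtain s where "poly (p * q) s \<noteq> 0" using poly_all_0_iff_0 by blast
  then show ?thesis using p q by (intro exI[of _ "?R s"]) simp
qed

text \<open>The localization at \<open>u\<close>, with the power that clears denominators left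
  existential; values where \<open>u\<close> vanishes are unconstrained.\<close>

definition regular_fun :: "nat \<Rightarrow> (('n \<Rightarrow> nat \<Rightarrow> complex) \<Rightarrow> complex) \<Rightarrow> (('n \<Rightarrow> nat \<Rightarrow> complex) \<Rightarrow> complex) \<Rightarrow> bool"
  where "regular_fun d u \<phi> \<longleftrightarrow> (\<exists>n \<psi>. polyfun d \<psi> \<and> (\<forall>P. u P \<noteq> 0 \<longrightarrow> u P ^ n * \<phi> P = \<psi> P))"

lemma regular_fun_polyfun: "polyfun d \<phi> \<Longrightarrow> regular_fun d u \<phi>"
  unfolding regular_fun_def by (intro exI[of _ 0] exI[of _ \<phi>]) simp

lemma regular_fun_add:
  assumes "polyfun d u" "regular_fun d u \<phi>" "regular_fun d u \<psi>"
  shows "regular_fun d u (\<lambda>P. \<phi> P + \<psi> P)"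
proof -
  obtain n \<phi>' m \<psi>' where "polyfun d \<phi>'" "\<And>P. u P \<noteq> 0 \<Longrightarrow> u P ^ n * \<phi> P = \<phi>' P"
    "polyfun d \<psi>'" "\<And>P. u P \<noteq> 0 \<Longrightarrow> u P ^ m * \<psi> P = \<psi>' P"
    using assms by (auto simp: regular_fun_def)
  then have "polyfun d (\<lambda>P. u P ^ m * \<phi>' P + u P ^ n * \<psi>' P)"
    "\<forall>P. u P \<noteq> 0 \<longrightarrow> u P ^ (n + m) * (\<phi> P + \<psi> P) = u P ^ m * \<phi>' P + u P ^ n * \<psi>' P"
    using assms(1) by (auto intro!: polyfun.intros polyfun_power simp: power_add algebra_simps)
  then show ?thesis unfolding regular_fun_def by blast
qed

lemma regular_fun_mult:
  assumes "regular_fun d u \<phi>" "regular_fun d u \<psi>"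
  shows "regular_fun d u (\<lambda>P. \<phi> P * \<psi> P)"
proof -
  obtain n \<phi>' m \<psi>' where *: "polyfun d \<phi>'" "\<And>P. u P \<noteq> 0 \<Longrightarrow> u P ^ n * \<phi> P = \<phi>' P"
    "polyfun d \<psi>'" "\<And>P. u P \<noteq> 0 \<Longrightarrow> u P ^ m * \<psi> P = \<psi>' P"
    using assms by (auto simp: regular_fun_def)
  have "u P ^ (n + m) * (\<phi> P * \<psi> P) = \<phi>' P * \<psi>' P" if "u P \<noteq> 0" for P
    by (simp only: *(2,4)[OF that, symmetric] power_add mult_ac)
  moreover have "polyfun d (\<lambda>P. \<phi>' P * \<psi>' P)"
    using * by (blast intro: polyfun.mult)
  ultimately show ?thesis unfolding regular_fun_def by blast
qed

lemma regular_fun_sum: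
  assumes "polyfun d u" "\<And>x. x \<in> A \<Longrightarrow> regular_fun d u (\<phi> x)"
  shows "regular_fun d u (\<lambda>P. \<Sum>x\<in>A. \<phi> x P)"
  using assms(2) by (induction A rule: infinite_finite_induct)
    (auto intro: regular_fun_add assms(1) regular_fun_polyfun polyfun.const)

lemma regular_fun_inverse:
  assumes "polyfun d \<theta>" "\<And>P. u P = \<psi> P * \<theta> P"
  shows "regular_fun d u (\<lambda>P. inverse (\<psi> P))"
  unfolding regular_fun_def
  by (intro exI[of _ 1] exI[of _ \<theta>]) (use assms in \<open>auto simp: field_simps\<close>)

lemma regular_fun_comp:
  assumes "polyfun d \<phi>" and u: "polyfun d u" and T: "\<And>i l. l \<le> d \<Longrightarrow> regular_fun d u (\<lambda>P. T P i l)"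
  shows "regular_fun d u (\<lambda>P. \<phi> (T P))"
  using assms(1)
proof induction
  case (const c)
  show ?case by (rule regular_fun_polyfun[OF polyfun.const])
next
  case (coord l i)
  then show ?case by (rule T)
next
  case (add \<phi> \<psi>)
  show ?case by (rule regular_fun_add[OF u add.IH])
next
  case (mult \<phi> \<psi>)
  show ?case by (rule regular_fun_mult[OF mult.IH])
qed

text \<open>
  As \<open>T\<close> is an involution of the open set \<open>u \<noteq> 0\<close>, it is dominant, so that nonzero polynomials
  pull back to nonzero functions.
\<close>

lemma generically_transfer:
  fixes R R' :: "('n::finite \<Rightarrow> nat \<Rightarrow> complex) \<Rightarrow> bool"
  assumes u: "polyfun d u" "u P0 \<noteq> 0"
    and T: "\<And>i l. l \<le> d \<Longrightarrow> regular_fun d u (\<lambda>P. T P i l)"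
    and uT: "\<And>P. u P \<noteq> 0 \<Longrightarrow> u (T P) \<noteq> 0" and TT: "\<And>P. u P \<noteq> 0 \<Longrightarrow> T (T P) = P"
    and R: "generically d R" and RR': "\<And>P. u P \<noteq> 0 \<Longrightarrow> R (T P) \<Longrightarrow> R' P"
  shows "generically d R'"
proof -
  obtain \<phi> P1 where \<phi>: "polyfun d \<phi>" "\<phi> P1 \<noteq> 0" "\<And>P. \<phi> P \<noteq> 0 \<Longrightarrow> R P"
    using R by (auto simp: generically_iff)
  obtain n \<psi> where \<psi>: "polyfun d \<psi>" "\<And>P. u P \<noteq> 0 \<Longrightarrow> u P ^ n * \<phi> (T P) = \<psi> P"
    using regular_fun_comp[OF \<phi>(1) u(1), of T] T by (auto simp: regular_fun_def)
  obtain P2 where P2: "\<phi> P2 \<noteq> 0" "u P2 \<noteq> 0"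
    using polyfun_nonzero_common[of d \<phi> u P1 P0] \<phi> u by blast
  show ?thesis
    unfolding generically_iff
  proof (intro exI conjI allI impI)
    show "polyfun d (\<lambda>P. u P * \<psi> P)" by (rule polyfun.mult[OF u(1) \<psi>(1)])
    \<comment> \<open>The witness is \<open>T P2\<close>, since applying \<open>T\<close> again
      returns to \<open>P2\<close>, where \<phi> is nonzero.\<close>
    show "u (T P2) * \<psi> (T P2) \<noteq> 0"
      using P2 uT[OF P2(2)] TT[OF P2(2)] \<psi>(2)[of "T P2", symmetric] by simp
    show "R' P" if "u P * \<psi> P \<noteq> 0" for P
    proof (rule RR')
      show "u P \<noteq> 0" using that by auto
      with that \<psi>(2)[of P] have "\<phi> (T P) \<noteq> 0" by auto
      then show "R (T P)" by (rule \<phi>(3))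
    qed
  qed
qed

section \<open>Inversion of coordinates relative to d + 1 base points\<close>

locale cremona_points =
  fixes d :: nat and I :: "'n::finite set" and e :: "nat \<Rightarrow> 'n"
  assumes bij: "bij_betw e {..d} I"
begin

text \<open>The base points are the columns; an identity block outside \<open>I\<close> makes the
  matrix square over the type \<open>'n\<close> without changing the determinant.\<close>

definition frame :: "('n \<Rightarrow> nat \<Rightarrow> complex) \<Rightarrow> complex ^ 'n ^ 'n" where
  "frame P = (\<chi> i j. if i \<in> I \<and> j \<in> I then P j (inv_into {..d} e i) else if i = j then 1 else 0)"

text \<open>The numerator in Cramer's rule: the column of the base point \<open>e l\<close> is
  replaced by the point \<open>q\<close>.\<close>

definition minor :: "('n \<Rightarrow> nat \<Rightarrow> complex) \<Rightarrow> 'n \<Rightarrow> nat \<Rightarrow> complex" where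
  "minor P q l = det (\<chi> i j. if j = e l then (if i \<in> I then P q (inv_into {..d} e i) else 0) else frame P $ i $ j)"

definition coords :: "('n \<Rightarrow> nat \<Rightarrow> complex) \<Rightarrow> 'n \<Rightarrow> nat \<Rightarrow> complex" where
  "coords P q l = (if q \<in> I then (if q = e l then 1 else 0) else minor P q l / det (frame P))"

text \<open>Nonzero exactly if the base points are independent and every other point has only
  nonzero coordinates with respect to them, that is, where the inversion is defined.\<close>

definition denom :: "('n \<Rightarrow> nat \<Rightarrow> complex) \<Rightarrow> complex" where
  "denom P = det (frame P) * (\<Prod>(q, l)\<in>(- I) \<times> {..d}. minor P q l)"

text \<open>The factor \<open>det (frame P) * inverse (minor P q m)\<close> is the inverse of the
  m-th coordinate of \<open>q\<close>. Base points and entries with index above \<open>d\<close>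
  stay untouched, so that applying the map twice returns the function \<open>P\<close>
  itself.\<close>

definition crem_pts :: "('n \<Rightarrow> nat \<Rightarrow> complex) \<Rightarrow> 'n \<Rightarrow> nat \<Rightarrow> complex" where
  "crem_pts P q l = (if q \<in> I \<or> l > d then P q l else
     (\<Sum>m\<le>d. P (e m) l * (det (frame P) * inverse (minor P q m))))"

lemma e_mem: "l \<le> d \<Longrightarrow> e l \<in> I"
  using bij by (auto simp: bij_betw_def)

lemma e_eq_iff: "l \<le> d \<Longrightarrow> m \<le> d \<Longrightarrow> e l = e m \<longleftrightarrow> l = m"
  using bij by (auto simp: bij_betw_def dest: inj_onD)

lemma inv_e: "l \<le> d \<Longrightarrow> inv_into {..d} e (e l) = l"
  using bij by (simp add: bij_betw_def inv_into_f_f)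

lemma inv_e_le: "i \<in> I \<Longrightarrow> inv_into {..d} e i \<le> d"
  using bij inv_into_into[of i e "{..d}"] by (auto simp: bij_betw_def)

lemma sum_I: "(\<Sum>i\<in>I. g i) = (\<Sum>l\<le>d. g (e l))"
  using bij by (rule sum.reindex_bij_betw[symmetric])

lemma frame_e: "l \<le> d \<Longrightarrow> m \<le> d \<Longrightarrow> frame P $ e l $ e m = P (e m) l"
  by (simp add: frame_def e_mem inv_e)

lemma frame_outside: "i \<in> I \<Longrightarrow> j \<notin> I \<Longrightarrow> frame P $ i $ j = 0"
  "i \<in> I \<Longrightarrow> j \<notin> I \<Longrightarrow> frame P $ j $ i = 0"
  by (auto simp: frame_def)

lemma sum_UNIV_I:
  fixes g :: "'n \<Rightarrow> complex"
  assumes "\<And>j. j \<notin> I \<Longrightarrow> g j = 0"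
  shows "(\<Sum>j\<in>UNIV. g j) = (\<Sum>m\<le>d. g (e m))"
proof -
  have "(\<Sum>j\<in>UNIV. g j) = (\<Sum>j\<in>I. g j)"
    by (rule sum.mono_neutral_right) (use assms in auto)
  then show ?thesis by (simp add: sum_I)
qed

lemma polyfun_frame: "polyfun d (\<lambda>P. frame P $ i $ j)"
  by (cases "i \<in> I \<and> j \<in> I"; cases "i = j") (auto simp: frame_def intro!: polyfun.intros inv_e_le)

lemma polyfun_det_frame: "polyfun d (\<lambda>P. det (frame P))"
  by (intro polyfun_det polyfun_frame)

lemma polyfun_minor: "polyfun d (\<lambda>P. minor P q l)"
  unfolding minor_def
proof (rule polyfun_det)
  fix i j
  show "polyfun d (\<lambda>P. (\<chi> i j. if j = e l then if i \<in> I then P q (inv_into {..d} e i) else 0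
      else frame P $ i $ j) $ i $ j)"
    by (cases "j = e l"; cases "i \<in> I") (auto intro!: polyfun.intros inv_e_le polyfun_frame)
qed

lemma polyfun_denom: "polyfun d denom"
proof -
  have "polyfun d (\<lambda>P. det (frame P) * (\<Prod>x\<in>(- I) \<times> {..d}. minor P (fst x) (snd x)))"
    by (intro polyfun.mult polyfun_prod polyfun_det_frame polyfun_minor)
  moreover have "(\<lambda>P. det (frame P) * (\<Prod>x\<in>(- I) \<times> {..d}. minor P (fst x) (snd x))) = denom"
    by (rule ext) (simp add: denom_def case_prod_beta)
  ultimately show ?thesis by simp
qed

lemma denom_nonzero:
  assumes "denom P \<noteq> 0"
  shows "det (frame P) \<noteq> 0" "\<And>q l. q \<notin> I \<Longrightarrow> l \<le> d \<Longrightarrow> minor P q l \<noteq> 0"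
  using assms by (auto simp: denom_def)

lemma regular_fun_crem_pts:
  assumes "l \<le> d"
  shows "regular_fun d denom (\<lambda>P. crem_pts P q l)"
proof (cases "q \<in> I")
  case True
  then show ?thesis by (simp add: crem_pts_def) (intro regular_fun_polyfun polyfun.coord assms)
next
  case False
  have "regular_fun d denom (\<lambda>P. inverse (minor P q m))" if m: "m \<le> d" for m
  proof (rule regular_fun_inverse)
    let ?S = "((- I) \<times> {..d}) - {(q, m)}"
    show "polyfun d (\<lambda>P. det (frame P) * (\<Prod>x\<in>?S. minor P (fst x) (snd x)))"
      by (intro polyfun.mult polyfun_prod polyfun_det_frame polyfun_minor)
    show "denom P = minor P q m * (det (frame P) * (\<Prod>x\<in>?S. minor P (fst x) (snd x)))" for P
      unfolding denom_def
      by (subst prod.remove[of _ "(q, m)"]) (use False m in \<open>auto simp: case_prod_beta\<close>)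
  qed
  then have "regular_fun d denom (\<lambda>P. \<Sum>m\<le>d. P (e m) l * (det (frame P) * inverse (minor P q m)))"
    by (intro regular_fun_sum regular_fun_mult polyfun_denom)
      (auto intro!: regular_fun_polyfun polyfun.coord polyfun_det_frame assms)
  then show ?thesis using False assms by (simp add: crem_pts_def)
qed

lemma coords_eq:
  assumes "det (frame P) \<noteq> 0" "l \<le> d"
  shows "P q l = (\<Sum>m\<le>d. P (e m) l * coords P q m)"
proof (cases "q \<in> I")
  case True
  then obtain k where k: "k \<le> d" "q = e k" using bij by (auto simp: bij_betw_def)
  have "(\<Sum>m\<le>d. P (e m) l * coords P q m) = (\<Sum>m\<le>d. if m = k then P (e m) l else 0)"
    using True k by (intro sum.cong refl) (auto simp: coords_def e_eq_iff)
  then show ?thesis using k by simp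
next
  case False
  define b :: "complex ^ 'n" where "b = (\<chi> i. if i \<in> I then P q (inv_into {..d} e i) else 0)"
  define x :: "complex ^ 'n" where
    "x = (\<chi> k. det (\<chi> i j. if j = k then b $ i else frame P $ i $ j) / det (frame P))"
  have "frame P *v x = b"
    using cramer[OF assms(1), of x b] by (simp add: x_def)
  then have "b $ e l = (\<Sum>j\<in>UNIV. frame P $ e l $ j * x $ j)"
    by (auto simp: matrix_vector_mult_def)
  also have "\<dots> = (\<Sum>m\<le>d. frame P $ e l $ e m * x $ e m)"
    by (rule sum_UNIV_I) (simp add: frame_outside e_mem assms)
  also have "\<dots> = (\<Sum>m\<le>d. P (e m) l * coords P q m)"
    using False assms by (intro sum.cong refl) (simp add: frame_e x_def coords_def minor_def b_def cong: if_cong)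
  finally show ?thesis using assms by (simp add: b_def e_mem inv_e)
qed

definition dual_frame :: "('n \<Rightarrow> nat \<Rightarrow> complex) \<Rightarrow> nat \<Rightarrow> nat \<Rightarrow> complex" where
  "dual_frame P l m = matrix_inv (frame P) $ e l $ e m"

lemma dual_frame:
  assumes "det (frame P) \<noteq> 0" "l \<le> d" "k \<le> d"
  shows "(\<Sum>j\<le>d. P (e j) l * dual_frame P j k) = (if l = k then 1 else 0)"
    and "(\<Sum>j\<le>d. dual_frame P l j * P (e k) j) = (if l = k then 1 else 0)"
proof -
  have "invertible (frame P)" using assms(1) by (simp add: invertible_det_nz)
  then have "frame P ** matrix_inv (frame P) = mat 1 \<and> matrix_inv (frame P) ** frame P = mat 1"
    unfolding invertible_def matrix_inv_def by (rule someI_ex)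
  then have inv: "frame P ** matrix_inv (frame P) = mat 1" "matrix_inv (frame P) ** frame P = mat 1"
    by auto
  have "(\<Sum>j\<le>d. P (e j) l * dual_frame P j k) = (\<Sum>j\<le>d. frame P $ e l $ e j * matrix_inv (frame P) $ e j $ e k)"
    using assms by (intro sum.cong refl) (simp add: frame_e dual_frame_def)
  also have "\<dots> = (\<Sum>j\<in>UNIV. frame P $ e l $ j * matrix_inv (frame P) $ j $ e k)"
    by (rule sum_UNIV_I[symmetric]) (simp add: frame_outside e_mem assms)
  also have "\<dots> = (frame P ** matrix_inv (frame P)) $ e l $ e k"
    by (simp add: matrix_matrix_mult_def)
  also have "\<dots> = (if l = k then 1 else 0)"
    using assms by (simp add: inv mat_def e_eq_iff)
  finally show "(\<Sum>j\<le>d. P (e j) l * dual_frame P j k) = (if l = k then 1 else 0)" .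
  have "(\<Sum>j\<le>d. dual_frame P l j * P (e k) j) = (\<Sum>j\<le>d. matrix_inv (frame P) $ e l $ e j * frame P $ e j $ e k)"
    using assms by (intro sum.cong refl) (simp add: frame_e dual_frame_def)
  also have "\<dots> = (\<Sum>j\<in>UNIV. matrix_inv (frame P) $ e l $ j * frame P $ j $ e k)"
    by (rule sum_UNIV_I[symmetric]) (simp add: frame_outside e_mem assms)
  also have "\<dots> = (matrix_inv (frame P) ** frame P) $ e l $ e k"
    by (simp add: matrix_matrix_mult_def)
  also have "\<dots> = (if l = k then 1 else 0)"
    using assms by (simp add: inv mat_def e_eq_iff)
  finally show "(\<Sum>j\<le>d. dual_frame P l j * P (e k) j) = (if l = k then 1 else 0)" .
qed

text \<open>Reads off the coordinates of a transformed point from any expression in the base points,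
  without expanding determinants.\<close>

lemma coords_unique:
  assumes "det (frame P) \<noteq> 0" and x: "\<And>l. l \<le> d \<Longrightarrow> P q l = (\<Sum>m\<le>d. P (e m) l * x m)" and k: "k \<le> d"
  shows "coords P q k = x k"
proof -
  have *: "y k = (\<Sum>l\<le>d. dual_frame P k l * P q l)"
    if y: "\<And>l. l \<le> d \<Longrightarrow> P q l = (\<Sum>m\<le>d. P (e m) l * y m)" for y
  proof -
    have "(\<Sum>l\<le>d. dual_frame P k l * P q l) = (\<Sum>l\<le>d. \<Sum>m\<le>d. dual_frame P k l * P (e m) l * y m)"
      by (intro sum.cong refl) (simp add: y sum_distrib_left mult_ac)
    also have "\<dots> = (\<Sum>m\<le>d. (\<Sum>l\<le>d. dual_frame P k l * P (e m) l) * y m)"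
      by (subst sum.swap) (simp add: sum_distrib_right)
    also have "\<dots> = (\<Sum>m\<le>d. if k = m then y m else 0)"
      by (intro sum.cong refl) (simp add: dual_frame assms(1) k)
    finally show ?thesis using k by simp
  qed
  show ?thesis using *[OF coords_eq[OF assms(1)]] *[OF x] by simp
qed

lemma frame_crem_pts [simp]: "frame (crem_pts P) = frame P"
  by (simp add: frame_def crem_pts_def vec_eq_iff)

lemma crem_pts_e: "l \<le> d \<Longrightarrow> crem_pts P (e l) = P (e l)"
  by (simp add: crem_pts_def e_mem fun_eq_iff)

lemma coords_crem_pts:
  assumes "denom P \<noteq> 0" "q \<notin> I" "l \<le> d"
  shows "coords (crem_pts P) q l = inverse (coords P q l)"
proof (rule coords_unique)
  show "crem_pts P q l = (\<Sum>m\<le>d. crem_pts P (e m) l * inverse (coords P q m))" if "l \<le> d" for l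
    using assms that by (simp add: crem_pts_e) (simp add: crem_pts_def coords_def divide_inverse mult.commute)
qed (use assms denom_nonzero in auto)

lemma minor_crem_pts:
  assumes "denom P \<noteq> 0" "q \<notin> I" "l \<le> d"
  shows "minor (crem_pts P) q l = det (frame P) ^ 2 / minor P q l"
proof -
  have "minor (crem_pts P) q l / det (frame P) = det (frame P) / minor P q l"
    using coords_crem_pts[OF assms] assms(2) by (simp add: coords_def)
  then show ?thesis using denom_nonzero[OF assms(1)] assms(2,3)
    by (simp add: field_simps power2_eq_square)
qed

lemma denom_crem_pts: "denom P \<noteq> 0 \<Longrightarrow> denom (crem_pts P) \<noteq> 0"
  using denom_nonzero[of P] by (auto simp: denom_def[of "crem_pts P"] minor_crem_pts)

lemma crem_pts_involution:
  assumes "denom P \<noteq> 0"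
  shows "crem_pts (crem_pts P) = P"
proof (intro ext)
  fix q l
  show "crem_pts (crem_pts P) q l = P q l"
  proof (cases "q \<in> I \<or> l > d")
    case True
    then show ?thesis by (auto simp: crem_pts_def)
  next
    case False
    then have "crem_pts (crem_pts P) q l =
        (\<Sum>m\<le>d. P (e m) l * (det (frame P) * inverse (det (frame P) ^ 2 / minor P q m)))"
      by (subst crem_pts_def) (auto simp: crem_pts_e minor_crem_pts[OF assms] intro!: sum.cong)
    also have "\<dots> = (\<Sum>m\<le>d. P (e m) l * coords P q m)"
      using False denom_nonzero[OF assms]
      by (intro sum.cong refl) (simp add: coords_def field_simps power2_eq_square)
    also have "\<dots> = P q l"
      using False denom_nonzero[OF assms] by (intro coords_eq[symmetric]) auto
    finally show ?thesis .
  qed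
qed

lemma dim_linsys_coords:
  assumes "det (frame P) \<noteq> 0"
  shows "mp.dim (linsys d P D) = mp.dim (linsys d (coords P) D)"
proof (rule dim_linsys_lin_change[where B = "\<lambda>l j. P (e j) l" and B' = "dual_frame P"])
  show "P i l = (\<Sum>j\<le>d. P (e j) l * coords P i j)" if "l \<le> d" for i l
    by (rule coords_eq[OF assms that])
qed (use dual_frame[OF assms] in auto)

text \<open>Linear changes bring both configurations into position with the base points at the
  coordinate points; there the other points are related by coordinatewise inversion.\<close>

lemma dim_linsys_cremona:
  assumes "denom P \<noteq> 0"
  shows "mp.dim (linsys d P D) = mp.dim (linsys d (crem_pts P) (cremona d I D))"
proof -
  note nz = denom_nonzero[OF assms]
  have "mp.dim (linsys d (coords P) D) = mp.dim (linsys d (coords (crem_pts P)) (cremona d I D))"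
  proof (rule dim_linsys_cremona_standard)
    show "inj_on e {..d}" "I = e ` {..d}" using bij by (auto simp: bij_betw_def)
    show "coords P (e l) k = (if k = l then 1 else 0)"
      "coords (crem_pts P) (e l) k = (if k = l then 1 else 0)" if "k \<le> d" "l \<le> d" for k l
      using that by (auto simp: coords_def e_mem e_eq_iff)
    show "coords (crem_pts P) i l * coords P i l = 1" if "i \<notin> I" "l \<le> d" for i l
      using coords_crem_pts[OF assms that] nz that by (simp add: coords_def)
  qed
  then show ?thesis using dim_linsys_coords[of P D] dim_linsys_coords[of "crem_pts P"] nz by simp
qed

lemma denom_exists_nonzero: "\<exists>P. denom P \<noteq> 0"
proof -
  \<comment> \<open>Base points at the coordinate points and all other points equal to (1, ..., 1),
    so that every factor of \<open>denom\<close> is 1.\<close>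
  define P :: "'n \<Rightarrow> nat \<Rightarrow> complex" where "P q l = (if q \<in> I then if q = e l then 1 else 0 else 1)" for q l
  have "frame P = mat 1"
    using bij by (auto simp: vec_eq_iff frame_def mat_def P_def bij_betw_def f_inv_into_f)
  then have det: "det (frame P) = 1" by simp
  have "coords P q l = 1" if "q \<notin> I" "l \<le> d" for q l
  proof (rule coords_unique)
    show "P q l = (\<Sum>m\<le>d. P (e m) l * 1)" if "l \<le> d" for l
    proof -
      have "(\<Sum>m\<le>d. P (e m) l * 1) = (\<Sum>m\<le>d. if m = l then 1 else 0)"
        using that by (intro sum.cong refl) (auto simp: P_def e_mem e_eq_iff)
      then show ?thesis using that \<open>q \<notin> I\<close> by (simp add: P_def)
    qed
  qed (use det that in auto)
  then have "minor P q l = 1" if "q \<notin> I" "l \<le> d" for q l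
    using that det by (simp add: coords_def)
  then have "denom P = 1" by (auto simp: denom_def det intro!: prod.neutral)
  then show ?thesis by (intro exI[of _ P]) simp
qed

lemma generically_dim_cremona:
  assumes "generically d (\<lambda>P. mp.dim (linsys d P D) = n)"
  shows "generically d (\<lambda>P. mp.dim (linsys d P (cremona d I D)) = n)"
proof -
  obtain P0 where "denom P0 \<noteq> 0" using denom_exists_nonzero by blast
  then show ?thesis
  proof (rule generically_transfer[OF polyfun_denom _ regular_fun_crem_pts denom_crem_pts
        crem_pts_involution assms])
    fix P assume P: "denom P \<noteq> 0" "mp.dim (linsys d (crem_pts P) D) = n"
    have "mp.dim (linsys d (crem_pts P) D) = mp.dim (linsys d (crem_pts (crem_pts P)) (cremona d I D))"
      by (rule dim_linsys_cremona[OF denom_crem_pts[OF P(1)]])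
    then show "mp.dim (linsys d P (cremona d I D)) = n"
      using P by (simp add: crem_pts_involution)
  qed
qed

end

text \<open>
  Both sides are \<open>THE\<close> over the same set of numbers, so the existence of a generic dimension is
  not needed.
\<close>

lemma h0_cremona:
  fixes D :: "'n::finite divcls"
  assumes "card I = d + 1"
  shows "h0 d (cremona d I D) = h0 d D"
proof -
  obtain e where e: "bij_betw e {..<d+1} I"
    using ex_bij_betw_nat_finite[of I] assms by (metis atLeast0LessThan finite)
  interpret cremona_points d I e
    using e by unfold_locales (simp add: lessThan_Suc_atMost)
  have "generically d (\<lambda>P. mp.dim (linsys d P (cremona d I D)) = n) \<longleftrightarrow>
      generically d (\<lambda>P. mp.dim (linsys d P D) = n)" for n
    using generically_dim_cremona[of D n] generically_dim_cremona[of "cremona d I D" n]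
    by (auto simp: cremona_involution[OF assms])
  then show ?thesis by (simp add: h0_def)
qed

text \<open>A dimension that is constant in the points is the generic one; it is unique because a
  generic property holds for at least one configuration.\<close>

lemma h0_eqI:
  fixes D :: "'n::finite divcls"
  assumes "\<And>P :: 'n \<Rightarrow> nat \<Rightarrow> complex. mp.dim (linsys d P D) = n"
  shows "h0 d D = n"
  unfolding h0_def
proof (rule the_equality)
  show "generically d (\<lambda>P. mp.dim (linsys d P D) = n)"
    unfolding generically_iff using assms by (intro exI[of _ "\<lambda>_. 1"]) (auto intro: polyfun.const)
  show "m = n" if "generically d (\<lambda>P. mp.dim (linsys d P D) = m)" for m
    using that assms by (auto simp: generically_iff)
qed

section \<open>Linear systems of degree at most zero\<close>

lemma form_nonpos:
  assumes "form d n f" "n \<le> 0"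
  shows "f = (if n = 0 then const (Poly_Mapping.lookup f 0) else 0)"
proof -
  have key: "\<alpha> = 0 \<and> n = 0" if "\<alpha> \<in> Poly_Mapping.keys f" for \<alpha>
  proof -
    have "int (tdeg \<alpha>) = n" using assms that by (simp add: form_def)
    then have "n = 0" "tdeg \<alpha> = 0" using assms(2) by auto
    then have "Poly_Mapping.lookup \<alpha> v = 0" for v
      by (cases "v \<in> Poly_Mapping.keys \<alpha>") (auto simp: tdeg_def in_keys_iff)
    then have "\<alpha> = 0" by (intro poly_mapping_eqI) simp
    with \<open>n = 0\<close> show ?thesis by simp
  qed
  show ?thesis
    by (rule poly_mapping_eqI) (use key in \<open>auto simp: const_def lookup_single when_def in_keys_iff\<close>)
qed

lemma vanishes_at_const: "vanishes_at (const c) p m \<longleftrightarrow> c = 0 \<or> m \<le> 0" for c :: "'c::comm_ring_1"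
proof -
  have "Poly_Mapping.keys (const c :: (nat, 'c) pol) = (if c = 0 then {} else {0})"
    by (simp add: const_def)
  then show ?thesis by (simp add: vanishes_at_def const_hom.subst_pol_const)
qed

lemma h0_neg: "fst D < 0 \<Longrightarrow> h0 d D = 0"
proof (rule h0_eqI)
  fix P :: "'a \<Rightarrow> nat \<Rightarrow> complex"
  assume "fst D < 0"
  then have "linsys d P D \<subseteq> {0}" by (auto simp: linsys_iff dest!: form_nonpos)
  then have "linsys d P D = {0}" using mp.subspace_0[OF subspace_linsys, of d P D] by auto
  then show "mp.dim (linsys d P D) = 0" using mp.dim_span_eq_card_independent[OF mp.independent_empty] by simp
qed

lemma h0_const: "fst D = 0 \<Longrightarrow> snd D $ i > 0 \<Longrightarrow> h0 d D = 0"
proof (rule h0_eqI)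
  fix P :: "'a \<Rightarrow> nat \<Rightarrow> complex"
  assume *: "fst D = 0" "snd D $ i > 0"
  have "f = 0" if f: "f \<in> linsys d P D" for f
  proof -
    obtain c where c: "f = const c" using f form_nonpos[of d 0 f] * by (auto simp: linsys_iff)
    have "vanishes_at f (P i) (snd D $ i)" using f by (simp add: linsys_iff)
    then show ?thesis using * by (simp add: c vanishes_at_const const_hom.hom_0)
  qed
  then have "linsys d P D = {0}" using mp.subspace_0[OF subspace_linsys, of d P D] by auto
  then show "mp.dim (linsys d P D) = 0" using mp.dim_span_eq_card_independent[OF mp.independent_empty] by simp
qed

lemma h0_exc: "h0 d (exc i) = 1"
proof (rule h0_eqI)
  fix P :: "'a \<Rightarrow> nat \<Rightarrow> complex"
  have "const c \<in> linsys d P (exc i)" for c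
    using form_const[of d c] by (simp add: linsys_iff exc_def vanishes_at_const axis_def)
  then have "linsys d P (exc i) = range const"
    using form_nonpos[of d 0] by (fastforce simp: linsys_iff exc_def)
  also have "\<dots> = mp.span {1}"
    by (auto simp: mp.span_singleton mp_scale_def)
  finally show "mp.dim (linsys d P (exc i)) = 1"
    by (simp add: mp.dim_eq_card_independent)
qed

subsection \<open>Effective classes of anticanonical degree one\<close>

definition int_deg :: "nat \<Rightarrow> 'n::finite divcls \<Rightarrow> int" where
  "int_deg d D = (int d + 1) * fst D - (\<Sum>i\<in>UNIV. snd D $ i)"

lemma antican_deg_eq: "d \<ge> 2 \<Longrightarrow> antican_deg d D = of_int (int_deg d D)"
proof -
  assume d: "d \<ge> 2"
  have "mukai_form d (- canon d) D = (int d - 1) * int_deg d D"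
    by (simp add: mukai_form_def canon_def int_deg_def sum_distrib_left algebra_simps)
  then show ?thesis using d by (simp add: antican_deg_def)
qed

lemma eff_deg_one_iff: "d \<ge> 2 \<Longrightarrow> D \<in> eff_deg_one d \<longleftrightarrow> h0 d D > 0 \<and> int_deg d D = 1"
  by (simp add: eff_deg_one_def antican_deg_eq)

lemma sum_indicator: "(\<Sum>i\<in>UNIV. if i \<in> I then g i else 0) = sum g I" for I :: "'n::finite set"
  by (simp add: sum.If_cases)

text \<open>\<open>s\<close> is the Mukai product of \<open>D\<close> with the root H minus the sum
  of the E_i over \<open>I\<close>. For \<open>card I = d + 1\<close> this root has self-product -2
  and degree zero, so the map is the reflection adding \<open>s\<close> times the root.\<close>

lemma cremona_shift:
  assumes "s = (int d - 1) * fst D - (\<Sum>i\<in>I. snd D $ i)"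
  shows "fst (cremona d I D) = fst D + s"
    and "snd (cremona d I D) $ i = snd D $ i + (if i \<in> I then s else 0)"
  using assms by (auto simp: snd_cremona fst_cremona algebra_simps)

lemma int_deg_cremona:
  assumes "card I = d + 1"
  shows "int_deg d (cremona d I D) = int_deg d D"
  by (simp add: int_deg_def cremona_shift[OF refl] sum.distrib sum_indicator assms algebra_simps)

lemma mukai_form_cremona:
  assumes "card I = d + 1"
  shows "mukai_form d (cremona d I D) (cremona d I D') = mukai_form d D D'"
proof -
  define s where "s = (int d - 1) * fst D - (\<Sum>i\<in>I. snd D $ i)"
  define t where "t = (int d - 1) * fst D' - (\<Sum>i\<in>I. snd D' $ i)"
  have "(\<Sum>i\<in>UNIV. (snd D $ i + (if i \<in> I then s else 0)) * (snd D' $ i + (if i \<in> I then t else 0))) =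
      (\<Sum>i\<in>UNIV. snd D $ i * snd D' $ i + (if i \<in> I then t * snd D $ i + s * snd D' $ i + s * t else 0))"
    by (intro sum.cong refl) (simp add: algebra_simps)
  also have "\<dots> = (\<Sum>i\<in>UNIV. snd D $ i * snd D' $ i) + t * (\<Sum>i\<in>I. snd D $ i) +
      s * (\<Sum>i\<in>I. snd D' $ i) + (int d + 1) * (s * t)"
    by (simp add: sum.distrib sum_indicator sum_distrib_left assms)
  finally have "mukai_form d (cremona d I D) (cremona d I D') =
     (int d - 1) * (fst D + s) * (fst D' + t) - ((\<Sum>i\<in>UNIV. snd D $ i * snd D' $ i) +
      t * ((int d - 1) * fst D - s) + s * ((int d - 1) * fst D' - t) + (int d + 1) * (s * t))"
    by (simp add: mukai_form_def cremona_shift[OF s_def] cremona_shift[OF t_def])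
       (simp add: s_def t_def)
  then show ?thesis by (simp add: mukai_form_def algebra_simps)
qed

section \<open>Negative definiteness orthogonal to the canonical class\<close>

lemma sum_int_squared_le:
  fixes f :: "'a \<Rightarrow> int"
  shows "(\<Sum>i\<in>A. f i)\<^sup>2 \<le> int (card A) * (\<Sum>i\<in>A. (f i)\<^sup>2)"
proof -
  have "(\<Sum>i\<in>A. real_of_int (f i))\<^sup>2 \<le> (\<Sum>i\<in>A. (real_of_int (f i))\<^sup>2) * real (card A)"
    by (rule sum_squared_le_sum_of_squares)
  then have "real_of_int ((\<Sum>i\<in>A. f i)\<^sup>2) \<le> real_of_int (int (card A) * (\<Sum>i\<in>A. (f i)\<^sup>2))"
    by (simp add: mult.commute)
  then show ?thesis by (simp only: of_int_le_iff)
qed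

text \<open>For \<open>d \<ge> 2\<close> the first hypothesis means (K, K) > 0, as (K, K) =
  (d-1)((d+1)^2 - (d-1)k). In degree zero the multiplicities sum to (d+1)m_0, and Cauchy-Schwarz
  bounds the square of this by k times their sum of squares.\<close>

lemma mukai_form_neg:
  fixes D :: "'n::finite divcls"
  assumes k: "(int d - 1) * int CARD('n) < (int d + 1)\<^sup>2" and "int_deg d D = 0" "D \<noteq> 0"
  shows "mukai_form d D D < 0"
proof -
  let ?S = "\<Sum>i\<in>UNIV. (snd D $ i)\<^sup>2"
  have form: "mukai_form d D D = (int d - 1) * (fst D)\<^sup>2 - ?S"
    by (simp add: mukai_form_def power2_eq_square mult.assoc)
  show ?thesis
  proof (cases "fst D = 0")
    case True
    with assms(3) have "snd D \<noteq> 0" by (auto simp: prod_eq_iff)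
    then obtain i where "snd D $ i \<noteq> 0" by (auto simp: vec_eq_iff)
    then have "?S > 0" by (intro sum_pos2[of _ i]) auto
    then show ?thesis using True by (simp add: form)
  next
    case False
    have "((int d + 1) * fst D)\<^sup>2 = (\<Sum>i\<in>UNIV. snd D $ i)\<^sup>2"
      using assms(2) by (simp add: int_deg_def)
    also have "\<dots> \<le> int CARD('n) * ?S"
      by (rule sum_int_squared_le)
    finally have 1: "(int d + 1)\<^sup>2 * (fst D)\<^sup>2 \<le> int CARD('n) * ?S"
      by (simp add: power_mult_distrib)
    have "(int d - 1) * int CARD('n) * (fst D)\<^sup>2 < (int d + 1)\<^sup>2 * (fst D)\<^sup>2"
      using k False by (intro mult_strict_right_mono) auto
    with 1 have "int CARD('n) * mukai_form d D D < 0"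
      by (simp add: form algebra_simps)
    then show ?thesis by (simp add: mult_less_0_iff)
  qed
qed

lemma mukai_form_diff:
  "mukai_form d (D - D') (D - D') = mukai_form d D D + mukai_form d D' D' - 2 * mukai_form d D D'"
proof -
  have "(\<Sum>i\<in>UNIV. (snd D $ i - snd D' $ i) * (snd D $ i - snd D' $ i)) =
    (\<Sum>i\<in>UNIV. snd D $ i * snd D $ i) + (\<Sum>i\<in>UNIV. snd D' $ i * snd D' $ i) -
      2 * (\<Sum>i\<in>UNIV. snd D $ i * snd D' $ i)"
    unfolding sum_distrib_left sum.distrib[symmetric] sum_subtractf[symmetric]
    by (intro sum.cong refl) (simp add: algebra_simps)
  then show ?thesis by (simp add: mukai_form_def algebra_simps)
qed

lemma int_deg_diff: "int_deg d (D - D') = int_deg d D - int_deg d D'"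
  by (simp add: int_deg_def algebra_simps sum_subtractf)

lemma mukai_form_exc:
  fixes i :: "'n::finite"
  shows "mukai_form d (exc i) (exc i) = -1"
proof -
  have "(\<Sum>j\<in>UNIV. (axis i (1::int) :: int ^ 'n) $ j * axis i 1 $ j) = (\<Sum>j\<in>UNIV. if j = i then 1 else 0)"
    by (intro sum.cong refl) (simp add: axis_def)
  then show ?thesis by (simp add: mukai_form_def exc_def)
qed

lemma int_deg_exc:
  fixes i :: "'n::finite"
  shows "int_deg d (exc i) = 1"
proof -
  have "(\<Sum>j\<in>UNIV. (axis i (1::int) :: int ^ 'n) $ j) = (\<Sum>j\<in>UNIV. if j = i then 1 else 0)"
    by (intro sum.cong refl) (simp add: axis_def)
  then show ?thesis by (simp add: int_deg_def exc_def sum_negf)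
qed

lemma exc_mem_eff_deg_one: "d \<ge> 2 \<Longrightarrow> exc i \<in> eff_deg_one d"
  by (simp add: eff_deg_one_iff h0_exc int_deg_exc)

lemma exc_eq_iff: "exc i = exc j \<longleftrightarrow> i = j"
  by (auto simp: exc_def axis_eq_axis)

lemma eff_deg_one_fst_nonneg: "D \<in> eff_deg_one d \<Longrightarrow> fst D \<ge> 0"
  using h0_neg[of D d] by (cases "fst D < 0") (auto simp: eff_deg_one_def)

text \<open>Sections are constants, so no multiplicity is positive; nonnegative integers -m_i with
  sum one have a single nonzero entry.\<close>

lemma eff_deg_one_fst_zero:
  assumes "d \<ge> 2" "D \<in> eff_deg_one d" "fst D = 0"
  obtains i where "D = exc i"
proof -
  have np: "snd D $ i \<le> 0" for i
    using h0_const[of D i d] assms by (fastforce simp: eff_deg_one_def not_less[symmetric])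
  have sum: "(\<Sum>i\<in>UNIV. - (snd D $ i)) = 1"
    using assms by (simp add: eff_deg_one_iff int_deg_def sum_negf)
  then obtain i where i: "snd D $ i \<noteq> 0" by (metis (mono_tags, lifting) neg_equal_0_iff_equal sum.neutral zero_neq_one)
  have "(\<Sum>j\<in>UNIV. - (snd D $ j)) = - (snd D $ i) + (\<Sum>j\<in>UNIV - {i}. - (snd D $ j))"
    by (simp add: sum.remove)
  moreover have nn: "(\<Sum>j\<in>UNIV - {i}. - (snd D $ j)) \<ge> 0" by (intro sum_nonneg) (simp add: np)
  ultimately have *: "snd D $ i = -1" "(\<Sum>j\<in>UNIV - {i}. - (snd D $ j)) = 0"
    using np[of i] i sum by linarith+
  from *(2) have "\<forall>j\<in>UNIV - {i}. - (snd D $ j) = 0"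
    by (subst (asm) sum_nonneg_eq_0_iff) (auto simp: np)
  with * have "D = exc i"
    using assms(3) by (auto simp: prod_eq_iff exc_def vec_eq_iff axis_def)
  then show ?thesis by (rule that)
qed

text \<open>Exchange argument: a subset of maximal sum cannot gain by swapping one of its elements
  for an outside one.\<close>

lemma exists_top_subset:
  fixes m :: "'n::finite \<Rightarrow> int"
  assumes "r \<le> CARD('n)"
  obtains I where "card I = r" "\<And>i j. i \<in> I \<Longrightarrow> j \<notin> I \<Longrightarrow> m j \<le> m i"
proof -
  let ?\<I> = "{I :: 'n set. card I = r}"
  have "?\<I> \<noteq> {}"
    using obtain_subset_with_card_n[OF assms] by auto
  have "Max (sum m ` ?\<I>) \<in> sum m ` ?\<I>"
    using \<open>?\<I> \<noteq> {}\<close> by (intro Max_in) auto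
  then obtain I where I: "card I = r" "sum m I = Max (sum m ` ?\<I>)" by auto
  have max: "sum m J \<le> sum m I" if "card J = r" for J
    unfolding I(2) using that by (intro Max_ge) auto
  have "m j \<le> m i" if "i \<in> I" "j \<notin> I" for i j
  proof -
    have "r > 0" using that I(1) by (auto simp: card_gt_0_iff)
    then have "card (insert j (I - {i})) = r"
      using that I(1) by (simp add: card_insert_if)
    from max[OF this] have "m j + sum m (I - {i}) \<le> sum m I"
      using that by simp
    moreover have "sum m I = m i + sum m (I - {i})"
      using that by (simp add: sum.remove)
    ultimately show ?thesis by simp
  qed
  with I(1) show ?thesis by (rule that)
qed

definition special_class :: "nat \<Rightarrow> 'n::finite divcls \<Rightarrow> bool" where
  "special_class d D \<longleftrightarrow> (d = 2 \<and> CARD('n) = 8 \<and> D = (3, \<chi> i. 1)) \<or> (d = 3 \<and> CARD('n) = 7 \<and> D = (2, \<chi> i. 1))"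

lemma all_one_of_sum:
  fixes m :: "'a \<Rightarrow> int"
  assumes "finite A" "sum m A = int (card A)" "(\<forall>i\<in>A. m i \<ge> 1) \<or> (\<forall>i\<in>A. m i \<le> 1)"
  shows "\<forall>i\<in>A. m i = 1"
proof -
  have 1: "(\<Sum>i\<in>A. m i - 1) = 0" "(\<Sum>i\<in>A. 1 - m i) = 0"
    using assms by (simp_all add: sum_subtractf)
  from assms(3) show ?thesis
  proof
    assume "\<forall>i\<in>A. m i \<ge> 1"
    then show ?thesis using 1(1) assms(1) by (subst (asm) sum_nonneg_eq_0_iff) auto
  next
    assume "\<forall>i\<in>A. m i \<le> 1"
    then show ?thesis using 1(2) assms(1) by (subst (asm) sum_nonneg_eq_0_iff) auto
  qed
qed

text \<open>Both special classes are -K/(d-1), and pairing with that is the anticanonical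
  degree.\<close>

lemma mukai_form_special: "special_class d D \<Longrightarrow> mukai_form d D G = int_deg d G"
  by (auto simp: special_class_def mukai_form_def int_deg_def)

text \<open>With r = k - d - 1, \<open>fin\<close> is the inequality 1/(d+1) + 1/r > 1/2 after
  clearing denominators. Adding (d-1)(d+1) to both sides gives \<open>card_bound\<close>.\<close>

locale finite_type =
  fixes d :: nat and N :: "'n::finite itself"
  assumes d: "d \<ge> 2" and k: "CARD('n) \<ge> d + 2"
    and fin: "(int d - 1) * (int CARD('n) - int d - 1) < 2 * (int d + 1)"
    and not_8_4: "(CARD('n), d) \<noteq> (8, 4)"
begin

lemma card_bound: "(int d - 1) * int CARD('n) < (int d + 1)\<^sup>2"
  using fin by (simp add: power2_eq_square algebra_simps)

text \<open>
  Let \<open>I\<close> collect the \<open>d + 1\<close> largest multiplicities and let \<open>M\<close> be the largest of the \<open>r\<close> remaining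
  ones. Reducedness gives \<open>(d + 1) M \<le> (d - 1) m\<^sub>0\<close>, and degree one gives \<open>2 m\<^sub>0 - 1 \<le> r M\<close>;
  for integers in finite type these are compatible only in the special cases.
\<close>

lemma reduced_class:
  fixes D :: "'n divcls"
  assumes deg: "int_deg d D = 1" and pos: "fst D > 0"
    and red: "\<And>I. card I = d + 1 \<Longrightarrow> (\<Sum>i\<in>I. snd D $ i) \<le> (int d - 1) * fst D"
  shows "special_class d D"
proof -
  obtain m0 m where D: "D = (m0, m)" by (cases D)
  have "d + 1 \<le> CARD('n)" using k by simp
  then obtain I where I: "card I = d + 1" "\<And>i j. i \<in> I \<Longrightarrow> j \<notin> I \<Longrightarrow> m $ j \<le> m $ i"
    using exists_top_subset[of "d + 1" "\<lambda>i. m $ i"] by blast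
  define r where "r = card (- I)"
  have r: "int CARD('n) = int r + int d + 1"
    using card_Un_disjoint[of I "- I"] I(1) by (simp add: r_def)
  have "- I \<noteq> {}" using r k by (auto simp: r_def)
  define M where "M = Max ((\<lambda>i. m $ i) ` (- I))"
  have M_ge: "m $ j \<le> M" if "j \<notin> I" for j
    unfolding M_def using that by (intro Max_ge) auto
  have M_le: "M \<le> m $ i" if "i \<in> I" for i
    unfolding M_def using that I(2) \<open>- I \<noteq> {}\<close> by (intro Max.boundedI) auto
  have total: "(\<Sum>i\<in>I. m $ i) + (\<Sum>i\<in>- I. m $ i) = (int d + 1) * m0 - 1"
    using deg sum.union_disjoint[of I "- I" "\<lambda>i. m $ i"] by (simp add: int_deg_def D)
  have SI: "(\<Sum>i\<in>I. m $ i) \<le> (int d - 1) * m0" using red[OF I(1)] by (simp add: D)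
  have "int (card I) * M \<le> (\<Sum>i\<in>I. m $ i)"
    using sum_bounded_below[of I M "\<lambda>i. m $ i"] M_le by simp
  then have MI: "(int d + 1) * M \<le> (\<Sum>i\<in>I. m $ i)" by (simp add: I(1) algebra_simps)
  have MR: "(\<Sum>i\<in>- I. m $ i) \<le> int r * M"
    using sum_bounded_above[of "- I" "\<lambda>i. m $ i" M] M_ge by (simp add: r_def)
  have 1: "(int d + 1) * M \<le> (int d - 1) * m0" using MI SI by simp
  have 2: "2 * m0 - 1 \<le> int r * M" using total SI MR by (simp add: algebra_simps)
  have m0: "m0 \<ge> 1" using pos by (simp add: D)
  then have rM: "int r * M \<ge> 1" using 2 by simp
  then have M: "M \<ge> 1" by (smt (verit) mult_nonneg_nonpos of_nat_0_le_iff)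
  have r_bound: "(int d - 1) * int r < 2 * (int d + 1)" using fin r by simp
  have d': "int d \<ge> 2" using d by simp
  \<comment> \<open>Six or more remaining points would give 6(d-1) < 2(d+1), hence d < 2.\<close>
  have "int r \<le> 5"
  proof (rule ccontr)
    assume "\<not> ?thesis"
    then have "(int d - 1) * 6 \<le> (int d - 1) * int r" using d' by (intro mult_left_mono) auto
    then show False using r_bound d' by simp
  qed
  then consider "r = 0" | "r = 1" | "r = 2" | "r = 3" | "r = 4" | "r = 5" by linarith
  then show ?thesis
  proof cases
    case 1 then show ?thesis using rM by simp
  next
    case 2
    then have "M \<ge> m0" using \<open>2 * m0 - 1 \<le> int r * M\<close> m0 by simp
    then have "(int d + 1) * m0 \<le> (int d + 1) * M" by (intro mult_left_mono) auto
    then have "(int d + 1) * m0 \<le> (int d - 1) * m0" using 1 by linarith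
    then show ?thesis using m0 by (simp add: algebra_simps)
  next
    case 3
    \<comment> \<open>Integrality matters: 2 m_0 - 1 \<le> 2 M already forces m_0 \<le> M, which
      contradicts (d+1) M \<le> (d-1) m_0.\<close>
    then have "M \<ge> m0" using \<open>2 * m0 - 1 \<le> int r * M\<close> m0 by simp
    then have "(int d + 1) * m0 \<le> (int d + 1) * M" by (intro mult_left_mono) auto
    then have "(int d + 1) * m0 \<le> (int d - 1) * m0" using 1 by linarith
    then show ?thesis using m0 by (simp add: algebra_simps)
  next
    case 4
    then have "d < 5" using r_bound by simp
    then consider "d = 2" | "d = 3" | "d = 4" using d by linarith
    then show ?thesis
    proof cases
      assume "d = 2"
      then show ?thesis using 1 2 4 M by simp
    next
      assume d3: "d = 3"
      \<comment> \<open>For d = r = 3 the bounds are 2 M \<le> m_0 and 2 m_0 - 1 \<le> 3 M. They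
        leave M = 1 and m_0 = 2, where all estimates are equalities, so every multiplicity is
        one.\<close>
      then have "M = 1" using 1 2 4 M by simp
      then have "m0 = 2" using 1 2 4 d3 by simp
      have SI4: "(\<Sum>i\<in>I. m $ i) = int (card I)" using SI MI d3 \<open>M = 1\<close> \<open>m0 = 2\<close> I(1) by simp
      then have "\<forall>i\<in>I. m $ i = 1"
        using M_le \<open>M = 1\<close> by (intro all_one_of_sum) auto
      moreover have "(\<Sum>i\<in>- I. m $ i) = int (card (- I))"
        using total SI4 d3 \<open>m0 = 2\<close> I(1) 4 by (simp add: r_def)
      then have "\<forall>i\<in>- I. m $ i = 1"
        using M_ge \<open>M = 1\<close> by (intro all_one_of_sum) auto
      ultimately have "m = (\<chi> i. 1)" by (auto simp: vec_eq_iff)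
      then show ?thesis using d3 \<open>m0 = 2\<close> r 4 by (simp add: special_class_def D)
    next
      \<comment> \<open>Here k = 8, the excluded pair. The conclusion fails for it: -K has m_0 = 5
        and all multiplicities 3, and is reduced of degree one.\<close>
      assume "d = 4"
      then show ?thesis using r 4 not_8_4 by simp
    qed
  next
    case 5
    then have "d = 2" using r_bound d by simp
    then show ?thesis using 1 2 5 M by simp
  next
    case 6
    then have d2: "d = 2" using r_bound d by simp
    \<comment> \<open>The same rigidity, now from 3 M \<le> m_0 and 2 m_0 - 1 \<le> 5 M.\<close>
    then have "M = 1" using 1 2 6 M by simp
    then have "m0 = 3" using 1 2 6 d2 by simp
    have SI3: "(\<Sum>i\<in>I. m $ i) = int (card I)" using SI MI d2 \<open>M = 1\<close> \<open>m0 = 3\<close> I(1) by simp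
    then have "\<forall>i\<in>I. m $ i = 1"
      using M_le \<open>M = 1\<close> by (intro all_one_of_sum) auto
    moreover have "(\<Sum>i\<in>- I. m $ i) = int (card (- I))"
      using total SI3 d2 \<open>m0 = 3\<close> I(1) 6 by (simp add: r_def)
    then have "\<forall>i\<in>- I. m $ i = 1"
      using M_ge \<open>M = 1\<close> by (intro all_one_of_sum) auto
    ultimately have "m = (\<chi> i. 1)" by (auto simp: vec_eq_iff)
    then show ?thesis using d2 \<open>m0 = 3\<close> r 6 by (simp add: special_class_def D)
  qed
qed

text \<open>Instead of a path in the Weyl group, the conclusion records two quantities that
  \<open>cremona\<close> preserves. They are known for the E_i and are carried back along each step
  of the descent.\<close>

lemma eff_deg_one_cases:
  fixes D :: "'n divcls"
  assumes "D \<in> eff_deg_one d"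
  shows "special_class d D \<or> (mukai_form d D D = -1 \<and> h0 d D = 1)"
  using assms
proof (induction "nat (fst D)" arbitrary: D rule: less_induct)
  case less
  show ?case
  proof (cases "fst D = 0")
    case True
    then obtain i where "D = exc i" using eff_deg_one_fst_zero[OF d less.prems] by blast
    then show ?thesis by (simp add: mukai_form_exc h0_exc)
  next
    case False
    then have pos: "fst D > 0" using eff_deg_one_fst_nonneg[OF less.prems] by simp
    have deg: "int_deg d D = 1" using less.prems d by (simp add: eff_deg_one_iff)
    show ?thesis
    proof (cases "\<exists>I. card I = d + 1 \<and> (\<Sum>i\<in>I. snd D $ i) > (int d - 1) * fst D")
      case True
      then obtain I where I: "card I = d + 1" "(\<Sum>i\<in>I. snd D $ i) > (int d - 1) * fst D" by blast
      let ?D = "cremona d I D"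
      have eff: "?D \<in> eff_deg_one d"
        using less.prems d by (simp add: eff_deg_one_iff h0_cremona int_deg_cremona I(1))
      have "fst ?D < fst D" using I(2) by (simp add: fst_cremona algebra_simps)
      then have "nat (fst ?D) < nat (fst D)" using pos by simp
      from less.hyps[OF this eff] show ?thesis
      proof
        \<comment> \<open>A proper descent cannot end in a special class: being a rational multiple
          of K, it is orthogonal to the root and fixed by the transformation, so the degree would
          not have dropped.\<close>
        assume s: "special_class d ?D"
        have "(\<Sum>i\<in>I. snd ?D $ i) = (int d - 1) * fst ?D"
          using s I(1) by (auto simp: special_class_def)
        then have "fst (cremona d I ?D) = fst ?D"
          by (simp add: fst_cremona[of d I ?D] algebra_simps)
        then show ?thesis using \<open>fst ?D < fst D\<close> by (simp add: cremona_involution I(1))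
      next
        assume "mukai_form d ?D ?D = -1 \<and> h0 d ?D = 1"
        then show ?thesis by (simp add: mukai_form_cremona h0_cremona I(1))
      qed
    next
      case False
      then show ?thesis using reduced_class[OF deg pos] by (force simp: not_less)
    qed
  qed
qed

text \<open>For two classes of self-product -1 the negativity reads -2 - 2(D, G) < 0, and
  integrality improves (D, G) > -1 to (D, G) \<ge> 0. A special \<open>G\<close> gives the value
  1.\<close>

lemma mukai_form_nonneg:
  fixes D G :: "'n divcls"
  assumes "D \<in> eff_deg_one d" "mukai_form d D D = -1" "G \<in> eff_deg_one d" "D \<noteq> G"
  shows "mukai_form d D G \<ge> 0"
  using eff_deg_one_cases[OF assms(3)]
proof
  assume "special_class d G"
  then have "mukai_form d G D = int_deg d D" by (rule mukai_form_special)
  moreover have "mukai_form d G D = mukai_form d D G"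
    by (simp add: mukai_form_def mult_ac)
  ultimately show ?thesis using assms d by (simp add: eff_deg_one_iff)
next
  assume "mukai_form d G G = -1 \<and> h0 d G = 1"
  moreover have "mukai_form d (D - G) (D - G) < 0"
    using assms d by (intro mukai_form_neg[OF card_bound]) (auto simp: int_deg_diff eff_deg_one_iff)
  ultimately show ?thesis using assms(2) by (simp add: mukai_form_diff)
qed

lemma finite_eff_deg_one: "finite (eff_deg_one d :: 'n divcls set)"
proof -
  \<comment> \<open>Cauchy-Schwarz gives a quadratic inequality for m_0 with leading coefficient
    (d+1)^2 - (d-1)k, a positive integer and hence at least 1; \<open>B\<close> exceeds its
    solutions. \<open>C\<close> then bounds the sum of squares and with it each
    multiplicity.\<close>
  define B where "B = 2 * (int d + 1) + int CARD('n)"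
  define C where "C = (int d - 1) * B\<^sup>2 + 1"
  let ?V = "{m :: int ^ 'n. \<forall>i. m $ i \<in> {-C..C}}"
  have "finite (vec_nth ` ?V)"
  proof (rule finite_subset)
    show "vec_nth ` ?V \<subseteq> Pi\<^sub>E UNIV (\<lambda>_. {-C..C})" by auto
  qed (intro finite_PiE; simp)
  moreover have "inj_on vec_nth ?V" by (auto intro!: inj_onI simp: vec_eq_iff)
  ultimately have "finite ?V" by (rule finite_imageD)
  then have "finite ({-B..B} \<times> ?V)" by simp
  moreover have "eff_deg_one d \<subseteq> {-B..B} \<times> ?V"
  proof
    fix D :: "'n divcls" assume D: "D \<in> eff_deg_one d"
    let ?S = "\<Sum>i\<in>UNIV. (snd D $ i)\<^sup>2"
    have deg: "int_deg d D = 1" using D d by (simp add: eff_deg_one_iff)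
    have "mukai_form d D D \<ge> -1"
      using eff_deg_one_cases[OF D] mukai_form_special[of d D D] deg by auto
    then have S: "?S \<le> (int d - 1) * (fst D)\<^sup>2 + 1"
      by (simp add: mukai_form_def power2_eq_square mult.assoc)
    have "((int d + 1) * fst D - 1)\<^sup>2 = (\<Sum>i\<in>UNIV. snd D $ i)\<^sup>2"
      using deg by (simp add: int_deg_def algebra_simps)
    also have "\<dots> \<le> int CARD('n) * ?S"
      by (rule sum_int_squared_le)
    also have "\<dots> \<le> int CARD('n) * ((int d - 1) * (fst D)\<^sup>2 + 1)"
      by (intro mult_left_mono S) auto
    finally have *: "((int d + 1)\<^sup>2 - (int d - 1) * int CARD('n)) * (fst D)\<^sup>2 \<le>
        2 * (int d + 1) * fst D + int CARD('n)"
      by (simp add: power2_eq_square algebra_simps)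
    have nn: "fst D \<ge> 0" by (rule eff_deg_one_fst_nonneg[OF D])
    have "1 * (fst D)\<^sup>2 \<le> ((int d + 1)\<^sup>2 - (int d - 1) * int CARD('n)) * (fst D)\<^sup>2"
      using card_bound by (intro mult_right_mono) auto
    with * have **: "fst D * fst D \<le> 2 * (int d + 1) * fst D + int CARD('n)"
      by (simp add: power2_eq_square)
    have "fst D \<le> B"
    proof (rule ccontr)
      assume "\<not> ?thesis"
      then have big: "fst D > B" by simp
      then have "B * fst D \<le> fst D * fst D" using nn by (intro mult_right_mono) auto
      then have "int CARD('n) * fst D \<le> int CARD('n)"
      proof -
        have "B * fst D = 2 * (int d + 1) * fst D + int CARD('n) * fst D"
          by (simp add: B_def algebra_simps)
        then show ?thesis using ** \<open>B * fst D \<le> fst D * fst D\<close> by linarith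
      qed
      moreover have "int CARD('n) * 1 < int CARD('n) * fst D"
        using big by (intro mult_strict_left_mono) (auto simp: B_def)
      ultimately show False by simp
    qed
    have "(fst D)\<^sup>2 \<le> B\<^sup>2" using nn \<open>fst D \<le> B\<close> by (intro power_mono)
    then have "(int d - 1) * (fst D)\<^sup>2 \<le> (int d - 1) * B\<^sup>2" using d by (intro mult_left_mono) auto
    then have SC: "?S \<le> C" using S by (simp add: C_def)
    have "\<bar>snd D $ i\<bar> \<le> C" for i
    proof -
      have "\<bar>x\<bar> \<le> x\<^sup>2" for x :: int
      proof (cases "x = 0")
        case False
        then have "1 \<le> \<bar>x\<bar>" by linarith
        then have "1 * \<bar>x\<bar> \<le> \<bar>x\<bar> * \<bar>x\<bar>" by (intro mult_right_mono) auto
        then show ?thesis by (simp add: power2_eq_square)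
      qed simp
      then have "\<bar>snd D $ i\<bar> \<le> (snd D $ i)\<^sup>2" .
      also have "\<dots> \<le> ?S" by (intro member_le_sum) auto
      finally show ?thesis using SC by simp
    qed
    then have "- C \<le> snd D $ i \<and> snd D $ i \<le> C" for i
      using abs_le_iff[of "snd D $ i" C] by (simp add: minus_le_iff)
    then show "D \<in> {-B..B} \<times> ?V"
      using nn \<open>fst D \<le> B\<close> by (cases D) (auto simp: B_def)
  qed
  ultimately show ?thesis by (rule rev_finite_subset)
qed

text \<open>Only the last edge of a path matters: a special class has product one with its
  neighbour, never zero.\<close>

lemma mukai_edge_graph_vertex:
  fixes D :: "'n divcls"
  assumes "D \<in> fst (mukai_edge_graph d a)"
  shows "D \<in> eff_deg_one d \<and> mukai_form d D D = -1 \<and> h0 d D = 1"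
proof -
  have "(mukai_adj d)\<^sup>*\<^sup>* (exc a) D" using assms by (simp add: mukai_edge_graph_def Let_def)
  then show ?thesis
  proof (cases rule: rtranclp.cases)
    case rtrancl_refl
    then show ?thesis using d by (simp add: exc_mem_eff_deg_one mukai_form_exc h0_exc)
  next
    case (rtrancl_into_rtrancl D')
    then have *: "D \<in> eff_deg_one d" "D' \<in> eff_deg_one d" "mukai_form d D' D = 0"
      by (auto simp: mukai_adj_def)
    have "mukai_form d D D' = mukai_form d D' D" by (simp add: mukai_form_def mult_ac)
    then have "\<not> special_class d D"
      using mukai_form_special[of d D D'] * d by (auto simp: eff_deg_one_iff)
    then show ?thesis using eff_deg_one_cases[OF *(1)] *(1) by blast
  qed
qed

end

subsection \<open>Initial forms\<close>

lemma value0_unique: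
  assumes "value0 c v" "value0 c w"
  shows "v = w"
proof -
  obtain p q p' q' where *: "poly q 0 \<noteq> 0" "poly q' 0 \<noteq> 0" "c = Fract p q" "c = Fract p' q'"
    "v = poly p 0 / poly q 0" "w = poly p' 0 / poly q' 0"
    using assms unfolding value0_def by blast
  then have "q \<noteq> 0" "q' \<noteq> 0" by auto
  with * have "p * q' = p' * q" by (simp add: eq_fract)
  then have "poly p 0 * poly q' 0 = poly p' 0 * poly q 0" by (metis poly_mult)
  then show ?thesis unfolding *(5,6) using *(1,2) by (simp add: frac_eq_eq)
qed

lemma value0_Fract: "poly q 0 \<noteq> 0 \<Longrightarrow> value0 (Fract p q) (poly p 0 / poly q 0)"
  by (auto simp: value0_def)

lemma value0_0: "value0 0 0"
  using value0_Fract[of 1 0] by (simp add: Zero_fract_def)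

lemma value0_1: "value0 1 1"
  using value0_Fract[of 1 1] by (simp add: One_fract_def)

lemma value0_tt: "value0 tt 0"
  using value0_Fract[of 1 "[:0, 1:]"] by (simp add: tt_def)

lemma value0_mult:
  assumes "value0 c v" "value0 c' v'"
  shows "value0 (c * c') (v * v')"
proof -
  obtain p q p' q' where *: "poly q 0 \<noteq> 0" "poly q' 0 \<noteq> 0" "c = Fract p q" "c' = Fract p' q'"
    "v = poly p 0 / poly q 0" "v' = poly p' 0 / poly q' 0"
    using assms by (auto simp: value0_def)
  then show ?thesis using value0_Fract[of "q * q'" "p * p'"] by simp
qed

lemma value0_tt_power: "value0 (tt ^ n) (0 ^ n)"
proof (induction n)
  case (Suc n)
  then show ?case using value0_mult[OF value0_tt Suc.IH] by simp
qed (simp add: value0_1)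

lemma tt_nonzero: "tt \<noteq> 0"
  by (simp add: tt_def Zero_fract_def eq_fract)

lemma tt_power: "tt ^ n = Fract ([:0, 1:] ^ n) 1"
  by (induction n) (simp_all add: tt_def One_fract_def)

lemma tt_powi_add: "tt powi (int k + m) = tt ^ k * tt powi m"
  by (simp add: power_int_add tt_nonzero)

text \<open>Splitting the powers of t off numerator and denominator leaves a unit at t = 0; the
  order is the difference of the two exponents.\<close>

lemma exists_valuation:
  assumes "c \<noteq> 0"
  shows "\<exists>n v. v \<noteq> 0 \<and> value0 (tt powi (- n) * c) v"
proof -
  obtain p q where c: "c = Fract p q" "q \<noteq> 0" "p \<noteq> 0"
    using assms by (cases c rule: Fract_cases_nonzero) auto
  have *: "\<exists>a p'. p = [:0, 1:] ^ a * p' \<and> poly p' 0 \<noteq> 0" if "p \<noteq> 0" for p :: "complex poly"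
    using order_decomp[OF that, of 0] by (auto simp: poly_eq_0_iff_dvd)
  obtain a p' where p': "p = [:0, 1:] ^ a * p'" "poly p' 0 \<noteq> 0" using *[OF c(3)] by blast
  obtain b q' where q': "q = [:0, 1:] ^ b * q'" "poly q' 0 \<noteq> 0" using *[OF c(2)] by blast
  have "tt ^ b * c = tt ^ a * Fract p' q'"
  proof -
    have "q' \<noteq> 0" using q'(2) by auto
    then show ?thesis
      unfolding c(1) tt_power mult_fract using c(2) p'(1) q'(1)
      by (subst eq_fract) (simp_all add: mult_ac)
  qed
  then have "Fract p' q' = tt powi (int b) * c * inverse (tt powi (int a))"
    using tt_nonzero by (simp add: field_simps)
  also have "\<dots> = tt powi (int b - int a) * c"
    using tt_nonzero by (subst power_int_diff) (simp_all add: divide_inverse mult_ac)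
  finally have "tt powi (int b - int a) * c = Fract p' q'" ..
  then have "value0 (tt powi (- (int a - int b)) * c) (poly p' 0 / poly q' 0)"
    using value0_Fract[OF q'(2)] by simp
  moreover have "poly p' 0 / poly q' 0 \<noteq> 0" using p' q' by simp
  ultimately show ?thesis by blast
qed

lemma lookup_mp_scale: "Poly_Mapping.lookup (mp_scale c f) \<alpha> = c * Poly_Mapping.lookup f \<alpha>"
proof -
  have "mp_scale c f = (\<Sum>\<beta>\<in>Poly_Mapping.keys f. Poly_Mapping.single \<beta> (c * Poly_Mapping.lookup f \<beta>))"
    using arg_cong[OF poly_mapping_sum_single[of f, symmetric], of "mp_scale c"]
    by (simp only: mp_scale_sum mp_scale_single)
  then show ?thesis
    by (cases "\<alpha> \<in> Poly_Mapping.keys f") (auto simp: lookup_sum lookup_single when_def in_keys_iff)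
qed

lemma specializes_unique: "specializes f g \<Longrightarrow> specializes f g' \<Longrightarrow> g = g'"
  by (auto simp: specializes_def intro!: poly_mapping_eqI value0_unique)

lemma specializes_keys:
  assumes "specializes f g"
  shows "Poly_Mapping.keys g \<subseteq> Poly_Mapping.keys f"
proof
  fix \<alpha> assume \<alpha>: "\<alpha> \<in> Poly_Mapping.keys g"
  have "value0 (Poly_Mapping.lookup f \<alpha>) (Poly_Mapping.lookup g \<alpha>)"
    using assms by (simp add: specializes_def)
  then show "\<alpha> \<in> Poly_Mapping.keys f"
    using \<alpha> value0_unique[OF value0_0, of "Poly_Mapping.lookup g \<alpha>"] by (auto simp: in_keys_iff)
qed

text \<open>The order is the least valuation among the finitely many coefficients. Together with
  uniqueness this gives meaning to \<open>THE\<close> in \<open>ord0\<close> and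
  \<open>init0\<close>.\<close>

lemma exists_specialization:
  fixes f :: "'e::comm_monoid_add \<Rightarrow>\<^sub>0 ratfun"
  assumes "f \<noteq> 0"
  shows "\<exists>n g. g \<noteq> 0 \<and> specializes (mp_scale (tt powi (- n)) f) g"
proof -
  let ?K = "Poly_Mapping.keys f"
  have "\<forall>\<alpha>\<in>?K. \<exists>n v. v \<noteq> 0 \<and> value0 (tt powi (- n) * Poly_Mapping.lookup f \<alpha>) v"
    by (auto simp: in_keys_iff intro: exists_valuation)
  then obtain \<nu> v where \<nu>: "\<And>\<alpha>. \<alpha> \<in> ?K \<Longrightarrow> v \<alpha> \<noteq> 0"
    "\<And>\<alpha>. \<alpha> \<in> ?K \<Longrightarrow> value0 (tt powi (- \<nu> \<alpha>) * Poly_Mapping.lookup f \<alpha>) (v \<alpha>)"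
    by metis
  define n where "n = Min (\<nu> ` ?K)"
  have "?K \<noteq> {}"
  proof
    assume "?K = {}"
    then have "f = 0" by (intro poly_mapping_eqI) (metis empty_iff in_keys_iff lookup_zero)
    with assms show False by simp
  qed
  then have "n \<in> \<nu> ` ?K" unfolding n_def by (intro Min_in) auto
  then obtain \<alpha>0 where \<alpha>0: "\<alpha>0 \<in> ?K" "\<nu> \<alpha>0 = n" by auto
  have le: "n \<le> \<nu> \<alpha>" if "\<alpha> \<in> ?K" for \<alpha> unfolding n_def using that by (intro Min_le) auto
  \<comment> \<open>The power of 0 is 1 where the minimum is attained, as \<open>0 ^ 0 = 1\<close>,
    and 0 elsewhere: only coefficients of least order survive.\<close>
  define g where "g = (\<Sum>\<alpha>\<in>?K. Poly_Mapping.single \<alpha> (0 ^ nat (\<nu> \<alpha> - n) * v \<alpha>))"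
  have g: "Poly_Mapping.lookup g \<alpha> = (if \<alpha> \<in> ?K then 0 ^ nat (\<nu> \<alpha> - n) * v \<alpha> else 0)" for \<alpha>
    by (simp add: g_def lookup_sum lookup_single when_def)
  have "Poly_Mapping.lookup g \<alpha>0 \<noteq> 0" using \<alpha>0 \<nu>(1) by (simp add: g)
  then have "g \<noteq> 0" by auto
  moreover have "specializes (mp_scale (tt powi (- n)) f) g"
    unfolding specializes_def
  proof
    fix \<alpha>
    show "value0 (Poly_Mapping.lookup (mp_scale (tt powi (- n)) f) \<alpha>) (Poly_Mapping.lookup g \<alpha>)"
    proof (cases "\<alpha> \<in> ?K")
      case True
      have "tt powi (- n) = tt powi (int (nat (\<nu> \<alpha> - n)) + (- \<nu> \<alpha>))"
        using le[OF True] by (intro arg_cong2[where f = power_int]) auto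
      also have "\<dots> = tt ^ nat (\<nu> \<alpha> - n) * tt powi (- \<nu> \<alpha>)"
        by (rule tt_powi_add)
      finally have "Poly_Mapping.lookup (mp_scale (tt powi (- n)) f) \<alpha> =
          tt ^ nat (\<nu> \<alpha> - n) * (tt powi (- \<nu> \<alpha>) * Poly_Mapping.lookup f \<alpha>)"
        by (simp add: lookup_mp_scale mult.assoc)
      then show ?thesis using True by (simp only: g) (simp add: value0_mult value0_tt_power \<nu>(2))
    next
      case False
      then show ?thesis by (simp add: lookup_mp_scale g in_keys_iff value0_0)
    qed
  qed
  ultimately show ?thesis by blast
qed

text \<open>If n < n', scaling by the smaller order leaves a positive power of t as a factor, so the
  specialization \<open>g\<close> would be zero.\<close>

lemma specialization_order_le:
  assumes g: "g \<noteq> 0" "specializes (mp_scale (tt powi (- n)) f) g"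
    and g': "specializes (mp_scale (tt powi (- n')) f) g'"
  shows "n' \<le> n"
proof (rule ccontr)
  assume "\<not> ?thesis"
  then have less: "n < n'" by simp
  have "Poly_Mapping.lookup g \<alpha> = 0" for \<alpha>
  proof -
    have "tt powi (- n) = tt powi (int (nat (n' - n)) + (- n'))"
      using less by (intro arg_cong2[where f = power_int]) auto
    also have "\<dots> = tt ^ nat (n' - n) * tt powi (- n')"
      by (rule tt_powi_add)
    finally have "Poly_Mapping.lookup (mp_scale (tt powi (- n)) f) \<alpha> =
        tt ^ nat (n' - n) * Poly_Mapping.lookup (mp_scale (tt powi (- n')) f) \<alpha>"
      by (simp add: lookup_mp_scale mult.assoc)
    then have "value0 (Poly_Mapping.lookup (mp_scale (tt powi (- n)) f) \<alpha>)
        (0 ^ nat (n' - n) * Poly_Mapping.lookup g' \<alpha>)"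
      using g' by (simp add: specializes_def value0_mult value0_tt_power)
    moreover have "value0 (Poly_Mapping.lookup (mp_scale (tt powi (- n)) f) \<alpha>) (Poly_Mapping.lookup g \<alpha>)"
      using g(2) by (simp add: specializes_def)
    ultimately have "Poly_Mapping.lookup g \<alpha> = 0 ^ nat (n' - n) * Poly_Mapping.lookup g' \<alpha>"
      using value0_unique by blast
    then show ?thesis using less by simp
  qed
  then have "g = 0" by (intro poly_mapping_eqI) simp
  with g(1) show False ..
qed

text \<open>Specialization can only shrink the support, so every grading for which \<open>f\<close>
  is homogeneous passes to its initial form.\<close>

lemma keys_init0:
  assumes "f \<noteq> 0"
  shows "Poly_Mapping.keys (init0 f) \<subseteq> Poly_Mapping.keys f"
proof -
  obtain n g where g: "g \<noteq> 0" "specializes (mp_scale (tt powi (- n)) f) g"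
    using exists_specialization[OF assms] by blast
  have "ord0 f = n"
    unfolding ord0_def
    by (rule the_equality) (use g in \<open>auto intro: antisym specialization_order_le\<close>)
  then have "init0 f = g"
    unfolding init0_def using g specializes_unique by (intro the_equality) auto
  then show ?thesis
    using specializes_keys[OF g(2)] by (auto simp: in_keys_iff lookup_mp_scale)
qed

lemma exponent_mem_keys:
  assumes "f \<noteq> 0" "is_monomial (init0 f)"
  shows "exponent (init0 f) \<in> Poly_Mapping.keys f"
proof -
  obtain \<alpha> c where c: "c \<noteq> 0" "init0 f = Poly_Mapping.single \<alpha> c"
    using assms(2) by (auto simp: is_monomial_def)
  have "exponent (init0 f) = \<alpha>"
    unfolding exponent_def
  proof (rule the_equality)
    fix \<beta> assume "\<exists>b. b \<noteq> 0 \<and> init0 f = Poly_Mapping.single \<beta> b"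
    then obtain b where "b \<noteq> 0" "Poly_Mapping.single \<alpha> c = Poly_Mapping.single \<beta> b" using c by auto
    then have "Poly_Mapping.keys (Poly_Mapping.single \<alpha> c) = Poly_Mapping.keys (Poly_Mapping.single \<beta> b)" by simp
    then show "\<beta> = \<alpha>" using c(1) \<open>b \<noteq> 0\<close> by simp
  qed (use c in auto)
  moreover have "\<alpha> \<in> Poly_Mapping.keys (init0 f)" using c by simp
  ultimately show ?thesis using keys_init0[OF assms(1)] by auto
qed

subsection \<open>The multigrading of the parametrization\<close>

definition homog :: "('e \<Rightarrow> int) \<Rightarrow> int \<Rightarrow> ('e \<Rightarrow>\<^sub>0 'c::zero) \<Rightarrow> bool" where
  "homog L n f \<longleftrightarrow> (\<forall>\<alpha>\<in>Poly_Mapping.keys f. L \<alpha> = n)"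

locale grading =
  fixes L :: "'e::comm_monoid_add \<Rightarrow> int"
  assumes L_0: "L 0 = 0" and L_add: "L (\<alpha> + \<beta>) = L \<alpha> + L \<beta>"
begin

lemma homog_add: "homog L n f \<Longrightarrow> homog L n g \<Longrightarrow> homog L n (f + g)"
  using Poly_Mapping.keys_add[of f g] by (auto simp: homog_def)

lemma homog_sum: "(\<And>x. x \<in> A \<Longrightarrow> homog L n (f x)) \<Longrightarrow> homog L n (sum f A)"
proof (induction A rule: infinite_finite_induct)
  case (insert x A)
  then show ?case by (simp add: homog_add)
qed (simp_all add: homog_def)

lemma homog_mult:
  assumes "homog L m f" "homog L n g"
  shows "homog L (m + n) (f * g)"
  unfolding homog_def
proof
  fix \<alpha> assume "\<alpha> \<in> Poly_Mapping.keys (f * g)"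
  then obtain \<beta> \<gamma> where "\<alpha> = \<beta> + \<gamma>" "\<beta> \<in> Poly_Mapping.keys f" "\<gamma> \<in> Poly_Mapping.keys g"
    using keys_mult[of f g] by auto
  then show "L \<alpha> = m + n" using assms by (simp add: homog_def L_add)
qed

lemma homog_const: "homog L 0 (const c)"
  by (auto simp: homog_def const_def L_0 split: if_splits)

lemma homog_monom_of: "homog L (L \<alpha>) (monom_of \<alpha>)"
  by (auto simp: homog_def monom_of_def split: if_splits)

lemma homog_power:
  fixes f :: "'e \<Rightarrow>\<^sub>0 'c::comm_ring_1"
  shows "homog L n f \<Longrightarrow> homog L (int k * n) (f ^ k)"
proof (induction k)
  case 0
  then show ?case using homog_const[of "1::'c"] by (simp add: const_hom.hom_1)
next
  case (Suc k)
  then show ?case using homog_mult[of n f "int k * n" "f ^ k"] by (simp add: algebra_simps)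
qed

lemma homog_prod:
  fixes f :: "'b \<Rightarrow> ('e \<Rightarrow>\<^sub>0 'c::comm_ring_1)"
  shows "(\<And>x. x \<in> A \<Longrightarrow> homog L (n x) (f x)) \<Longrightarrow> homog L (sum n A) (prod f A)"
proof (induction A rule: infinite_finite_induct)
  case (insert x A)
  then show ?case by (simp add: homog_mult)
qed (use homog_const[of "1::'c"] in \<open>simp_all add: const_hom.hom_1\<close>)

lemma homog_subst_pol:
  fixes k :: "nat \<Rightarrow> ('e \<Rightarrow>\<^sub>0 'c::comm_ring_1)"
  assumes f: "form d n f" and k: "\<And>l. homog L w (k l)"
  shows "homog L (n * w) (subst_pol const k f)"
  unfolding subst_pol_def
proof (rule homog_sum)
  fix \<alpha> assume \<alpha>: "\<alpha> \<in> Poly_Mapping.keys f"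
  have "homog L (0 + (\<Sum>v\<in>Poly_Mapping.keys \<alpha>. int (Poly_Mapping.lookup \<alpha> v) * w))
     (const (Poly_Mapping.lookup f \<alpha>) * (\<Prod>v\<in>Poly_Mapping.keys \<alpha>. k v ^ Poly_Mapping.lookup \<alpha> v))"
    by (intro homog_mult homog_const homog_prod homog_power k)
  moreover have "(\<Sum>v\<in>Poly_Mapping.keys \<alpha>. int (Poly_Mapping.lookup \<alpha> v) * w) = n * w"
    using f \<alpha> by (auto simp: form_def tdeg_def sum_distrib_right)
  ultimately show "homog L (n * w) (const (Poly_Mapping.lookup f \<alpha>) *
      (\<Prod>v\<in>Poly_Mapping.keys \<alpha>. k v ^ Poly_Mapping.lookup \<alpha> v))"
    by simp
qed

end

definition y_degree :: "('n::finite xy \<Rightarrow>\<^sub>0 int) \<Rightarrow> int" where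
  "y_degree \<alpha> = (\<Sum>i\<in>UNIV. Poly_Mapping.lookup \<alpha> (YV i))"

definition xy_degree :: "'n::finite \<Rightarrow> ('n xy \<Rightarrow>\<^sub>0 int) \<Rightarrow> int" where
  "xy_degree i \<alpha> = Poly_Mapping.lookup \<alpha> (XV i) + Poly_Mapping.lookup \<alpha> (YV i)"

interpretation y_grading: grading y_degree
  by unfold_locales (simp_all add: y_degree_def lookup_add sum.distrib)

interpretation xy_grading: grading "xy_degree i" for i
  by unfold_locales (simp_all add: xy_degree_def lookup_add)

text \<open>The quotient y_i/x_i has degree one in y and degree zero in every pair, so the form
  contributes m_0 to the y-degree alone; the monomial factor contributes m_0 - m_i in the i-th pair.
  These are the entries of [n_0, ..., n_k].\<close>

lemma phi_var_homog:
  assumes "v \<in> gvars d" and F: "\<And>D j. VD D j \<in> gvars d \<Longrightarrow> form d (fst D) (F D j)"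
  shows "homog y_degree (fst (multideg v)) (phi_var P F v)"
    and "homog (xy_degree i) (fst (multideg v) - snd (multideg v) $ i) (phi_var P F v)"
proof -
  have single_X: "y_degree (Poly_Mapping.single (XV j) n) = 0"
    "xy_degree i (Poly_Mapping.single (XV j) n) = (if j = i then n else 0)" for j n
    by (auto simp: y_degree_def xy_degree_def lookup_single when_def)
  have quot: "y_degree (Poly_Mapping.single (YV j) 1 - Poly_Mapping.single (XV j) 1) = 1"
    "xy_degree i (Poly_Mapping.single (YV j) 1 - Poly_Mapping.single (XV j) 1) = 0" for j
    by (auto simp: y_degree_def xy_degree_def lookup_single lookup_minus when_def)
  have shift: "y_degree (\<Sum>j\<in>UNIV. Poly_Mapping.single (XV j) (n j)) = 0"
    "xy_degree i (\<Sum>j\<in>UNIV. Poly_Mapping.single (XV j) (n j)) = n i" for n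
    by (auto simp: y_degree_def xy_degree_def lookup_sum lookup_single when_def)
  have "homog y_degree (fst (multideg v)) (phi_var P F v) \<and>
    homog (xy_degree i) (fst (multideg v) - snd (multideg v) $ i) (phi_var P F v)"
  proof (cases v)
    case (VE j)
    then show ?thesis
      using y_grading.homog_monom_of[of "Poly_Mapping.single (XV j) 1"]
        xy_grading.homog_monom_of[of i "Poly_Mapping.single (XV j) 1"]
      by (auto simp: exc_def single_X axis_def eq_commute)
  next
    case (VD D j)
    then have form: "form d (fst D) (F D j)" using assms by simp
    let ?k = "\<lambda>l. \<Sum>i\<in>UNIV. const (P i l) *
         monom_of (Poly_Mapping.single (YV i) 1 - Poly_Mapping.single (XV i) 1)"
    let ?m = "\<Sum>i\<in>UNIV. Poly_Mapping.single (XV i) (fst D - snd D $ i)"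
    have k1: "homog y_degree 1 (?k l)" for l
    proof (rule y_grading.homog_sum)
      fix j
      show "homog y_degree 1 (const (P j l) * monom_of (Poly_Mapping.single (YV j) 1 - Poly_Mapping.single (XV j) 1))"
        using y_grading.homog_mult[OF y_grading.homog_const[of "P j l"]
            y_grading.homog_monom_of[of "Poly_Mapping.single (YV j) 1 - Poly_Mapping.single (XV j) 1"]]
        by (simp add: quot)
    qed
    have k0: "homog (xy_degree i) 0 (?k l)" for l
    proof (rule xy_grading.homog_sum)
      fix j
      show "homog (xy_degree i) 0 (const (P j l) * monom_of (Poly_Mapping.single (YV j) 1 - Poly_Mapping.single (XV j) 1))"
        using xy_grading.homog_mult[OF xy_grading.homog_const[of i "P j l"]
            xy_grading.homog_monom_of[of i "Poly_Mapping.single (YV j) 1 - Poly_Mapping.single (XV j) 1"]]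
        by (simp add: quot)
    qed
    show ?thesis
      using y_grading.homog_mult[OF y_grading.homog_subst_pol[OF form k1] y_grading.homog_monom_of[of ?m]]
        xy_grading.homog_mult[OF xy_grading.homog_subst_pol[OF form k0] xy_grading.homog_monom_of[of i ?m]]
      by (simp add: VD shift)
  qed
  then show "homog y_degree (fst (multideg v)) (phi_var P F v)"
    "homog (xy_degree i) (fst (multideg v) - snd (multideg v) $ i) (phi_var P F v)" by auto
qed

lemma init_point_degree:
  assumes KD: "KD_data d P F" and v: "v \<in> gvars d"
  shows "(\<Sum>i\<in>UNIV. snd (init_point P F v) $ i) = of_int (fst (multideg v))"
    and "fst (init_point P F v) $ i + snd (init_point P F v) $ i =
      of_int (fst (multideg v) - snd (multideg v) $ i)"
proof -
  have "form d (fst D) (F D j)" if "VD D j \<in> gvars d" for D j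
  proof -
    have D: "D \<in> eff_deg_one d" "fst D > 0" "j \<in> {1..h0 d D}" using that by (auto simp: gvars_def)
    then have "mp.span (F D ` {1..h0 d D}) = linsys d P D"
      using KD by (auto simp: KD_data_def linsys_bases_def)
    then have "F D j \<in> linsys d P D" using D(3) by (metis imageI mp.span_base)
    then show ?thesis by (simp add: linsys_iff)
  qed
  note homog = phi_var_homog[OF v this]
  let ?\<alpha> = "exponent (init0 (phi_var P F v))"
  have "phi_var P F v \<noteq> 0 \<and> is_monomial (init0 (phi_var P F v))"
    using KD v by (auto simp: KD_data_def khovanskii_basis_def)
  then have "?\<alpha> \<in> Poly_Mapping.keys (phi_var P F v)" by (simp add: exponent_mem_keys)
  then have "y_degree ?\<alpha> = fst (multideg v)" "xy_degree i ?\<alpha> = fst (multideg v) - snd (multideg v) $ i"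
    using homog by (auto simp: homog_def)
  moreover have "(\<Sum>i\<in>UNIV. snd (init_point P F v) $ i) = of_int (y_degree ?\<alpha>)"
    "fst (init_point P F v) $ i + snd (init_point P F v) $ i = of_int (xy_degree i ?\<alpha>)"
    by (simp_all add: init_point_def Let_def y_degree_def xy_degree_def)
  ultimately show "(\<Sum>i\<in>UNIV. snd (init_point P F v) $ i) = of_int (fst (multideg v))"
    "fst (init_point P F v) $ i + snd (init_point P F v) $ i =
      of_int (fst (multideg v) - snd (multideg v) $ i)"
    by simp_all
qed

text \<open>
  An exponent vector \<open>(x, y)\<close> of multidegree \<open>[n\<^sub>0, \<dots>, n\<^sub>k]\<close> satisfies \<open>n\<^sub>0 = \<Sum>\<^sub>i y\<^sub>i\<close> and
  \<open>n\<^sub>i = x\<^sub>i + y\<^sub>i\<close>; the coefficients come from inserting this into the Mukai form.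
\<close>

definition mukai_functional :: "nat \<Rightarrow> 'n::finite divcls \<Rightarrow> (real ^ 'n) \<times> (real ^ 'n)" where
  "mukai_functional d D = (\<chi> j. of_int (snd D $ j),
     \<chi> j. of_int ((int d - 1) * fst D - (\<Sum>i\<in>UNIV. snd D $ i) + snd D $ j))"

lemma mukai_functional_init_point:
  assumes KD: "KD_data d P F" and v: "v \<in> gvars d"
  shows "mukai_functional d D \<bullet> init_point P F v = of_int (mukai_form d D (multideg v))"
proof -
  let ?x = "fst (init_point P F v)" and ?y = "snd (init_point P F v)"
  let ?G = "multideg v"
  let ?s = "(int d - 1) * fst D - (\<Sum>i\<in>UNIV. snd D $ i)"
  have "mukai_functional d D \<bullet> init_point P F v =
      (\<Sum>j\<in>UNIV. of_int (snd D $ j) * ?x $ j) + (\<Sum>j\<in>UNIV. of_int (?s + snd D $ j) * ?y $ j)"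
    by (simp add: mukai_functional_def inner_prod_def inner_vec_def)
  also have "\<dots> = (\<Sum>j\<in>UNIV. of_int (snd D $ j) * (?x $ j + ?y $ j)) + of_int ?s * (\<Sum>j\<in>UNIV. ?y $ j)"
    unfolding sum_distrib_left sum.distrib[symmetric]
    by (intro sum.cong refl) (simp add: algebra_simps)
  also have "\<dots> = of_int ((\<Sum>j\<in>UNIV. snd D $ j * (fst ?G - snd ?G $ j)) + ?s * fst ?G)"
    by (simp only: init_point_degree[OF KD v] of_int_add of_int_mult of_int_sum)
  also have "(\<Sum>j\<in>UNIV. snd D $ j * (fst ?G - snd ?G $ j)) + ?s * fst ?G = mukai_form d D ?G"
    by (simp add: mukai_form_def right_diff_distrib left_diff_distrib sum_subtractf sum_distrib_right)
  finally show ?thesis .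
qed

subsection \<open>Edges of polytopes\<close>

text \<open>A face of the hull of a finite set is the hull of a subset, which here must lie in the
  supporting hyperplane.\<close>

lemma face_of_convex_hull_functional:
  fixes S :: "'a::euclidean_space set"
  assumes "finite S" "\<And>x. x \<in> S \<Longrightarrow> u \<bullet> x \<ge> c"
  shows "convex hull {x\<in>S. u \<bullet> x = c} face_of convex hull S"
proof -
  let ?T = "convex hull S \<inter> {x. u \<bullet> x = c}"
  have "convex hull S \<subseteq> {x. u \<bullet> x \<ge> c}"
    using assms(2) by (intro hull_minimal convex_halfspace_ge) auto
  then have T: "?T face_of convex hull S"
    by (intro face_of_Int_supporting_hyperplane_ge) auto
  then obtain S' where S': "S' \<subseteq> S" "?T = convex hull S'"
    using face_of_convex_hull_subset[OF finite_imp_compact[OF assms(1)]] by metis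
  have "S' \<subseteq> {x\<in>S. u \<bullet> x = c}"
    using S' hull_subset[of S' convex] by auto
  then have "?T \<subseteq> convex hull {x\<in>S. u \<bullet> x = c}"
    unfolding S'(2) by (rule hull_mono)
  moreover have "convex hull {x\<in>S. u \<bullet> x = c} \<subseteq> ?T"
    by (rule hull_minimal) (auto intro: hull_inc convex_Int convex_hyperplane)
  ultimately show ?thesis using T by auto
qed

text \<open>Among the faces that contain \<open>v\<close> and differ from \<open>{v}\<close>, one of
  least dimension has a facet through \<open>v\<close>. By minimality this facet is
  \<open>{v}\<close>, so the face has dimension one.\<close>

lemma extreme_point_in_edge:
  fixes Q :: "'a::euclidean_space set"
  assumes Q: "polytope Q" and v: "v extreme_point_of Q" and ne: "Q \<noteq> {v}"
  shows "\<exists>w. closed_segment v w edge_of Q"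
proof -
  let ?P = "\<lambda>F. F face_of Q \<and> v \<in> F \<and> F \<noteq> {v}"
  have "?P Q" using v ne Q by (auto simp: extreme_point_of_def polytope_imp_convex face_of_refl)
  then obtain F where F: "?P F" and min: "\<And>G. ?P G \<Longrightarrow> nat (aff_dim F) \<le> nat (aff_dim G)"
    using ex_has_least_nat[of ?P Q "\<lambda>F. nat (aff_dim F)"] by blast
  have polyF: "polytope F" using face_of_polytope_polytope[OF Q] F by blast
  have vF: "v extreme_point_of F" using F v extreme_point_of_face by blast
  have "aff_dim F \<noteq> 0" using F by (auto simp: aff_dim_eq_0)
  moreover have "aff_dim F \<noteq> -1" using F aff_dim_empty[of F] by auto
  ultimately have pos: "aff_dim F \<ge> 1" using aff_dim_geq[of F] by linarith
  obtain G where G: "G facet_of F" "{v} \<subseteq> G"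
    using face_of_polyhedron_subset_facet[OF polytope_imp_polyhedron[OF polyF], of "{v}"] vF F
    by (auto simp: face_of_singleton)
  have dimG: "aff_dim G = aff_dim F - 1" and "G face_of Q"
    using G F by (auto simp: facet_of_def intro: face_of_trans)
  have "G = {v}"
  proof (rule ccontr)
    assume "G \<noteq> {v}"
    then have "?P G" using G \<open>G face_of Q\<close> by auto
    from min[OF this] pos show False using dimG by simp
  qed
  then have dim: "aff_dim F = 1" using dimG by simp
  obtain a b where ab: "F = closed_segment a b"
  proof (rule compact_convex_collinear_segment[of F])
    show "F \<noteq> {}" "compact F" "convex F" "collinear F"
      using F polyF dim by (auto simp: polytope_imp_compact polytope_imp_convex collinear_aff_dim)
  qed
  then have "v = a \<or> v = b" using vF by (simp add: extreme_point_of_segment)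
  then have "F = closed_segment v b \<or> F = closed_segment v a" using ab by (auto simp: closed_segment_commute)
  moreover have "F edge_of Q" using F dim by (simp add: edge_of_def)
  ultimately show ?thesis by metis
qed

lemma edge_endpoints_extreme:
  "closed_segment u v edge_of Q \<Longrightarrow> u extreme_point_of Q \<and> v extreme_point_of Q"
  using extreme_point_of_face[of "closed_segment u v" Q]
  by (auto simp: edge_of_def extreme_point_of_segment)

lemma finite_extreme_points_convex_hull:
  "finite S \<Longrightarrow> finite {v. v extreme_point_of convex hull S}"
  by (rule finite_subset[of _ S]) (auto dest: extreme_point_of_convex_hull)

text \<open>Makes the comparison of edge numbers meaningful, since \<open>card\<close> is 0 on
  infinite sets.\<close>

lemma finite_edges_convex_hull:
  assumes "finite S"
  shows "finite (snd (vertex_edge_graph (convex hull S)))"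
proof (rule finite_subset)
  let ?V = "{v. v extreme_point_of convex hull S}"
  show "snd (vertex_edge_graph (convex hull S)) \<subseteq> Pow ?V"
    by (auto simp: vertex_edge_graph_def dest: edge_endpoints_extreme)
qed (simp add: finite_extreme_points_convex_hull assms)

subsection \<open>Mukai edges are edges of KD polytopes\<close>

lemma VE_mem_gvars: "VE i \<in> gvars d"
  by (simp add: gvars_def)

lemma VD_mem_gvars: "VD D j \<in> gvars d \<longleftrightarrow> D \<in> eff_deg_one d \<and> fst D > 0 \<and> j \<in> {1..h0 d D}"
  by (cases D) (auto simp: gvars_def)

lemma edge_mem_vertex_edge_graph:
  "closed_segment u v edge_of Q \<Longrightarrow> {u, v} \<in> snd (vertex_edge_graph Q)"
  by (auto simp: vertex_edge_graph_def)

lemma multideg_mem_eff_deg_one: "d \<ge> 2 \<Longrightarrow> v \<in> gvars d \<Longrightarrow> multideg v \<in> eff_deg_one d"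
  by (auto simp: gvars_def exc_mem_eff_deg_one)

lemma multideg_eq_of_init_point_eq:
  assumes KD: "KD_data d P F" and v: "v \<in> gvars d" and w: "w \<in> gvars d"
    and eq: "init_point P F v = init_point P F w"
  shows "multideg v = multideg w"
proof -
  have "real_of_int (fst (multideg v)) = of_int (fst (multideg w))"
    using init_point_degree(1)[OF KD v] init_point_degree(1)[OF KD w] by (simp add: eq)
  then have fst: "fst (multideg v) = fst (multideg w)" by simp
  have "real_of_int (fst (multideg v) - snd (multideg v) $ i) =
      of_int (fst (multideg w) - snd (multideg w) $ i)" for i
    using init_point_degree(2)[OF KD v, of i] init_point_degree(2)[OF KD w, of i] by (simp only: eq)
  then have "snd (multideg v) $ i = snd (multideg w) $ i" for i
    using fst by (metis diff_left_imp_eq of_int_eq_iff)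
  with fst show ?thesis by (simp add: prod_eq_iff vec_eq_iff)
qed

context finite_type
begin

lemma finite_gvars: "finite (gvars d :: 'n gvar set)"
proof -
  have "{VD D j | D j. D \<in> eff_deg_one d \<and> fst D > 0 \<and> j \<in> {1..h0 d D}} \<subseteq>
      (\<lambda>(D, j). VD D j) ` (SIGMA D:eff_deg_one d. {1..h0 d D})"
    by auto
  then have "finite {VD D j :: 'n gvar | D j. D \<in> eff_deg_one d \<and> fst D > 0 \<and> j \<in> {1..h0 d D}}"
    by (rule finite_subset) (intro finite_imageI finite_SigmaI finite_eff_deg_one; simp)
  then show ?thesis by (simp add: gvars_def)
qed

text \<open>Justifies the \<open>THE\<close> in \<open>class_point\<close>: variables
  \<open>VD\<close> have positive degree, which separates them from the \<open>VE\<close>, and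
  \<open>h0 = 1\<close> leaves only the index 1.\<close>

lemma unique_generator:
  fixes D :: "'n divcls"
  assumes "D \<in> eff_deg_one d" "h0 d D = 1"
  shows "\<exists>!v. v \<in> gvars d \<and> multideg v = D"
proof (cases "fst D = 0")
  case True
  then obtain i where i: "D = exc i" using eff_deg_one_fst_zero[OF d assms(1)] by blast
  have "v = VE i" if "v \<in> gvars d" "multideg v = D" for v
    using that True by (cases v) (auto simp: VD_mem_gvars i exc_eq_iff)
  then show ?thesis by (intro ex1I[of _ "VE i"]) (auto simp: VE_mem_gvars i)
next
  case False
  then have pos: "fst D > 0" using eff_deg_one_fst_nonneg[OF assms(1)] by simp
  have "v = VD D 1" if "v \<in> gvars d" "multideg v = D" for v
    using that pos assms(2) by (cases v) (auto simp: VD_mem_gvars exc_def)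
  then show ?thesis using assms pos by (intro ex1I[of _ "VD D 1"]) (auto simp: VD_mem_gvars)
qed

end

section \<open>The polytope of a fixed Khovanskii degeneration\<close>

locale KD_setup = finite_type d N for d :: nat and N :: "'n::finite itself" +
  fixes P :: "'n \<Rightarrow> nat \<Rightarrow> ratfun" and F :: "'n divcls \<Rightarrow> nat \<Rightarrow> (nat, ratfun) pol" and a :: 'n
  assumes KD: "KD_data d P F"
begin

abbreviation "V \<equiv> fst (mukai_edge_graph d a)"
abbreviation "S \<equiv> init_point P F ` gvars d"
abbreviation "Q \<equiv> KD_polytope d P F"

lemma Q_eq: "Q = convex hull S"
  by (simp add: KD_polytope_def)

lemma finite_S: "finite S"
  using finite_gvars by simp

definition gen :: "'n divcls \<Rightarrow> 'n gvar" where
  "gen D = (THE v. v \<in> gvars d \<and> multideg v = D)"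

lemma gen:
  assumes "D \<in> V"
  shows "gen D \<in> gvars d" "multideg (gen D) = D" "\<And>v. v \<in> gvars d \<Longrightarrow> multideg v = D \<Longrightarrow> v = gen D"
proof -
  have ex1: "\<exists>!v. v \<in> gvars d \<and> multideg v = D"
    using mukai_edge_graph_vertex[OF assms] by (intro unique_generator) auto
  from theI'[OF this] show "gen D \<in> gvars d" "multideg (gen D) = D" by (auto simp: gen_def)
  with ex1 show "\<And>v. v \<in> gvars d \<Longrightarrow> multideg v = D \<Longrightarrow> v = gen D" by blast
qed

lemma class_point_eq: "class_point d P F D = init_point P F (gen D)"
  by (simp add: class_point_def gen_def)

lemma class_point_mem_S: "D \<in> V \<Longrightarrow> class_point d P F D \<in> S"
  by (simp add: class_point_eq gen(1))

lemma inj_on_class_point: "inj_on (class_point d P F) V"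
proof (rule inj_onI)
  fix D D' assume "D \<in> V" "D' \<in> V" "class_point d P F D = class_point d P F D'"
  then show "D = D'"
    using multideg_eq_of_init_point_eq[OF KD gen(1) gen(1), of D D'] by (simp add: class_point_eq gen(2))
qed

lemma functional_class_point:
  "D' \<in> V \<Longrightarrow> mukai_functional d D \<bullet> class_point d P F D' = of_int (mukai_form d D D')"
  by (simp add: class_point_eq mukai_functional_init_point[OF KD gen(1)] gen(2))

lemma functional_self:
  "D \<in> V \<Longrightarrow> mukai_functional d D \<bullet> class_point d P F D = -1"
  using mukai_edge_graph_vertex by (simp add: functional_class_point)

lemma functional_nonneg:
  assumes D: "D \<in> V" and x: "x \<in> S" and ne: "x \<noteq> class_point d P F D"
  shows "mukai_functional d D \<bullet> x \<ge> 0"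
proof -
  obtain v where v: "v \<in> gvars d" "x = init_point P F v" using x by auto
  then have "multideg v \<noteq> D" using gen(3)[OF D] ne by (auto simp: class_point_eq)
  then have "mukai_form d D (multideg v) \<ge> 0"
    using mukai_edge_graph_vertex[OF D] multideg_mem_eff_deg_one[OF d v(1)]
    by (intro mukai_form_nonneg) auto
  then show ?thesis using v mukai_functional_init_point[OF KD v(1)] by simp
qed

lemma class_point_extreme:
  assumes D: "D \<in> V"
  shows "class_point d P F D extreme_point_of Q"
proof -
  let ?u = "mukai_functional d D" and ?p = "class_point d P F D"
  have ge: "?u \<bullet> x \<ge> -1" if "x \<in> S" for x
    using functional_nonneg[OF D that] functional_self[OF D] by (cases "x = ?p") auto
  have "{x\<in>S. ?u \<bullet> x = -1} = {?p}"
    using functional_nonneg[OF D] functional_self[OF D] class_point_mem_S[OF D] by fastforce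
  then have "{?p} face_of Q"
    using face_of_convex_hull_functional[OF finite_S ge] by (simp add: Q_eq)
  then show ?thesis by (simp add: face_of_singleton)
qed

lemma class_point_edge:
  assumes D: "D \<in> V" "D' \<in> V" and adj: "mukai_adj d D D'"
  shows "closed_segment (class_point d P F D) (class_point d P F D') edge_of Q"
proof -
  let ?u = "mukai_functional d D + mukai_functional d D'"
  let ?p = "class_point d P F D" and ?p' = "class_point d P F D'"
  have ne: "D \<noteq> D'" and form: "mukai_form d D D' = 0" using adj by (auto simp: mukai_adj_def)
  then have pp: "?p \<noteq> ?p'" using inj_on_class_point D by (auto dest: inj_onD)
  have form': "mukai_form d D' D = 0" using form by (simp add: mukai_form_def mult_ac)
  \<comment> \<open>At each of the two points one summand gives -1 and the other gives 0.\<close>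
  have at: "?u \<bullet> ?p = -1" "?u \<bullet> ?p' = -1"
    using D form form' by (simp_all add: inner_add_left functional_self functional_class_point)
  have nn: "?u \<bullet> x \<ge> 0" if "x \<in> S" "x \<noteq> ?p" "x \<noteq> ?p'" for x
    using functional_nonneg[OF D(1) that(1,2)] functional_nonneg[OF D(2) that(1,3)]
    by (simp add: inner_add_left)
  have ge: "?u \<bullet> x \<ge> -1" if "x \<in> S" for x
    using nn[OF that] at by (cases "x = ?p"; cases "x = ?p'") auto
  have "{x\<in>S. ?u \<bullet> x = -1} = {?p, ?p'}"
    using nn at class_point_mem_S[OF D(1)] class_point_mem_S[OF D(2)] by fastforce
  then have "closed_segment ?p ?p' face_of Q"
    using face_of_convex_hull_functional[OF finite_S ge] by (simp add: Q_eq segment_convex_hull)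
  moreover have "aff_dim (closed_segment ?p ?p') = 1"
    using pp by (simp add: segment_convex_hull aff_dim_convex_hull)
  ultimately show ?thesis by (simp add: edge_of_def)
qed

lemma subgraph_relabel:
  "subgraph (relabel (class_point d P F) (mukai_edge_graph d a)) (vertex_edge_graph Q)"
proof -
  have "(\<lambda>e. class_point d P F ` e) ` snd (mukai_edge_graph d a) \<subseteq> snd (vertex_edge_graph Q)"
  proof
    fix E assume "E \<in> (\<lambda>e. class_point d P F ` e) ` snd (mukai_edge_graph d a)"
    then obtain D D' where "E = {class_point d P F D, class_point d P F D'}"
      "D \<in> V" "D' \<in> V" "mukai_adj d D D'"
      by (auto simp: mukai_edge_graph_def Let_def)
    then show "E \<in> snd (vertex_edge_graph Q)"
      using class_point_edge[of D D'] by (simp add: edge_mem_vertex_edge_graph)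
  qed
  then show ?thesis
    by (auto simp: subgraph_def relabel_def vertex_edge_graph_def class_point_extreme)
qed

lemma mukai_edges_subset: "snd (mukai_edge_graph d a) \<subseteq> Pow V"
  by (auto simp: mukai_edge_graph_def Let_def)

lemma finite_polytope_edges: "finite (snd (vertex_edge_graph Q))"
  unfolding Q_eq by (rule finite_edges_convex_hull[OF finite_S])

lemma card_relabel_edges:
  "card (snd (relabel (class_point d P F) (mukai_edge_graph d a))) = card (snd (mukai_edge_graph d a))"
proof -
  have "inj_on (\<lambda>e. class_point d P F ` e) (Pow V)"
    by (rule inj_on_image_Pow[OF inj_on_class_point])
  then show ?thesis
    using mukai_edges_subset by (simp add: relabel_def card_image inj_on_subset)
qed

text \<open>Excludes the degenerate polytope whose only vertex lies on no edge: two exceptional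
  classes give two different points.\<close>

lemma polytope_not_singleton: "Q \<noteq> {v}"
proof
  assume Q: "Q = {v}"
  have "UNIV \<noteq> {a}"
  proof
    assume "UNIV = {a}"
    then have "CARD('n) = card {a}" by simp
    then show False using k by simp
  qed
  then obtain b where b: "b \<noteq> a" by blast
  have S: "init_point P F (VE i) = v" for i
    using hull_inc[of "init_point P F (VE i)" S convex] Q by (auto simp: Q_eq gvars_def)
  have "multideg (VE a :: 'n gvar) = multideg (VE b)"
    by (rule multideg_eq_of_init_point_eq[OF KD]) (auto simp: gvars_def S)
  then show False using b by (simp add: exc_eq_iff)
qed

text \<open>For finite edge sets, inclusion and equal size give equality. The vertices follow,
  because each vertex of the polytope is an endpoint of an edge and all edges now join Mukai
  vertices.\<close>

lemma relabel_eq_of_card_eq: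
  assumes "card (snd (vertex_edge_graph Q)) = card (snd (mukai_edge_graph d a))"
  shows "relabel (class_point d P F) (mukai_edge_graph d a) = vertex_edge_graph Q"
proof -
  let ?R = "relabel (class_point d P F) (mukai_edge_graph d a)"
  have sub: "fst ?R \<subseteq> fst (vertex_edge_graph Q)" "snd ?R \<subseteq> snd (vertex_edge_graph Q)"
    using subgraph_relabel by (auto simp: subgraph_def)
  have edges: "snd ?R = snd (vertex_edge_graph Q)"
    by (rule card_subset_eq[OF finite_polytope_edges sub(2)]) (simp add: card_relabel_edges assms)
  have "fst (vertex_edge_graph Q) \<subseteq> fst ?R"
  proof
    fix v assume "v \<in> fst (vertex_edge_graph Q)"
    then have "v extreme_point_of Q" by (simp add: vertex_edge_graph_def)
    moreover have "polytope Q" unfolding Q_eq by (rule polytope_convex_hull[OF finite_S])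
    ultimately obtain w where "closed_segment v w edge_of Q"
      using extreme_point_in_edge polytope_not_singleton by blast
    then have "{v, w} \<in> snd ?R" unfolding edges by (rule edge_mem_vertex_edge_graph)
    then obtain E where "E \<in> snd (mukai_edge_graph d a)" "{v, w} = class_point d P F ` E"
      by (auto simp: relabel_def)
    then have "v \<in> class_point d P F ` V" using mukai_edges_subset by blast
    then show "v \<in> fst ?R" by (simp add: relabel_def)
  qed
  with sub edges show ?thesis by (simp add: prod_eq_iff)
qed

end

text \<open>The number of Mukai edges is a lower bound that does not depend on \<open>P\<close> and
  \<open>F\<close>; a minimal number of edges means that this bound is attained.\<close>

theorem theorem21:
  fixes d :: nat and a :: "'n::finite"
    and P :: "'n \<Rightarrow> nat \<Rightarrow> ratfun"
    and F :: "'n divcls \<Rightarrow> nat \<Rightarrow> (nat, ratfun) pol"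
  assumes "d \<ge> 2" and "CARD('n) \<ge> d + 2"
    and "1 / (real d + 1) + 1 / (real CARD('n) - real d - 1) > 1 / 2"
    and "(CARD('n), d) \<noteq> (8, 4)"
    and "KD_data d P F"
  shows "inj_on (class_point d P F) (fst (mukai_edge_graph d a)) \<and>
    subgraph (relabel (class_point d P F) (mukai_edge_graph d a))
      (vertex_edge_graph (KD_polytope d P F)) \<and>
    card (snd (mukai_edge_graph d a)) \<le> card (snd (vertex_edge_graph (KD_polytope d P F))) \<and>
    (card (snd (vertex_edge_graph (KD_polytope d P F))) = card (snd (mukai_edge_graph d a)) \<longrightarrow>
      relabel (class_point d P F) (mukai_edge_graph d a) =
        vertex_edge_graph (KD_polytope d P F))"
proof -
  interpret KD_setup d "TYPE('n)" P F a
  proof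
    define r where "r = real CARD('n) - real d - 1"
    have "real CARD('n) \<ge> real d + 2" using assms(2) by linarith
    then have r: "r \<ge> 1" by (simp add: r_def)
    have "1 / (real d + 1) + 1 / r > 1 / 2" using assms(3) by (simp add: r_def)
    \<comment> \<open>The factor is positive because k \<ge> d + 2 gives r \<ge> 1.\<close>
    then have "1 / 2 * ((real d + 1) * r) < (1 / (real d + 1) + 1 / r) * ((real d + 1) * r)"
      using r by (intro mult_strict_right_mono) auto
    also have "\<dots> = r + (real d + 1)"
    proof -
      have "(1 / x + 1 / y) * (x * y) = y + x" if "x > 0" "y > 0" for x y :: real
        using that by (simp add: field_simps)
      then show ?thesis using r by simp
    qed
    finally have "(real d + 1) * r < 2 * (r + (real d + 1))" by simp
    then have "(real d - 1) * r < 2 * (real d + 1)" by (simp add: algebra_simps)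
    then have "real_of_int ((int d - 1) * (int CARD('n) - int d - 1)) < real_of_int (2 * (int d + 1))"
      by (simp add: r_def)
    then show "(int d - 1) * (int CARD('n) - int d - 1) < 2 * (int d + 1)"
      by (simp only: of_int_less_iff)
  qed (use assms in auto)
  have "card (snd (mukai_edge_graph d a)) \<le> card (snd (vertex_edge_graph Q))"
    using card_mono[OF finite_polytope_edges, of "snd (relabel (class_point d P F) (mukai_edge_graph d a))"]
      subgraph_relabel by (simp add: subgraph_def card_relabel_edges)
  then show ?thesis
    using inj_on_class_point subgraph_relabel relabel_eq_of_card_eq by blast
qed

end
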